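(* Let $X$ be one of the following real Banach spaces: $c_0$; $C([0,1])$; $\ell_p$ for some $1\leq p<+\infty$; $L_p$ for some $1\leq p<+\infty$. Then a countable group is representable in $X$ if and only if it admits a normal subgroup with two elements.
   Context: A group $H$ is representable in a Banach space $X$ if there exists an equivalent norm on $X$ for which the group of isometries on $X$ (all surjective linear isometries of $X$ onto itself) is isomorphic, as a group, to $H$. Countable means finite or countably infinite. All spaces are over the real scalars, $L_p=L_p([0,1])$. *)

theory Defs
  imports
    "HOL-Analysis.Analysis"
    "HOL-Algebra.Bij"
    "HOL-Algebra.Coset"
    "HOL-Library.Function_Algebras"
begin

text \<open>
  A normed space is given by a linear subspace \<open>V\<close> of a real vector space together with a
  function \<open>N\<close> that is a norm on \<open>V\<close>; the values of \<open>N\<close> outside \<open>V\<close> are irrelevant. This allows the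
  exponent \<open>p\<close> of \<open>\<ell>\<^sub>p\<close> and \<open>L\<^sub>p\<close> to be an ordinary variable.
\<close>

definition norm_on :: "'a::real_vector set \<Rightarrow> ('a \<Rightarrow> real) \<Rightarrow> bool" where
  "norm_on V N \<longleftrightarrow>
     (\<forall>x\<in>V. 0 \<le> N x \<and> (N x = 0 \<longleftrightarrow> x = 0)) \<and>
     (\<forall>x\<in>V. \<forall>c. N (c *\<^sub>R x) = \<bar>c\<bar> * N x) \<and>
     (\<forall>x\<in>V. \<forall>y\<in>V. N (x + y) \<le> N x + N y)"

definition equivalent_norms :: "'a::real_vector set \<Rightarrow> ('a \<Rightarrow> real) \<Rightarrow> ('a \<Rightarrow> real) \<Rightarrow> bool" where
  "equivalent_norms V N M \<longleftrightarrow>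
     (\<exists>a>0. \<exists>b>0. \<forall>x\<in>V. a * N x \<le> M x \<and> M x \<le> b * N x)"

definition linear_isometry_on :: "'a::real_vector set \<Rightarrow> ('a \<Rightarrow> real) \<Rightarrow> ('a \<Rightarrow> 'a) \<Rightarrow> bool" where
  "linear_isometry_on V N T \<longleftrightarrow>
     (\<forall>x\<in>V. \<forall>y\<in>V. T (x + y) = T x + T y) \<and>
     (\<forall>x\<in>V. \<forall>c. T (c *\<^sub>R x) = c *\<^sub>R T x) \<and>
     (\<forall>x\<in>V. N (T x) = N x)"

text \<open>
  The elements of \<^term>\<open>Bij V\<close> are the bijections of \<open>V\<close> onto itself, made \<open>undefined\<close> outside
  \<open>V\<close> so that equality of maps is equality on \<open>V\<close>; an isometry is automatically injective.
\<close>

definition isometry_group :: "'a::real_vector set \<Rightarrow> ('a \<Rightarrow> real) \<Rightarrow> ('a \<Rightarrow> 'a) monoid" where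
  "isometry_group V N = BijGroup V \<lparr>carrier := {T \<in> Bij V. linear_isometry_on V N T}\<rparr>"

lemma group_isometry_group:
  assumes "subspace V"
  shows "group (isometry_group V N)"
  unfolding isometry_group_def
proof (rule subgroup.subgroup_is_group [OF _ group_BijGroup],
    rule group.subgroupI [OF group_BijGroup])
  let ?I = "{T \<in> Bij V. linear_isometry_on V N T}"
  have V: "x + y \<in> V" "c *\<^sub>R x \<in> V" if "x \<in> V" "y \<in> V" for x y c
    using that assms by (auto simp: subspace_def)
  have maps: "T x \<in> V" if "T \<in> Bij V" "x \<in> V" for T x
    using that Bij_imp_funcset by fastforce
  show "?I \<subseteq> carrier (BijGroup V)"
    by (auto simp: BijGroup_def)
  have "(\<lambda>x\<in>V. x) \<in> ?I"
    by (auto simp: id_Bij linear_isometry_on_def V)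
  then show "?I \<noteq> {}"
    by blast
  fix S assume S: "S \<in> ?I"
  then have S': "S \<in> Bij V" and inj: "inj_on S V" and lin: "linear_isometry_on V N S"
    by (auto simp: Bij_def bij_betw_def)
  let ?R = "\<lambda>x\<in>V. inv_into V S x"
  have R: "?R \<in> Bij V"
    using S' by (rule restrict_inv_into_Bij)
  have SR: "S (?R x) = x" if "x \<in> V" for x
    using that S' by (auto simp: Bij_def bij_betw_def f_inv_into_f)
  have RS: "?R (S x) = x" if "x \<in> V" for x
    using that S' inj maps by simp
  have "linear_isometry_on V N ?R"
    unfolding linear_isometry_on_def
  proof (intro conjI ballI allI)
    fix x y c assume x: "x \<in> V"
    have Rx: "?R x \<in> V" using maps [OF R] x .
    have "N (S (?R x)) = N (?R x)"
      using lin Rx unfolding linear_isometry_on_def by blast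
    then show "N (?R x) = N x"
      unfolding SR [OF x] by (rule sym)
    have "S (c *\<^sub>R ?R x) = c *\<^sub>R S (?R x)"
      using lin Rx unfolding linear_isometry_on_def by blast
    then show "?R (c *\<^sub>R x) = c *\<^sub>R ?R x"
      using RS [OF V(2) [OF Rx Rx, of c]] unfolding SR [OF x] by (rule subst)
    assume y: "y \<in> V"
    have Ry: "?R y \<in> V" using maps [OF R] y .
    have "S (?R x + ?R y) = S (?R x) + S (?R y)"
      using lin Rx Ry unfolding linear_isometry_on_def by blast
    then show "?R (x + y) = ?R x + ?R y"
      using RS [OF V(1) [OF Rx Ry]] unfolding SR [OF x] SR [OF y] by (rule subst)
  qed
  with R S' show "inv\<^bsub>BijGroup V\<^esub> S \<in> ?I"
    by (simp add: inv_BijGroup)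
  fix T assume T: "T \<in> ?I"
  have "compose V S T \<in> ?I"
    using S T V maps compose_Bij [of S V T]
    by (auto simp: linear_isometry_on_def compose_def)
  with S T show "S \<otimes>\<^bsub>BijGroup V\<^esub> T \<in> ?I"
    by (simp add: BijGroup_def)
qed

definition representable ::
    "('g, 'm) monoid_scheme \<Rightarrow> 'a::real_vector set \<Rightarrow> ('a \<Rightarrow> real) \<Rightarrow> bool" where
  "representable H V N \<longleftrightarrow>
     (\<exists>M. norm_on V M \<and> equivalent_norms V N M \<and> isometry_group V M \<cong> H)"

instantiation "fun" :: (type, real_vector) real_vector
begin

definition scaleR_fun :: "real \<Rightarrow> ('a \<Rightarrow> 'b) \<Rightarrow> 'a \<Rightarrow> 'b" where
  "scaleR_fun c f = (\<lambda>x. c *\<^sub>R f x)"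

instance
  by standard (simp_all add: scaleR_fun_def fun_eq_iff algebra_simps)

end

definition c0_space :: "(nat \<Rightarrow> real) set" where
  "c0_space = {x. x \<longlonglongrightarrow> 0}"

definition c0_norm :: "(nat \<Rightarrow> real) \<Rightarrow> real" where
  "c0_norm x = (SUP n. \<bar>x n\<bar>)"

definition lp_space :: "real \<Rightarrow> (nat \<Rightarrow> real) set" where
  "lp_space p = {x. summable (\<lambda>n. \<bar>x n\<bar> powr p)}"

definition lp_norm :: "real \<Rightarrow> (nat \<Rightarrow> real) \<Rightarrow> real" where
  "lp_norm p x = (\<Sum>n. \<bar>x n\<bar> powr p) powr (1 / p)"

text \<open>A continuous function on \<open>[0,1]\<close> is represented by its extension by \<open>0\<close>.\<close>

definition C01_space :: "(real \<Rightarrow> real) set" where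
  "C01_space = {f. continuous_on {0..1} f \<and> (\<forall>x. x \<notin> {0..1} \<longrightarrow> f x = 0)}"

definition C01_norm :: "(real \<Rightarrow> real) \<Rightarrow> real" where
  "C01_norm f = (SUP x\<in>{0..1}. \<bar>f x\<bar>)"

text \<open>Classes of Lebesgue measurable functions on \<open>[0,1]\<close> modulo equality almost everywhere.\<close>

abbreviation leb01 :: "real measure" where
  "leb01 \<equiv> lebesgue_on {0..1}"

definition ae_equal :: "(real \<Rightarrow> real) \<Rightarrow> (real \<Rightarrow> real) \<Rightarrow> bool" where
  "ae_equal f g \<longleftrightarrow> f \<in> borel_measurable leb01 \<and> g \<in> borel_measurable leb01 \<and>
     (AE x in leb01. f x = g x)"

quotient_type ae_fun = "real \<Rightarrow> real" / partial: ae_equal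
proof (rule part_equivpI)
  show "\<exists>f. ae_equal f f"
    by (rule exI [of _ "\<lambda>_. 0"]) (simp add: ae_equal_def)
  show "symp ae_equal"
    by (rule sympI) (auto simp: ae_equal_def eq_commute)
  show "transp ae_equal"
    by (rule transpI) (auto simp: ae_equal_def elim: eventually_elim2)
qed

instantiation ae_fun :: real_vector
begin

lift_definition zero_ae_fun :: ae_fun is "\<lambda>_. 0"
  by (simp add: ae_equal_def)

lift_definition plus_ae_fun :: "ae_fun \<Rightarrow> ae_fun \<Rightarrow> ae_fun" is "\<lambda>f g x. f x + g x"
  by (auto simp: ae_equal_def)

lift_definition minus_ae_fun :: "ae_fun \<Rightarrow> ae_fun \<Rightarrow> ae_fun" is "\<lambda>f g x. f x - g x"
  by (auto simp: ae_equal_def)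

lift_definition uminus_ae_fun :: "ae_fun \<Rightarrow> ae_fun" is "\<lambda>f x. - f x"
  by (auto simp: ae_equal_def)

lift_definition scaleR_ae_fun :: "real \<Rightarrow> ae_fun \<Rightarrow> ae_fun" is "\<lambda>c f x. c *\<^sub>R f x"
  by (auto simp: ae_equal_def)

instance
  by standard (transfer; auto simp: ae_equal_def algebra_simps)+

end

lift_definition Lp_integrable :: "real \<Rightarrow> ae_fun \<Rightarrow> bool" is
  "\<lambda>p f. integrable leb01 (\<lambda>x. \<bar>f x\<bar> powr p)"
  by (rule integrable_cong_AE) (auto simp: ae_equal_def)

definition Lp_space :: "real \<Rightarrow> ae_fun set" where
  "Lp_space p = {f. Lp_integrable p f}"

lift_definition Lp_norm :: "real \<Rightarrow> ae_fun \<Rightarrow> real" is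
  "\<lambda>p f. (\<integral>x. \<bar>f x\<bar> powr p \<partial>leb01) powr (1 / p)"
  by (rule arg_cong [where f = "\<lambda>t. t powr _"], rule integral_cong_AE) (auto simp: ae_equal_def)

end

theory Submission
  imports Defs
begin

text \<open>
  One direction is immediate: \<open>-1\<close> is a central isometry of order two for every norm, and a
  normal subgroup with two elements is the same thing as a central involution.

  For the converse let \<open>j\<close> be a central involution of the countable group \<open>H\<close>. Each of the four
  spaces splits into a sequence of blocks that may be permuted arbitrarily, with arbitrary signs,
  by isometries of an equivalent norm. Indexing the blocks by pairs of a coset of \<open>{1, j}\<close> and a
  natural number, and reading a vector as a function on \<open>H\<close> that changes sign under \<open>j\<close>, one lets
  \<open>H\<close> act by translation, so that \<open>j\<close> acts as \<open>-1\<close>. It remains to destroy all other isometries.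

  To that end the unit ball is cut by countably many hyperplanes. Let \<open>\<phi>\<close> and \<open>\<psi>\<close> be coordinates
  of two different blocks and let \<open>\<gamma>\<^sub>1, \<gamma>\<^sub>2, \<dots>\<close> be all coordinates. For rapidly decreasing
  \<open>s\<^sub>1 > s\<^sub>2 > \<dots>\<close> the functionals \<open>(1 - s\<^sub>n\<^sup>2) \<phi> + s\<^sub>n \<psi> + c s\<^sub>n\<^sup>2 \<gamma>\<^sub>n\<close> lie close to a parabola
  in the plane of \<open>\<phi>\<close> and \<open>\<psi>\<close>; as points of a strictly convex curve each of them dominates all the
  others in some direction, and this survives the perturbation by \<open>\<gamma>\<^sub>n\<close>. The new norm is the maximum
  of a multiple of a norm that is nowhere flat and of the moduli of these functionals and their
  translates under \<open>H\<close>. The linear functionals which agree with the new norm on a nonempty open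
  set are therefore translates of the given ones and, possibly, of their limit \<open>\<phi>\<close>, and all the
  given ones do occur (\<open>flat_imp_spike\<close>, \<open>flat_spike\<close>).

  An isometry \<open>T\<close> permutes the functionals of this kind. Those derived from one \<open>h\<close> in \<open>H\<close> are
  close together and far from those derived from another one, so that \<open>T\<close>, once composed with an
  element of \<open>H\<close>, preserves the family of the untranslated functionals. The distance between the
  members \<open>n\<close> and \<open>n + 1\<close> of the family is about \<open>s\<^sub>n\<close>, so each member is fixed. Letting \<open>n\<close> tend
  to infinity one recovers \<open>\<phi>\<close>, then \<open>\<psi>\<close>, then every \<open>\<gamma>\<^sub>n\<close>; all of these are fixed, and since the
  \<open>\<gamma>\<^sub>n\<close> separate points, \<open>T\<close> belongs to \<open>H\<close> (\<open>isometry_is_action\<close>). The suprema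
  over \<open>H\<close> are maxima, because every coordinate tends to zero along orbits.
\<close>

section \<open>Central involutions and the isometry -1\<close>

definition central_involution :: "('g, 'm) monoid_scheme \<Rightarrow> 'g \<Rightarrow> bool" where
  "central_involution G j \<longleftrightarrow> j \<in> carrier G \<and> j \<noteq> \<one>\<^bsub>G\<^esub> \<and> j \<otimes>\<^bsub>G\<^esub> j = \<one>\<^bsub>G\<^esub> \<and>
     (\<forall>x\<in>carrier G. j \<otimes>\<^bsub>G\<^esub> x = x \<otimes>\<^bsub>G\<^esub> j)"

lemma normal_subgroup_card_2_iff_central_involution:
  assumes "group G"
  shows "(\<exists>N. N \<lhd> G \<and> card N = 2) \<longleftrightarrow>
    (\<exists>j. central_involution G j)"
proof -
  interpret group G by fact
  show ?thesis
  proof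
    assume "\<exists>N. N \<lhd> G \<and> card N = 2"
    then obtain N where N: "N \<lhd> G" "card N = 2" by blast
    interpret normal N G by fact
    obtain j where j: "N = {\<one>\<^bsub>G\<^esub>, j}" "j \<noteq> \<one>\<^bsub>G\<^esub>"
    proof -
      obtain x y where "N = {x, y}" "x \<noteq> y" using N(2) by (auto simp: card_2_iff)
      then show thesis using that[of x] that[of y] one_closed by (cases "x = \<one>\<^bsub>G\<^esub>") auto
    qed
    have jN: "j \<in> N" by (subst j(1)) simp
    then have jG: "j \<in> carrier G" by (rule mem_carrier)
    have "j \<otimes>\<^bsub>G\<^esub> j \<in> N" using jN jN by (rule m_closed)
    then have jj: "j \<otimes>\<^bsub>G\<^esub> j = \<one>\<^bsub>G\<^esub>" using j jG by auto
    have "j \<otimes>\<^bsub>G\<^esub> x = x \<otimes>\<^bsub>G\<^esub> j" if x: "x \<in> carrier G" for x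
    proof -
      have "x \<otimes>\<^bsub>G\<^esub> j \<otimes>\<^bsub>G\<^esub> inv\<^bsub>G\<^esub> x \<in> N" using x jN by (rule inv_op_closed2)
      moreover have "x \<otimes>\<^bsub>G\<^esub> j \<otimes>\<^bsub>G\<^esub> inv\<^bsub>G\<^esub> x \<noteq> \<one>\<^bsub>G\<^esub>"
      proof
        assume "x \<otimes>\<^bsub>G\<^esub> j \<otimes>\<^bsub>G\<^esub> inv\<^bsub>G\<^esub> x = \<one>\<^bsub>G\<^esub>"
        then have "x \<otimes>\<^bsub>G\<^esub> j = x" using x jG by (simp add: inv_solve_right')
        then show False using j x jG by simp
      qed
      ultimately have "x \<otimes>\<^bsub>G\<^esub> j \<otimes>\<^bsub>G\<^esub> inv\<^bsub>G\<^esub> x = j" using j by simp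
      then show ?thesis using x jG by (simp add: inv_solve_right')
    qed
    with j jG jj show "\<exists>j. central_involution G j" unfolding central_involution_def by blast
  next
    assume "\<exists>j. central_involution G j"
    then obtain j where j: "j \<in> carrier G" "j \<noteq> \<one>\<^bsub>G\<^esub>" "j \<otimes>\<^bsub>G\<^esub> j = \<one>\<^bsub>G\<^esub>"
      and comm: "\<And>x. x \<in> carrier G \<Longrightarrow> j \<otimes>\<^bsub>G\<^esub> x = x \<otimes>\<^bsub>G\<^esub> j"
      unfolding central_involution_def by blast
    have "inv\<^bsub>G\<^esub> j = j" using j by (simp add: inv_equality)
    then have "subgroup {\<one>\<^bsub>G\<^esub>, j} G" using j by (intro subgroupI) auto
    moreover have "x \<otimes>\<^bsub>G\<^esub> j \<otimes>\<^bsub>G\<^esub> inv\<^bsub>G\<^esub> x = j" if "x \<in> carrier G" for x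
      using that j comm[OF that, symmetric] by (simp add: m_assoc)
    ultimately have "{\<one>\<^bsub>G\<^esub>, j} \<lhd> G" by (auto simp: normal_inv_iff)
    then show "\<exists>N. N \<lhd> G \<and> card N = 2" using j by (intro exI[of _ "{\<one>\<^bsub>G\<^esub>, j}"]) simp
  qed
qed

text \<open>
  The map \<open>-1\<close> is linear and isometric for every norm, commutes with linear maps, and differs from
  the identity as soon as the space is nonzero.
\<close>
lemma representable_imp_central_involution:
  assumes "group H" and V: "subspace V" and v: "v \<in> V" "v \<noteq> 0" and "representable H V N"
  shows "\<exists>j. central_involution H j"
proof -
  obtain M where M: "norm_on V M" and iso: "isometry_group V M \<cong> H"
    using assms by (auto simp: representable_def)
  let ?G = "isometry_group V M"
  interpret H: group H by fact
  interpret G: group ?G by (rule group_isometry_group[OF V])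
  obtain \<Theta> where \<Theta>: "\<Theta> \<in> hom ?G H" "bij_betw \<Theta> (carrier ?G) (carrier H)"
    using iso by (auto simp: is_iso_def iso_def)
  interpret \<Theta>: group_hom ?G H \<Theta>
    by (unfold_locales) (rule \<Theta>(1))
  define T where "T = (\<lambda>x\<in>V. - x)"
  have neg: "- x \<in> V" if "x \<in> V" for x using V that by (rule subspace_neg)
  have "bij_betw T V V"
    by (rule bij_betwI[where g = T]) (auto simp: T_def neg)
  moreover have "M (- x) = M x" if "x \<in> V" for x
  proof -
    have "M (-1 *\<^sub>R x) = \<bar>-1\<bar> * M x" using M that unfolding norm_on_def by blast
    then show ?thesis by simp
  qed
  ultimately have T: "T \<in> carrier ?G"
    using V by (auto simp: isometry_group_def Bij_def linear_isometry_on_def T_def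
        bij_betw_def subspace_add subspace_scale)
  have T_app: "T x = - x" if "x \<in> V" for x using that by (simp add: T_def)
  have mult: "S \<otimes>\<^bsub>?G\<^esub> S' = compose V S S'" if "S \<in> carrier ?G" "S' \<in> carrier ?G" for S S'
    using that by (auto simp: isometry_group_def BijGroup_def)
  have one: "\<one>\<^bsub>?G\<^esub> = (\<lambda>x\<in>V. x)" by (simp add: isometry_group_def BijGroup_def)
  have TT: "T \<otimes>\<^bsub>?G\<^esub> T = \<one>\<^bsub>?G\<^esub>"
    unfolding mult[OF T T] one by (auto simp: compose_def T_app neg fun_eq_iff)
  have T1: "T \<noteq> \<one>\<^bsub>?G\<^esub>"
  proof
    assume "T = \<one>\<^bsub>?G\<^esub>"
    then have "- v = v" using T_app[OF v(1)] v by (simp add: one)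
    then have "2 *\<^sub>R v = 0" by (metis add.right_inverse scaleR_2)
    then show False using v(2) by simp
  qed
  have comm: "T \<otimes>\<^bsub>?G\<^esub> S = S \<otimes>\<^bsub>?G\<^esub> T" if S: "S \<in> carrier ?G" for S
  proof -
    have "S x \<in> V" "S (- x) = - S x" if x: "x \<in> V" for x
    proof -
      show "S x \<in> V" using S x by (auto simp: isometry_group_def Bij_def bij_betw_def)
      have "\<forall>c. S (c *\<^sub>R x) = c *\<^sub>R S x"
        using S x by (simp add: isometry_group_def linear_isometry_on_def)
      then have "S ((-1) *\<^sub>R x) = (-1) *\<^sub>R S x" by blast
      then show "S (- x) = - S x" by (simp only: scaleR_minus1_left)
    qed
    then show ?thesis
      unfolding mult[OF T S] mult[OF S T] by (auto simp: compose_def T_app fun_eq_iff)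
  qed
  have "central_involution H (\<Theta> T)"
    unfolding central_involution_def
  proof (intro conjI ballI)
    show "\<Theta> T \<in> carrier H" using T by simp
    show "\<Theta> T \<noteq> \<one>\<^bsub>H\<^esub>"
    proof
      assume "\<Theta> T = \<one>\<^bsub>H\<^esub>"
      then have "\<Theta> T = \<Theta> \<one>\<^bsub>?G\<^esub>" by simp
      then show False using \<Theta>(2) T T1 by (auto simp: bij_betw_def inj_on_def)
    qed
    show "\<Theta> T \<otimes>\<^bsub>H\<^esub> \<Theta> T = \<one>\<^bsub>H\<^esub>" using T TT \<Theta>.hom_mult[of T T] by simp
    fix y assume "y \<in> carrier H"
    then obtain S where S: "S \<in> carrier ?G" "y = \<Theta> S" using \<Theta>(2) by (auto simp: bij_betw_def)
    then show "\<Theta> T \<otimes>\<^bsub>H\<^esub> y = y \<otimes>\<^bsub>H\<^esub> \<Theta> T"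
      using T comm[OF S(1)] \<Theta>.hom_mult[of T S] \<Theta>.hom_mult[of S T] by simp
  qed
  then show ?thesis ..
qed

section \<open>Functionals, suprema of seminorms and equivalent norms\<close>

definition functional_on :: "'a::real_vector set \<Rightarrow> ('a \<Rightarrow> real) \<Rightarrow> bool" where
  "functional_on V f \<longleftrightarrow>
     (\<forall>x\<in>V. \<forall>y\<in>V. f (x + y) = f x + f y) \<and> (\<forall>x\<in>V. \<forall>c. f (c *\<^sub>R x) = c * f x)"

text \<open>
  This is how suprema along an orbit of an infinite group become maxima: only finitely many values
  exceed half of a given positive value.
\<close>
lemma attains_maximum:
  fixes b :: "'i \<Rightarrow> real"
  assumes "I \<noteq> {}" and nonneg: "\<And>i. i \<in> I \<Longrightarrow> 0 \<le> b i"
    and fin: "\<And>e. e > 0 \<Longrightarrow> finite {i \<in> I. b i > e}"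
  obtains i where "i \<in> I" "\<And>k. k \<in> I \<Longrightarrow> b k \<le> b i"
proof (cases "\<exists>i\<in>I. b i > 0")
  case True
  then obtain i0 where i0: "i0 \<in> I" "b i0 > 0" by blast
  define F where "F = {i \<in> I. b i > b i0 / 2}"
  have F: "finite F" "i0 \<in> F"
    using i0 fin[of "b i0 / 2"] by (auto simp: F_def)
  have "Max (b ` F) \<in> b ` F"
    using F by (intro Max_in) auto
  then obtain i where i: "i \<in> F" "b i = Max (b ` F)"
    by auto
  have le: "b k \<le> b i" if "k \<in> F" for k
    using F that i by simp
  show thesis
  proof (rule that)
    show "i \<in> I" using i by (simp add: F_def)
    fix k assume "k \<in> I"
    then show "b k \<le> b i"
      using le[of k] le[of i0] F i0 by (cases "k \<in> F") (auto simp: F_def)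
  qed
next
  case False
  then show thesis
    using assms that by (metis all_not_in_conv not_less order_trans)
qed

lemma convergent_to_member_attains_maximum:
  fixes u :: "nat \<Rightarrow> real"
  assumes "u \<longlonglongrightarrow> u 0"
  obtains m where "\<And>k. u k \<le> u m"
proof (cases "\<exists>k. u k > u 0")
  case True
  then obtain k0 where k0: "u k0 > u 0" by blast
  then have "eventually (\<lambda>k. u k < u k0) sequentially"
    using assms by (simp add: order_tendstoD)
  then obtain K where K: "\<And>k. k \<ge> K \<Longrightarrow> u k < u k0"
    by (auto simp: eventually_sequentially)
  have "Max (u ` {..max K k0}) \<in> u ` {..max K k0}"
    by (intro Max_in) auto
  then obtain m where m: "u m = Max (u ` {..max K k0})"
    by (metis imageE)
  have le: "u k \<le> u m" if "k \<le> max K k0" for k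
    unfolding m using that by (intro Max_ge) auto
  show thesis
  proof (rule that)
    fix k show "u k \<le> u m"
      using le[of k] le[of k0] K[of k] by (cases "k \<le> max K k0") (auto simp: not_le)
  qed
next
  case False
  then show thesis using that by (metis not_less)
qed

text \<open>
  Where the supremum is attained it inherits every inequality from a single seminorm, and no
  boundedness has to be checked.
\<close>
lemma seminorm_SUP:
  fixes p :: "'i \<Rightarrow> 'a::real_vector \<Rightarrow> real" and I :: "'i set"
  defines "Q \<equiv> \<lambda>x. SUP i\<in>I. p i x"
  assumes V: "subspace V"
    and att: "\<And>x. x \<in> V \<Longrightarrow> \<exists>i\<in>I. \<forall>k\<in>I. p k x \<le> p i x"
    and add: "\<And>i x y. i \<in> I \<Longrightarrow> x \<in> V \<Longrightarrow> y \<in> V \<Longrightarrow> p i (x + y) \<le> p i x + p i y"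
    and scale: "\<And>i x c. i \<in> I \<Longrightarrow> x \<in> V \<Longrightarrow> p i (c *\<^sub>R x) = \<bar>c\<bar> * p i x"
  shows "\<And>i x. i \<in> I \<Longrightarrow> x \<in> V \<Longrightarrow> p i x \<le> Q x"
    and "\<And>x. x \<in> V \<Longrightarrow> \<exists>i\<in>I. Q x = p i x"
    and "\<And>x y. x \<in> V \<Longrightarrow> y \<in> V \<Longrightarrow> Q (x + y) \<le> Q x + Q y"
    and "\<And>x c. x \<in> V \<Longrightarrow> Q (c *\<^sub>R x) = \<bar>c\<bar> * Q x"
proof -
  have Q: "\<exists>i\<in>I. Q x = p i x \<and> (\<forall>k\<in>I. p k x \<le> p i x)" if x: "x \<in> V" for x
  proof -
    obtain i where i: "i \<in> I" "\<forall>k\<in>I. p k x \<le> p i x" using att[OF x] by blast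
    then have "Q x = p i x"
      unfolding Q_def by (intro cSup_eq_maximum) auto
    with i show ?thesis by blast
  qed
  show upper: "p i x \<le> Q x" if "i \<in> I" "x \<in> V" for i x
    using Q[OF that(2)] that(1) by auto
  show att': "\<exists>i\<in>I. Q x = p i x" if "x \<in> V" for x
    using Q[OF that] by auto
  show "Q (x + y) \<le> Q x + Q y" if x: "x \<in> V" and y: "y \<in> V" for x y
  proof -
    obtain i where "i \<in> I" "Q (x + y) = p i (x + y)"
      using att' V x y by (meson subspace_add)
    then show ?thesis
      using add[of i x y] upper[of i x] upper[of i y] x y by linarith
  qed
  show "Q (c *\<^sub>R x) = \<bar>c\<bar> * Q x" if x: "x \<in> V" for x c
  proof (rule antisym)
    have cx: "c *\<^sub>R x \<in> V" using V x by (rule subspace_scale)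
    obtain i where i: "i \<in> I" "Q (c *\<^sub>R x) = p i (c *\<^sub>R x)"
      using att'[OF cx] by blast
    then show "Q (c *\<^sub>R x) \<le> \<bar>c\<bar> * Q x"
      using scale[OF i(1) x] upper[OF i(1) x] by (simp add: mult_left_mono)
    obtain k where k: "k \<in> I" "Q x = p k x"
      using att'[OF x] by blast
    then show "\<bar>c\<bar> * Q x \<le> Q (c *\<^sub>R x)"
      using scale[OF k(1) x, of c] upper[OF k(1) cx] by simp
  qed
qed

lemma norm_on_SUP_functionals:
  fixes F :: "'i \<Rightarrow> 'a::real_vector \<Rightarrow> real"
  assumes V: "subspace V" and F: "\<And>i. functional_on V (F i)"
    and bdd: "\<And>x. x \<in> V \<Longrightarrow> bdd_above (range (\<lambda>i. \<bar>F i x\<bar>))"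
    and sep: "\<And>x. x \<in> V \<Longrightarrow> (\<And>i. F i x = 0) \<Longrightarrow> x = 0"
  shows "norm_on V (\<lambda>x. SUP i. \<bar>F i x\<bar>)"
proof -
  let ?N = "\<lambda>x. SUP i. \<bar>F i x\<bar>"
  have add: "F i (x + y) = F i x + F i y" and scale: "F i (c *\<^sub>R x) = c * F i x"
    if "x \<in> V" "y \<in> V" for i x y c
    using F that unfolding functional_on_def by auto
  have upper: "\<bar>F i x\<bar> \<le> ?N x" if "x \<in> V" for i x
    by (rule cSUP_upper[OF _ bdd[OF that]]) simp
  have least: "?N x \<le> B" if "\<And>i. \<bar>F i x\<bar> \<le> B" for x B
    by (rule cSUP_least) (use that in auto)
  show ?thesis
    unfolding norm_on_def
  proof (intro conjI ballI allI)
    fix x assume x: "x \<in> V"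
    show "0 \<le> ?N x" using upper[OF x] by (meson abs_ge_zero order_trans)
    have F0: "F i 0 = 0" for i using scale[of x x i 0] x by simp
    show "?N x = 0 \<longleftrightarrow> x = 0"
    proof
      assume "?N x = 0"
      then have "F i x = 0" for i using upper[OF x, of i] by simp
      then show "x = 0" by (rule sep[OF x])
    qed (simp add: F0)
    have le: "?N (c *\<^sub>R x) \<le> \<bar>c\<bar> * ?N x" if "x \<in> V" for c x
      using upper[OF that] that by (intro least) (simp add: scale abs_mult mult_left_mono)
    show "?N (c *\<^sub>R x) = \<bar>c\<bar> * ?N x" for c
    proof (cases "c = 0")
      case False
      have "?N ((1 / c) *\<^sub>R (c *\<^sub>R x)) \<le> \<bar>1 / c\<bar> * ?N (c *\<^sub>R x)"
        using V x by (intro le) (rule subspace_scale)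
      then have "\<bar>c\<bar> * ?N x \<le> ?N (c *\<^sub>R x)" using False by (simp add: field_simps)
      then show ?thesis using le[OF x, of c] by (rule antisym[rotated])
    qed (simp add: F0)
    fix y assume y: "y \<in> V"
    show "?N (x + y) \<le> ?N x + ?N y"
    proof (rule least)
      fix i show "\<bar>F i (x + y)\<bar> \<le> ?N x + ?N y"
        using upper[OF x, of i] upper[OF y, of i] x y by (simp add: add)
    qed
  qed
qed

lemma equivalent_norms_refl: "equivalent_norms V N N"
  unfolding equivalent_norms_def by (intro exI[of _ "1 :: real"] conjI) auto

lemma equivalent_norms_trans:
  assumes "equivalent_norms V N M" "equivalent_norms V M L"
  shows "equivalent_norms V N L"
proof -
  obtain a b where ab: "a > 0" "b > 0" "\<And>x. x \<in> V \<Longrightarrow> a * N x \<le> M x \<and> M x \<le> b * N x"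
    using assms(1) unfolding equivalent_norms_def by blast
  obtain c d where cd: "c > 0" "d > 0" "\<And>x. x \<in> V \<Longrightarrow> c * M x \<le> L x \<and> L x \<le> d * M x"
    using assms(2) unfolding equivalent_norms_def by blast
  have "(c * a) * N x \<le> L x \<and> L x \<le> (d * b) * N x" if x: "x \<in> V" for x
  proof -
    have "c * (a * N x) \<le> c * M x" "d * M x \<le> d * (b * N x)"
      using ab(3)[OF x] cd(1,2) by (simp_all add: mult_left_mono)
    then show ?thesis using cd(3)[OF x] by (simp only: mult.assoc) linarith
  qed
  then show ?thesis
    unfolding equivalent_norms_def using ab cd by (intro exI[of _ "c * a"] exI[of _ "d * b"] conjI) auto
qed

section \<open>A rapidly decreasing sequence\<close>

text \<open>
  The parameters \<open>s\<^sub>n\<close> of the introduction. The value \<open>0\<close> at index \<open>0\<close> turns the limit of the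
  functionals constructed below into a member of the family. Consecutive values differ by the factor
  \<open>1000\<close>, more than the distortion with which an isometry will be seen to determine them.
\<close>
definition node :: "nat \<Rightarrow> real" where
  "node n = (if n = 0 then 0 else (1 / 1000) ^ n)"

lemma node_0 [simp]: "node 0 = 0"
  by (simp add: node_def)

lemma node_pos: "n \<noteq> 0 \<Longrightarrow> 0 < node n"
  by (simp add: node_def)

lemma node_nonneg: "0 \<le> node n"
  by (simp add: node_def)

lemma node_le: "node n \<le> 1 / 1000"
proof (cases n)
  case (Suc k)
  have "(1 / 1000 :: real) ^ k \<le> 1" by (rule power_le_one) auto
  then show ?thesis using Suc by (simp add: node_def)
qed (simp add: node_def)

lemma node_gap:
  assumes "n < m" "n \<noteq> 0"
  shows "node m \<le> node n / 1000"
proof -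
  have "(1 / 1000 :: real) ^ m \<le> (1 / 1000) ^ Suc n"
    using assms by (intro power_decreasing) auto
  then show ?thesis using assms by (simp add: node_def)
qed

lemma node_separated:
  assumes "m \<noteq> n"
  shows "999 / 1000 * max (node m) (node n) \<le> \<bar>node m - node n\<bar>"
proof -
  have *: "999 / 1000 * max (node m) (node n) \<le> \<bar>node m - node n\<bar>" if "n < m" for m n
    using node_gap[OF that] node_nonneg[of m] node_nonneg[of n] node_pos[of m] that
    by (cases "n = 0") (auto simp: max_def)
  show ?thesis
    using *[of m n] *[of n m] assms by (cases "n < m") (auto simp: max.commute abs_minus_commute)
qed

lemma node_comparable_imp_eq:
  assumes "node m \<le> 64 * node n" "node n \<le> 64 * node m" "n \<noteq> 0"
  shows "m = n"
proof (rule ccontr)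
  assume "m \<noteq> n"
  then consider "n < m" | "m < n" "m \<noteq> 0" | "m = 0" by linarith
  then show False
    using assms node_gap[of n m] node_gap[of m n] node_pos[of n] node_pos[of m] node_nonneg[of m]
    by cases auto
qed

lemma node_tendsto_0: "node \<longlonglongrightarrow> 0"
proof -
  have "(\<lambda>n. (1 / 1000 :: real) ^ n) \<longlonglongrightarrow> 0" by (rule LIMSEQ_power_zero) auto
  moreover have "eventually (\<lambda>n. (1 / 1000 :: real) ^ n = node n) sequentially"
    by (rule eventually_sequentiallyI[of 1]) (simp add: node_def)
  ultimately show ?thesis by (rule Lim_transform_eventually)
qed

section \<open>Spiking the unit ball along an orbit\<close>

text \<open>
  The orbits of the biorthogonal vectors \<open>a\<close> and \<open>b\<close> are invisible to \<open>\<phi>\<close> and \<open>\<psi>\<close> except at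
  \<open>a\<close>, \<open>b\<close>, \<open>- a\<close> and \<open>- b\<close>; this is what distinguishes the functionals from their translates.
  The decay conditions replace compactness: they make suprema over the group maxima.
\<close>
locale spiked_action = group H for H :: "('g, 'm) monoid_scheme" (structure) +
  fixes V :: "'a::real_vector set" and N :: "'a \<Rightarrow> real"
    and j :: 'g and A :: "'g \<Rightarrow> 'a \<Rightarrow> 'a"
    and \<phi> \<psi> :: "'a \<Rightarrow> real" and \<gamma> :: "nat \<Rightarrow> 'a \<Rightarrow> real"
    and a b :: 'a and C :: real
  assumes V: "subspace V" and N: "norm_on V N"
    and j [simp, intro]: "j \<in> carrier H"
    and A_closed [simp, intro]: "\<And>h x. h \<in> carrier H \<Longrightarrow> x \<in> V \<Longrightarrow> A h x \<in> V"
    and A_add: "\<And>h x y. h \<in> carrier H \<Longrightarrow> x \<in> V \<Longrightarrow> y \<in> V \<Longrightarrow> A h (x + y) = A h x + A h y"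
    and A_scale: "\<And>h x c. h \<in> carrier H \<Longrightarrow> x \<in> V \<Longrightarrow> A h (c *\<^sub>R x) = c *\<^sub>R A h x"
    and A_mult: "\<And>g h x. g \<in> carrier H \<Longrightarrow> h \<in> carrier H \<Longrightarrow> x \<in> V \<Longrightarrow> A (g \<otimes> h) x = A g (A h x)"
    and A_one [simp]: "\<And>x. x \<in> V \<Longrightarrow> A \<one> x = x"
    and A_j [simp]: "\<And>x. x \<in> V \<Longrightarrow> A j x = - x"
    and A_norm: "\<And>h x. h \<in> carrier H \<Longrightarrow> x \<in> V \<Longrightarrow> N (A h x) = N x"
    and functionals: "functional_on V \<phi>" "functional_on V \<psi>" "\<And>n. functional_on V (\<gamma> n)"
    and \<phi>_bound: "\<And>x. x \<in> V \<Longrightarrow> \<bar>\<phi> x\<bar> \<le> C * N x"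
    and \<psi>_bound: "\<And>x. x \<in> V \<Longrightarrow> \<bar>\<psi> x\<bar> \<le> C * N x"
    and \<gamma>_bound: "\<And>n x. x \<in> V \<Longrightarrow> \<bar>\<gamma> n x\<bar> \<le> N x"
    and total: "\<And>x. x \<in> V \<Longrightarrow> (\<And>n. \<gamma> n x = 0) \<Longrightarrow> x = 0"
    and \<phi>_decay: "\<And>x e. x \<in> V \<Longrightarrow> e > 0 \<Longrightarrow> finite {h \<in> carrier H. \<bar>\<phi> (A h x)\<bar> > e}"
    and \<psi>_decay: "\<And>x e. x \<in> V \<Longrightarrow> e > 0 \<Longrightarrow> finite {h \<in> carrier H. \<bar>\<psi> (A h x)\<bar> > e}"
    and \<gamma>_decay: "\<And>n x e. x \<in> V \<Longrightarrow> e > 0 \<Longrightarrow> finite {h \<in> carrier H. \<bar>\<gamma> n (A h x)\<bar> > e}"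
    and ab [simp, intro]: "a \<in> V" "b \<in> V" and ab_norm: "N a \<le> 1" "N b \<le> 1"
    and dual [simp]: "\<phi> a = 1" "\<psi> b = 1"
    and \<phi>_b: "\<And>h. h \<in> carrier H \<Longrightarrow> \<phi> (A h b) = 0"
    and \<psi>_a: "\<And>h. h \<in> carrier H \<Longrightarrow> \<psi> (A h a) = 0"
    and \<phi>_a: "\<And>h. h \<in> carrier H \<Longrightarrow> h \<noteq> \<one> \<Longrightarrow> h \<noteq> j \<Longrightarrow> \<phi> (A h a) = 0"
    and \<psi>_b: "\<And>h. h \<in> carrier H \<Longrightarrow> h \<noteq> \<one> \<Longrightarrow> h \<noteq> j \<Longrightarrow> \<psi> (A h b) = 0"
begin

lemma V_closed [simp, intro]:
  "x \<in> V \<Longrightarrow> y \<in> V \<Longrightarrow> x + y \<in> V" "x \<in> V \<Longrightarrow> y \<in> V \<Longrightarrow> x - y \<in> V"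
  "x \<in> V \<Longrightarrow> c *\<^sub>R x \<in> V" "x \<in> V \<Longrightarrow> - x \<in> V" "0 \<in> V"
  using V by (auto intro: subspace_add subspace_diff subspace_scale subspace_neg subspace_0)

lemma functional_onD:
  assumes "functional_on V f" "x \<in> V"
  shows "y \<in> V \<Longrightarrow> f (x + y) = f x + f y" "y \<in> V \<Longrightarrow> f (x - y) = f x - f y"
    "f (c *\<^sub>R x) = c * f x" "f (- x) = - f x"
proof -
  have scale: "f (c *\<^sub>R z) = c * f z" if "z \<in> V" for c z
    using assms that by (auto simp: functional_on_def)
  show "f (c *\<^sub>R x) = c * f x" using scale assms by simp
  show "f (- x) = - f x" using scale[of x "-1"] assms by simp
  show add: "f (x + y) = f x + f y" if "y \<in> V" using assms that by (auto simp: functional_on_def)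
  show "f (x - y) = f x - f y" if "y \<in> V"
  proof -
    have "f (x + - y) = f x + f (- y)"
      using assms that V_closed(4)[of y] unfolding functional_on_def by blast
    then show ?thesis using scale[of y "-1"] that by simp
  qed
qed

lemma N_simps:
  assumes "x \<in> V"
  shows "0 \<le> N x" "N x = 0 \<longleftrightarrow> x = 0" "N (c *\<^sub>R x) = \<bar>c\<bar> * N x"
    "y \<in> V \<Longrightarrow> N (x + y) \<le> N x + N y"
  using N assms by (auto simp: norm_on_def)

lemma A_diff: "h \<in> carrier H \<Longrightarrow> x \<in> V \<Longrightarrow> y \<in> V \<Longrightarrow> A h (x - y) = A h x - A h y"
  using A_add[of h x "- y"] A_scale[of h y "-1"] by simp

lemma A_inv [simp]:
  assumes "h \<in> carrier H" "x \<in> V"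
  shows "A h (A (inv h) x) = x" "A (inv h) (A h x) = x"
  using assms A_mult[of h "inv h" x] A_mult[of "inv h" h x] by simp_all

lemma functional_A:
  assumes "functional_on V f" "h \<in> carrier H"
  shows "functional_on V (\<lambda>x. f (A h x))"
  using assms by (auto simp: functional_on_def A_add A_scale)

text \<open>
  In the coordinates given by \<open>\<phi>\<close> and \<open>\<psi>\<close> the points \<open>(1 - s\<^sup>2, s)\<close> lie on a parabola, whose
  strict convexity makes each member of the family dominant somewhere. The last summand is
  small compared with the margin of this dominance and brings in all of the separating functionals.
\<close>
definition spike :: "nat \<Rightarrow> 'a \<Rightarrow> real" where
  "spike m x = (1 - (node m)\<^sup>2) * \<phi> x + node m * \<psi> x + (node m)\<^sup>2 / 10 * \<gamma> (m - 1) x"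

lemma spike_functional: "functional_on V (spike m)"
  using functionals unfolding functional_on_def spike_def by (auto simp: algebra_simps)

text \<open>
  Euclidean norm of the pair \<open>(\<phi>, \<psi>)\<close>, maximised over the orbit; it supplies the roundness.
\<close>
definition \<rho> :: "'a \<Rightarrow> real" where
  "\<rho> x = (SUP h\<in>carrier H. norm (\<phi> (A h x), \<psi> (A h x)))"

definition round_norm :: "'a \<Rightarrow> real" where
  "round_norm x = N x + \<rho> x"

definition spike_sup :: "'a \<Rightarrow> real" where
  "spike_sup x = (SUP i\<in>carrier H \<times> UNIV. \<bar>spike (snd i) (A (fst i) x)\<bar>)"

definition spiked_norm :: "'a \<Rightarrow> real" where
  "spiked_norm x = max (round_norm x / 4) (spike_sup x)"

lemma \<rho>_max_exists:
  assumes x: "x \<in> V"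
  shows "\<exists>i\<in>carrier H. \<forall>k\<in>carrier H. norm (\<phi> (A k x), \<psi> (A k x)) \<le> norm (\<phi> (A i x), \<psi> (A i x))"
proof (rule attains_maximum[of "carrier H" "\<lambda>h. norm (\<phi> (A h x), \<psi> (A h x))"])
  fix e :: real assume e: "e > 0"
  have "norm (\<phi> (A h x), \<psi> (A h x)) \<le> \<bar>\<phi> (A h x)\<bar> + \<bar>\<psi> (A h x)\<bar>" for h
    using norm_Pair_le[of "\<phi> (A h x)" "\<psi> (A h x)"] by simp
  then have "{h \<in> carrier H. norm (\<phi> (A h x), \<psi> (A h x)) > e}
      \<subseteq> {h \<in> carrier H. \<bar>\<phi> (A h x)\<bar> > e / 2} \<union> {h \<in> carrier H. \<bar>\<psi> (A h x)\<bar> > e / 2}"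
    by (auto simp: not_less) (smt (verit) field_sum_of_halves)
  then show "finite {h \<in> carrier H. norm (\<phi> (A h x), \<psi> (A h x)) > e}"
    using \<phi>_decay[OF x, of "e / 2"] \<psi>_decay[OF x, of "e / 2"] e
    by (meson finite_UnI finite_subset half_gt_zero)
qed (use one_closed in auto)

lemma \<rho>_seminorm:
  shows \<rho>_upper: "h \<in> carrier H \<Longrightarrow> x \<in> V \<Longrightarrow> norm (\<phi> (A h x), \<psi> (A h x)) \<le> \<rho> x"
    and \<rho>_attained: "x \<in> V \<Longrightarrow> \<exists>h\<in>carrier H. \<rho> x = norm (\<phi> (A h x), \<psi> (A h x))"
    and \<rho>_add: "x \<in> V \<Longrightarrow> y \<in> V \<Longrightarrow> \<rho> (x + y) \<le> \<rho> x + \<rho> y"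
    and \<rho>_scale: "x \<in> V \<Longrightarrow> \<rho> (c *\<^sub>R x) = \<bar>c\<bar> * \<rho> x"
proof -
  let ?p = "\<lambda>h x. norm (\<phi> (A h x), \<psi> (A h x))"
  have add: "?p h (x + y) \<le> ?p h x + ?p h y" if "h \<in> carrier H" "x \<in> V" "y \<in> V" for h x y
    using norm_triangle_ineq[of "(\<phi> (A h x), \<psi> (A h x))" "(\<phi> (A h y), \<psi> (A h y))"] that
    by (simp add: A_add functional_onD functionals)
  have scale: "?p h (c *\<^sub>R x) = \<bar>c\<bar> * ?p h x" if "h \<in> carrier H" "x \<in> V" for h x c
    using norm_scaleR[of c "(\<phi> (A h x), \<psi> (A h x))"] that
    by (simp add: A_scale functional_onD functionals)
  note * = seminorm_SUP[of V "carrier H" ?p, OF V \<rho>_max_exists add scale, folded \<rho>_def]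
  show "h \<in> carrier H \<Longrightarrow> x \<in> V \<Longrightarrow> ?p h x \<le> \<rho> x" by (rule *(1))
  show "x \<in> V \<Longrightarrow> \<exists>h\<in>carrier H. \<rho> x = ?p h x" by (rule *(2))
  show "x \<in> V \<Longrightarrow> y \<in> V \<Longrightarrow> \<rho> (x + y) \<le> \<rho> x + \<rho> y" by (rule *(3))
  show "x \<in> V \<Longrightarrow> \<rho> (c *\<^sub>R x) = \<bar>c\<bar> * \<rho> x" by (rule *(4))
qed

lemma \<rho>_nonneg: "x \<in> V \<Longrightarrow> 0 \<le> \<rho> x"
  using \<rho>_upper[of \<one> x] by (smt (verit) norm_ge_zero one_closed)

lemma \<phi>\<psi>_le_\<rho>:
  assumes "x \<in> V"
  shows "\<bar>\<phi> x\<bar> \<le> \<rho> x" "\<bar>\<psi> x\<bar> \<le> \<rho> x"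
  using \<rho>_upper[of \<one> x] assms norm_fst_le[of "\<phi> x" "\<psi> x"] norm_snd_le[of "\<psi> x" "\<phi> x"] by auto

lemma \<rho>_le: "x \<in> V \<Longrightarrow> \<rho> x \<le> 2 * C * N x"
proof -
  assume x: "x \<in> V"
  obtain h where h: "h \<in> carrier H" "\<rho> x = norm (\<phi> (A h x), \<psi> (A h x))"
    using \<rho>_attained[OF x] by blast
  have "\<rho> x \<le> \<bar>\<phi> (A h x)\<bar> + \<bar>\<psi> (A h x)\<bar>"
    using h norm_Pair_le[of "\<phi> (A h x)" "\<psi> (A h x)"] by simp
  also have "\<dots> \<le> C * N (A h x) + C * N (A h x)"
    using h x by (intro add_mono \<phi>_bound \<psi>_bound) auto
  finally show ?thesis using h x by (simp add: A_norm)
qed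

lemma \<rho>_A_le:
  assumes "g \<in> carrier H" "x \<in> V"
  shows "\<rho> (A g x) \<le> \<rho> x"
proof -
  obtain h where h: "h \<in> carrier H" "\<rho> (A g x) = norm (\<phi> (A h (A g x)), \<psi> (A h (A g x)))"
    using \<rho>_attained assms by blast
  then show ?thesis using \<rho>_upper[of "h \<otimes> g" x] assms by (simp add: A_mult)
qed

lemma round_norm_le_imp: "x \<in> V \<Longrightarrow> N x \<le> round_norm x" "x \<in> V \<Longrightarrow> \<rho> x \<le> round_norm x"
  by (auto simp: round_norm_def N_simps \<rho>_nonneg)

lemma spike_le:
  assumes x: "x \<in> V"
  shows "\<bar>spike m x\<bar> \<le> \<bar>\<phi> x\<bar> + \<bar>\<psi> x\<bar> + node m * \<bar>\<gamma> (m - 1) x\<bar>"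
proof -
  have s: "0 \<le> node m" "node m \<le> 1 / 1000" by (rule node_nonneg node_le)+
  have s2: "0 \<le> (node m)\<^sup>2" "(node m)\<^sup>2 \<le> node m" using s by (auto simp: power2_eq_square intro: mult_left_le)
  then have s3: "0 \<le> 1 - (node m)\<^sup>2" using s by linarith
  have "\<bar>spike m x\<bar> \<le> \<bar>(1 - (node m)\<^sup>2) * \<phi> x\<bar> + \<bar>node m * \<psi> x\<bar> + \<bar>(node m)\<^sup>2 / 10 * \<gamma> (m - 1) x\<bar>"
    unfolding spike_def by linarith
  also have "\<dots> = (1 - (node m)\<^sup>2) * \<bar>\<phi> x\<bar> + node m * \<bar>\<psi> x\<bar> + (node m)\<^sup>2 / 10 * \<bar>\<gamma> (m - 1) x\<bar>"
    by (simp add: abs_mult abs_of_nonneg[OF s(1)] abs_of_nonneg[OF s3])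
  also have "\<dots> \<le> 1 * \<bar>\<phi> x\<bar> + 1 * \<bar>\<psi> x\<bar> + node m * \<bar>\<gamma> (m - 1) x\<bar>"
    using s s2 by (intro add_mono mult_right_mono) linarith+
  also have "\<dots> = \<bar>\<phi> x\<bar> + \<bar>\<psi> x\<bar> + node m * \<bar>\<gamma> (m - 1) x\<bar>"
    by simp
  finally show ?thesis .
qed

lemma spike_le_round_norm: "x \<in> V \<Longrightarrow> \<bar>spike m x\<bar> \<le> 2 * round_norm x"
proof -
  assume x: "x \<in> V"
  have "node m * \<bar>\<gamma> (m - 1) x\<bar> \<le> 1 * N x"
    using x \<gamma>_bound node_nonneg[of m] node_le[of m] by (intro mult_mono) auto
  then show ?thesis
    using spike_le[OF x, of m] \<phi>\<psi>_le_\<rho>[OF x] N_simps(1)[OF x] by (simp add: round_norm_def)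
qed

lemma spike_tendsto:
  assumes x: "x \<in> V"
  shows "(\<lambda>m. spike m x) \<longlonglongrightarrow> spike 0 x"
proof -
  have "(\<lambda>m. (node m)\<^sup>2 / 10 * \<gamma> (m - 1) x) \<longlonglongrightarrow> 0"
  proof (rule Lim_null_comparison)
    show "eventually (\<lambda>m. norm ((node m)\<^sup>2 / 10 * \<gamma> (m - 1) x) \<le> (node m)\<^sup>2 / 10 * N x) sequentially"
      using \<gamma>_bound[OF x] by (auto simp: abs_mult intro!: always_eventually mult_left_mono)
    show "(\<lambda>m. (node m)\<^sup>2 / 10 * N x) \<longlonglongrightarrow> 0"
      by (rule tendsto_eq_intros node_tendsto_0 refl | simp)+
  qed
  then have "(\<lambda>m. spike m x) \<longlonglongrightarrow> (1 - 0\<^sup>2) * \<phi> x + 0 * \<psi> x + 0"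
    unfolding spike_def by (intro tendsto_intros node_tendsto_0)
  then show ?thesis by (simp add: spike_def)
qed

text \<open>
  For a fixed group element the sequence converges to its own member at index \<open>0\<close>. Outside a
  finite set of group elements all members are small at once: for small indices because \<open>\<gamma>\<close>
  decays along the orbit, for large ones because of the factor \<open>node\<close>.
\<close>
lemma spike_sup_max_exists:
  assumes x: "x \<in> V"
  shows "\<exists>i\<in>carrier H \<times> UNIV. \<forall>k\<in>carrier H \<times> UNIV.
    \<bar>spike (snd k) (A (fst k) x)\<bar> \<le> \<bar>spike (snd i) (A (fst i) x)\<bar>"
proof -
  have "\<exists>m. \<forall>k. \<bar>spike k (A h x)\<bar> \<le> \<bar>spike m (A h x)\<bar>" if h: "h \<in> carrier H" for h
  proof -
    have "(\<lambda>m. \<bar>spike m (A h x)\<bar>) \<longlonglongrightarrow> \<bar>spike 0 (A h x)\<bar>"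
      using h x by (intro tendsto_rabs spike_tendsto) auto
    then show ?thesis
      by (rule convergent_to_member_attains_maximum) blast
  qed
  then obtain \<mu> where \<mu>: "\<And>h k. h \<in> carrier H \<Longrightarrow> \<bar>spike k (A h x)\<bar> \<le> \<bar>spike (\<mu> h) (A h x)\<bar>"
    by metis
  have "\<exists>i\<in>carrier H. \<forall>k\<in>carrier H. \<bar>spike (\<mu> k) (A k x)\<bar> \<le> \<bar>spike (\<mu> i) (A i x)\<bar>"
  proof (rule attains_maximum[of "carrier H" "\<lambda>h. \<bar>spike (\<mu> h) (A h x)\<bar>"])
    fix e :: real assume e: "e > 0"
    have "(\<lambda>m. node m * N x) \<longlonglongrightarrow> 0"
      by (rule tendsto_eq_intros node_tendsto_0 refl | simp)+
    then have "eventually (\<lambda>m. node m * N x < e / 4) sequentially"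
      using e by (intro order_tendstoD) auto
    then obtain K where K: "\<And>m. m \<ge> K \<Longrightarrow> node m * N x < e / 4"
      by (auto simp: eventually_sequentially)
    define F where "F = {h \<in> carrier H. \<bar>\<phi> (A h x)\<bar> > e / 4} \<union> {h \<in> carrier H. \<bar>\<psi> (A h x)\<bar> > e / 4}
      \<union> (\<Union>m<K. {h \<in> carrier H. \<bar>\<gamma> (m - 1) (A h x)\<bar> > e / 4})"
    have "finite F"
      unfolding F_def using e x by (intro finite_UnI finite_UN_I \<phi>_decay \<psi>_decay \<gamma>_decay) auto
    moreover have "h \<in> F" if h: "h \<in> carrier H" "\<bar>spike (\<mu> h) (A h x)\<bar> > e" for h
    proof (rule ccontr)
      assume hF: "h \<notin> F"
      let ?m = "\<mu> h"
      have "node ?m * \<bar>\<gamma> (?m - 1) (A h x)\<bar> \<le> e / 4"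
      proof (cases "?m < K")
        case True
        then have "\<bar>\<gamma> (?m - 1) (A h x)\<bar> \<le> e / 4"
          using hF h unfolding F_def by force
        moreover have "node ?m * \<bar>\<gamma> (?m - 1) (A h x)\<bar> \<le> 1 * \<bar>\<gamma> (?m - 1) (A h x)\<bar>"
          using node_le[of ?m] by (intro mult_right_mono) auto
        ultimately show ?thesis by simp
      next
        case False
        have "node ?m * \<bar>\<gamma> (?m - 1) (A h x)\<bar> \<le> node ?m * N x"
          using \<gamma>_bound[of "A h x" "?m - 1"] h x
          by (intro mult_left_mono node_nonneg) (simp add: A_norm)
        then show ?thesis using K[of ?m] False by simp
      qed
      moreover have "\<bar>\<phi> (A h x)\<bar> \<le> e / 4" "\<bar>\<psi> (A h x)\<bar> \<le> e / 4"
        using hF h by (auto simp: F_def)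
      ultimately show False
        using spike_le[OF A_closed[OF h(1) x], of ?m] h(2) e by linarith
    qed
    ultimately show "finite {h \<in> carrier H. \<bar>spike (\<mu> h) (A h x)\<bar> > e}"
      by (auto elim: rev_finite_subset)
  qed auto
  then obtain i where i: "i \<in> carrier H"
    "\<And>k. k \<in> carrier H \<Longrightarrow> \<bar>spike (\<mu> k) (A k x)\<bar> \<le> \<bar>spike (\<mu> i) (A i x)\<bar>"
    by blast
  show ?thesis
  proof (rule bexI[of _ "(i, \<mu> i)"])
    show "\<forall>k\<in>carrier H \<times> UNIV. \<bar>spike (snd k) (A (fst k) x)\<bar> \<le> \<bar>spike (snd (i, \<mu> i)) (A (fst (i, \<mu> i)) x)\<bar>"
      using \<mu> i(2) by (auto intro: order_trans)
  qed (use i in auto)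
qed

lemma spike_sup_seminorm:
  shows spike_sup_upper: "h \<in> carrier H \<Longrightarrow> x \<in> V \<Longrightarrow> \<bar>spike m (A h x)\<bar> \<le> spike_sup x"
    and spike_sup_attained: "x \<in> V \<Longrightarrow> \<exists>h\<in>carrier H. \<exists>m. spike_sup x = \<bar>spike m (A h x)\<bar>"
    and spike_sup_add: "x \<in> V \<Longrightarrow> y \<in> V \<Longrightarrow> spike_sup (x + y) \<le> spike_sup x + spike_sup y"
    and spike_sup_scale: "x \<in> V \<Longrightarrow> spike_sup (c *\<^sub>R x) = \<bar>c\<bar> * spike_sup x"
proof -
  let ?p = "\<lambda>i x. \<bar>spike (snd i) (A (fst i) x)\<bar>" and ?I = "carrier H \<times> (UNIV :: nat set)"
  have add: "?p i (x + y) \<le> ?p i x + ?p i y" if "i \<in> ?I" "x \<in> V" "y \<in> V" for i x y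
    using that by (auto simp: A_add functional_onD[OF spike_functional])
  have scale: "?p i (c *\<^sub>R x) = \<bar>c\<bar> * ?p i x" if "i \<in> ?I" "x \<in> V" for i x c
    using that by (auto simp: A_scale functional_onD[OF spike_functional] abs_mult)
  note * = seminorm_SUP[of V ?I ?p, OF V spike_sup_max_exists add scale, folded spike_sup_def]
  show "h \<in> carrier H \<Longrightarrow> x \<in> V \<Longrightarrow> \<bar>spike m (A h x)\<bar> \<le> spike_sup x" using *(1)[of "(h, m)" x] by simp
  show "x \<in> V \<Longrightarrow> \<exists>h\<in>carrier H. \<exists>m. spike_sup x = \<bar>spike m (A h x)\<bar>" using *(2)[of x] by auto
  show "x \<in> V \<Longrightarrow> y \<in> V \<Longrightarrow> spike_sup (x + y) \<le> spike_sup x + spike_sup y" by (rule *(3))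
  show "x \<in> V \<Longrightarrow> spike_sup (c *\<^sub>R x) = \<bar>c\<bar> * spike_sup x" by (rule *(4))
qed

lemma spike_le_spiked_norm: "h \<in> carrier H \<Longrightarrow> x \<in> V \<Longrightarrow> \<bar>spike m (A h x)\<bar> \<le> spiked_norm x"
  using spike_sup_upper[of h x m] by (simp add: spiked_norm_def)

lemma spike_le_spiked_norm_self: "x \<in> V \<Longrightarrow> \<bar>spike m x\<bar> \<le> spiked_norm x"
  using spike_le_spiked_norm[of \<one> x m] by simp

lemma round_norm_A_le:
  assumes "g \<in> carrier H" "x \<in> V"
  shows "round_norm (A g x) \<le> round_norm x"
  using \<rho>_A_le[OF assms] assms by (simp add: round_norm_def A_norm)

lemma round_norm_le_spiked_norm: "round_norm x \<le> 4 * spiked_norm x"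
  by (simp add: spiked_norm_def)

lemma spiked_norm_le_round_norm:
  assumes x: "x \<in> V"
  shows "spiked_norm x \<le> 2 * round_norm x"
proof -
  obtain h m where h: "h \<in> carrier H" "spike_sup x = \<bar>spike m (A h x)\<bar>"
    using spike_sup_attained[OF x] by blast
  then have "spike_sup x \<le> 2 * round_norm (A h x)" using spike_le_round_norm x by auto
  also have "\<dots> \<le> 2 * round_norm x" using round_norm_A_le[OF h(1) x] by simp
  finally show ?thesis
    using N_simps(1)[OF x] \<rho>_nonneg[OF x] by (simp add: spiked_norm_def round_norm_def)
qed

lemma spiked_norm_A [simp]:
  assumes g: "g \<in> carrier H" and x: "x \<in> V"
  shows "spiked_norm (A g x) = spiked_norm x"
proof -
  have le: "spiked_norm (A g x) \<le> spiked_norm x" if g: "g \<in> carrier H" and x: "x \<in> V" for g x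
  proof -
    obtain h m where h: "h \<in> carrier H" "spike_sup (A g x) = \<bar>spike m (A h (A g x))\<bar>"
      using spike_sup_attained g x by blast
    then have "spike_sup (A g x) \<le> spike_sup x" using spike_sup_upper[of "h \<otimes> g" x m] g x by (simp add: A_mult)
    then show ?thesis using round_norm_A_le[OF g x] unfolding spiked_norm_def by linarith
  qed
  show ?thesis using le[OF g x] le[of "inv g" "A g x"] g x by simp
qed

lemma spiked_norm_add:
  assumes "x \<in> V" "y \<in> V"
  shows "spiked_norm (x + y) \<le> spiked_norm x + spiked_norm y"
proof -
  have "spike_sup x \<le> spiked_norm x" "spike_sup y \<le> spiked_norm y" by (simp_all add: spiked_norm_def)
  then have "spike_sup (x + y) \<le> spiked_norm x + spiked_norm y" using spike_sup_add[OF assms] by linarith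
  moreover have "round_norm (x + y) / 4 \<le> spiked_norm x + spiked_norm y"
  proof -
    have "round_norm (x + y) \<le> round_norm x + round_norm y"
      using \<rho>_add[OF assms] N_simps(4)[OF assms] by (simp add: round_norm_def)
    then show ?thesis using round_norm_le_spiked_norm[of x] round_norm_le_spiked_norm[of y] by linarith
  qed
  ultimately show ?thesis unfolding spiked_norm_def[of "x + y"] by (rule max.boundedI[rotated])
qed

lemma spiked_norm_scale: "x \<in> V \<Longrightarrow> spiked_norm (c *\<^sub>R x) = \<bar>c\<bar> * spiked_norm x"
  by (auto simp: spiked_norm_def round_norm_def spike_sup_scale \<rho>_scale N_simps max_mult_distrib_left algebra_simps)

lemma N_le_spiked_norm: "x \<in> V \<Longrightarrow> N x \<le> 4 * spiked_norm x"
  using round_norm_le_spiked_norm[of x] round_norm_le_imp[of x] by linarith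

lemma norm_on_spiked_norm: "norm_on V spiked_norm"
  unfolding norm_on_def
proof (intro conjI ballI allI)
  fix x assume x: "x \<in> V"
  show "0 \<le> spiked_norm x" using N_le_spiked_norm[OF x] N_simps(1)[OF x] by linarith
  have "spiked_norm 0 = 0" using spiked_norm_scale[of 0 0] by simp
  then show "spiked_norm x = 0 \<longleftrightarrow> x = 0"
    using N_le_spiked_norm[OF x] N_simps(1,2)[OF x] by auto
qed (auto simp: spiked_norm_scale spiked_norm_add)

lemma equivalent_norms_spiked_norm: "equivalent_norms V N spiked_norm"
proof -
  have "1 / 4 * N x \<le> spiked_norm x \<and> spiked_norm x \<le> (2 + 4 * \<bar>C\<bar>) * N x" if x: "x \<in> V" for x
  proof -
    have "C * N x \<le> \<bar>C\<bar> * N x" using N_simps(1)[OF x] by (intro mult_right_mono) auto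
    then have "spiked_norm x \<le> (2 + 4 * \<bar>C\<bar>) * N x"
      using spiked_norm_le_round_norm[OF x] \<rho>_le[OF x] by (simp add: round_norm_def algebra_simps)
    then show ?thesis using N_le_spiked_norm[OF x] by simp
  qed
  then show ?thesis
    unfolding equivalent_norms_def
    by (intro exI[of _ "1/4 :: real"] exI[of _ "2 + 4 * \<bar>C\<bar>"] conjI ballI) auto
qed

text \<open>
  The unit sphere has a facet with nonempty relative interior where such a functional equals \<open>1\<close>.
  The notion refers to nothing but the norm, hence it is preserved by isometries.
\<close>
definition flat :: "('a \<Rightarrow> real) \<Rightarrow> bool" where
  "flat \<alpha> \<longleftrightarrow> functional_on V \<alpha> \<and> (\<exists>z\<in>V. \<exists>r>0. \<forall>x\<in>V. spiked_norm (x - z) < r \<longrightarrow> spiked_norm x = \<alpha> x)"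

lemma \<phi>_neq_0_near:
  assumes z: "z \<in> V" and r: "r > 0"
  obtains x where "x \<in> V" "spiked_norm (x - z) < r" "\<phi> x \<noteq> 0"
proof (cases "\<phi> z = 0")
  case False
  have "spiked_norm (z - z) = 0" using norm_on_spiked_norm by (simp add: norm_on_def)
  then show thesis using that[of z] False z r by simp
next
  case True
  define t where "t = r / (2 * spiked_norm a + 1)"
  have norm_a: "0 \<le> spiked_norm a" using norm_on_spiked_norm by (auto simp: norm_on_def)
  then have t: "0 < t" using r by (simp add: t_def)
  have "r * spiked_norm a < r * (2 * spiked_norm a + 1)" using norm_a r by (intro mult_strict_left_mono) auto
  then have "t * spiked_norm a < r" using norm_a by (simp add: t_def pos_divide_less_eq)
  then show thesis
    using that[of "z + t *\<^sub>R a"] z t True by (simp add: spiked_norm_scale functional_onD functionals)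
qed

text \<open>
  Let \<open>h\<close> realise \<open>\<rho> x\<close>. Moving the pair \<open>(\<phi>, \<psi>)\<close> at \<open>A h x\<close> perpendicularly to itself, in either
  direction, increases its Euclidean length.
\<close>
lemma round_norm_strictly_convex_somewhere:
  assumes x: "x \<in> V" and "\<phi> x \<noteq> 0"
  obtains v where "v \<in> V" "\<And>t. t \<noteq> 0 \<Longrightarrow> 2 * round_norm x < round_norm (x + t *\<^sub>R v) + round_norm (x - t *\<^sub>R v)"
proof -
  obtain h where h: "h \<in> carrier H" "\<rho> x = norm (\<phi> (A h x), \<psi> (A h x))"
    using \<rho>_attained[OF x] by blast
  define c d where "c = \<phi> (A h x)" and "d = \<psi> (A h x)"
  have "0 < \<rho> x" using \<phi>\<psi>_le_\<rho>(1)[OF x] assms by linarith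
  then have cd: "0 < c\<^sup>2 + d\<^sup>2"
    using h by (auto simp: c_def d_def norm_Pair)
  \<comment> \<open>the pair \<open>(\<phi>, \<psi>)\<close> at \<open>w\<close> is \<open>(c, d)\<close> turned by a right angle\<close>
  define w where "w = (- d) *\<^sub>R a + c *\<^sub>R b"
  have w: "w \<in> V" "\<phi> w = - d" "\<psi> w = c"
    using \<phi>_b[of \<one>] \<psi>_a[of \<one>] by (auto simp: w_def functional_onD functionals)
  define v where "v = A (inv h) w"
  have v: "v \<in> V" "A h v = w" using h w by (auto simp: v_def)
  have rot: "\<rho> x < \<rho> (x + t *\<^sub>R v)" if t: "t \<noteq> 0" for t
  proof -
    have "(c - t * d)\<^sup>2 + (d + t * c)\<^sup>2 = (1 + t\<^sup>2) * (c\<^sup>2 + d\<^sup>2)"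
      by (simp add: power2_eq_square algebra_simps)
    also have "\<dots> > 1 * (c\<^sup>2 + d\<^sup>2)"
      using cd t by (intro mult_strict_right_mono) auto
    finally have "sqrt (c\<^sup>2 + d\<^sup>2) < sqrt ((c - t * d)\<^sup>2 + (d + t * c)\<^sup>2)" by simp
    also have "\<dots> = norm (\<phi> (A h (x + t *\<^sub>R v)), \<psi> (A h (x + t *\<^sub>R v)))"
      using h x v w by (simp add: norm_Pair A_add A_scale functional_onD functionals c_def d_def)
    also have "\<dots> \<le> \<rho> (x + t *\<^sub>R v)"
      using h x v by (intro \<rho>_upper) auto
    finally show ?thesis using h by (simp add: c_def d_def norm_Pair)
  qed
  have N_mid: "2 * N x \<le> N (x + t *\<^sub>R v) + N (x - t *\<^sub>R v)" for t
  proof -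
    have "2 *\<^sub>R x = (x + t *\<^sub>R v) + (x - t *\<^sub>R v)" by (simp add: scaleR_2)
    then show ?thesis
      using N_simps(3)[OF x, of 2] N_simps(4)[of "x + t *\<^sub>R v" "x - t *\<^sub>R v"] x v by simp
  qed
  show thesis
  proof (rule that[OF v(1)])
    fix t :: real assume "t \<noteq> 0"
    then show "2 * round_norm x < round_norm (x + t *\<^sub>R v) + round_norm (x - t *\<^sub>R v)"
      using rot[of t] rot[of "- t"] N_mid[of t] by (simp add: round_norm_def)
  qed
qed

text \<open>
  At a point of the open set where \<open>\<phi>\<close> does not vanish the maximum is either that of the round norm, which contradicts
  linearity in a neighbourhood, or the value of a spike; in the latter case the spike is a linear
  minorant of the norm touching it where the norm is linear, and so it is its derivative there.
\<close>
lemma flat_imp_spike: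
  assumes "flat \<alpha>"
  obtains m h where "h \<in> carrier H" "\<And>x. x \<in> V \<Longrightarrow> \<alpha> x = spike m (A h x)"
proof -
  obtain z r where lin: "functional_on V \<alpha>" and z: "z \<in> V" and r: "r > 0"
    and flat: "\<And>x. x \<in> V \<Longrightarrow> spiked_norm (x - z) < r \<Longrightarrow> spiked_norm x = \<alpha> x"
    using assms unfolding flat_def by blast
  obtain x where x: "x \<in> V" "spiked_norm (x - z) < r" "\<phi> x \<noteq> 0"
    using \<phi>_neq_0_near[OF z r] .
  have seg: "\<exists>t>0. \<forall>s. \<bar>s\<bar> \<le> t \<longrightarrow> spiked_norm (x + s *\<^sub>R v) = \<alpha> x + s * \<alpha> v" if v: "v \<in> V" for v
  proof -
    define t where "t = (r - spiked_norm (x - z)) / (2 * spiked_norm v + 1)"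
    have norm_v: "0 \<le> spiked_norm v" using norm_on_spiked_norm v by (auto simp: norm_on_def)
    have t: "0 < t" using norm_v x(2) by (simp add: t_def)
    have "spiked_norm (x + s *\<^sub>R v) = \<alpha> x + s * \<alpha> v" if s: "\<bar>s\<bar> \<le> t" for s
    proof -
      have "\<bar>s\<bar> * spiked_norm v \<le> t * spiked_norm v" using s norm_v by (rule mult_right_mono)
      also have "t * spiked_norm v < r - spiked_norm (x - z)"
      proof -
        have "(r - spiked_norm (x - z)) * spiked_norm v < (r - spiked_norm (x - z)) * (2 * spiked_norm v + 1)"
          using norm_v x(2) by (intro mult_strict_left_mono) auto
        then show ?thesis using norm_v by (simp add: t_def pos_divide_less_eq)
      qed
      finally have "spiked_norm (x - z) + spiked_norm (s *\<^sub>R v) < r" using v by (simp add: spiked_norm_scale)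
      moreover have "spiked_norm ((x - z) + s *\<^sub>R v) \<le> spiked_norm (x - z) + spiked_norm (s *\<^sub>R v)"
        using x z v by (intro spiked_norm_add) auto
      moreover have "x + s *\<^sub>R v - z = (x - z) + s *\<^sub>R v" by simp
      ultimately have "spiked_norm (x + s *\<^sub>R v - z) < r" by (simp only:)
      then have "spiked_norm (x + s *\<^sub>R v) = \<alpha> (x + s *\<^sub>R v)" using x v by (intro flat) auto
      then show ?thesis using x v by (simp add: functional_onD[OF lin])
    qed
    then show ?thesis using t by blast
  qed
  have norm_x: "spiked_norm x = \<alpha> x" using flat x by blast
  show thesis
  proof (cases "spike_sup x < round_norm x / 4")
    case True
    obtain v where v: "v \<in> V" "\<And>t. t \<noteq> 0 \<Longrightarrow> 2 * round_norm x < round_norm (x + t *\<^sub>R v) + round_norm (x - t *\<^sub>R v)"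
      using round_norm_strictly_convex_somewhere[OF x(1,3)] by blast
    obtain t where t: "t > 0" "\<And>s. \<bar>s\<bar> \<le> t \<Longrightarrow> spiked_norm (x + s *\<^sub>R v) = \<alpha> x + s * \<alpha> v"
      using seg[OF v(1)] by blast
    have "spiked_norm (x + t *\<^sub>R v) + spiked_norm (x - t *\<^sub>R v) = 2 * spiked_norm x"
      using t(2)[of t] t(2)[of "- t"] t(1) norm_x by simp
    also have "\<dots> = round_norm x / 2" using True by (simp add: spiked_norm_def)
    also have "\<dots> < (round_norm (x + t *\<^sub>R v) + round_norm (x - t *\<^sub>R v)) / 4"
      using v(2)[of t] t(1) by simp
    also have "\<dots> \<le> spiked_norm (x + t *\<^sub>R v) + spiked_norm (x - t *\<^sub>R v)"
      using round_norm_le_spiked_norm[of "x + t *\<^sub>R v"] round_norm_le_spiked_norm[of "x - t *\<^sub>R v"] by simp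
    finally show ?thesis by simp
  next
    case False
    obtain h m where h: "h \<in> carrier H" "spike_sup x = \<bar>spike m (A h x)\<bar>"
      using spike_sup_attained[OF x(1)] by blast
    have "A (j \<otimes> h) x = - A h x" using h x by (simp add: A_mult)
    then have "spike m (A (j \<otimes> h) x) = - spike m (A h x)"
      using h x functional_onD[OF spike_functional, of "A h x"] by simp
    then obtain g where g: "g \<in> carrier H" "spike m (A g x) = spike_sup x"
      using h by (metis abs_if j m_closed)
    then have eq: "spike m (A g x) = \<alpha> x" using False norm_x by (simp add: spiked_norm_def)
    note fA = functional_A[OF spike_functional g(1)]
    show ?thesis
    proof (rule that[OF g(1)])
      fix v assume v: "v \<in> V"
      obtain t where t: "t > 0" "\<And>s. \<bar>s\<bar> \<le> t \<Longrightarrow> spiked_norm (x + s *\<^sub>R v) = \<alpha> x + s * \<alpha> v"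
        using seg[OF v] by blast
      have le: "s * spike m (A g v) \<le> s * \<alpha> v" if "\<bar>s\<bar> \<le> t" for s
      proof -
        have "spike m (A g (x + s *\<^sub>R v)) \<le> spiked_norm (x + s *\<^sub>R v)"
          using spike_le_spiked_norm[OF g(1), of "x + s *\<^sub>R v" m] x v by auto
        moreover have "spike m (A g (x + s *\<^sub>R v)) = spike m (A g x) + s * spike m (A g v)"
          using functional_onD(1)[OF fA x(1), of "s *\<^sub>R v"] functional_onD(3)[OF fA v] v by auto
        ultimately show ?thesis using t(2)[OF that] eq by simp
      qed
      show "\<alpha> v = spike m (A g v)"
        using le[of t] le[of "- t"] t(1) by auto
    qed
  qed
qed

lemma spike_a: "99 / 100 \<le> spike m a" "spike m a \<le> 101 / 100"
proof -
  have sq: "(node m)\<^sup>2 \<le> 1 / 1000"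
    using mult_mono[OF node_le[of m] node_le[of m]] node_nonneg[of m] by (simp add: power2_eq_square)
  have "\<bar>\<gamma> (m - 1) a\<bar> \<le> 1" using \<gamma>_bound[of a "m - 1"] ab_norm by simp
  then have "\<bar>(node m)\<^sup>2 / 10 * \<gamma> (m - 1) a\<bar> \<le> 1 / 1000 / 10 * 1"
    unfolding abs_mult using sq by (intro mult_mono) auto
  moreover have "spike m a = 1 - (node m)\<^sup>2 + (node m)\<^sup>2 / 10 * \<gamma> (m - 1) a"
    using \<psi>_a[of \<one>] by (simp add: spike_def)
  ultimately show "99 / 100 \<le> spike m a" "spike m a \<le> 101 / 100"
    using sq zero_le_power2[of "node m"] by linarith+
qed

lemma spike_other_side:
  assumes h: "h \<in> carrier H" "h \<noteq> \<one>" "h \<noteq> j" and x: "x \<in> {a, b}"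
  shows "\<bar>spike m (A h x)\<bar> \<le> 1 / 100"
proof -
  have xV: "x \<in> V" "N x \<le> 1" using x ab_norm by auto
  have 0: "\<phi> (A h x) = 0" "\<psi> (A h x) = 0" using x h \<phi>_a \<phi>_b \<psi>_a \<psi>_b by auto
  have "\<bar>\<gamma> (m - 1) (A h x)\<bar> \<le> 1"
    using \<gamma>_bound[of "A h x" "m - 1"] h(1) xV by (simp add: A_norm)
  then have "node m * \<bar>\<gamma> (m - 1) (A h x)\<bar> \<le> 1 / 1000 * 1"
    using node_le node_nonneg by (intro mult_mono) auto
  then show ?thesis using spike_le[of "A h x" m] 0 h xV by simp
qed

lemma \<rho>_a: "\<rho> a \<le> 1" and \<rho>_b: "\<rho> b \<le> 1"
proof -
  obtain h where h: "h \<in> carrier H" "\<rho> a = norm (\<phi> (A h a), \<psi> (A h a))"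
    using \<rho>_attained[of a] by blast
  then show "\<rho> a \<le> 1"
    using \<psi>_a[of h] \<phi>_a[of h] functional_onD(4)[OF functionals(1), of a]
    by (cases "h = \<one>"; cases "h = j") (auto simp: norm_Pair)
  obtain h where h: "h \<in> carrier H" "\<rho> b = norm (\<phi> (A h b), \<psi> (A h b))"
    using \<rho>_attained[of b] by blast
  then show "\<rho> b \<le> 1"
    using \<phi>_b[of h] \<psi>_b[of h] functional_onD(4)[OF functionals(2), of b]
    by (cases "h = \<one>"; cases "h = j") (auto simp: norm_Pair)
qed

lemma round_norm_ab: "round_norm a \<le> 2" "round_norm b \<le> 2"
  using \<rho>_a \<rho>_b ab_norm by (auto simp: round_norm_def)

text \<open>
  At \<open>z = a + 2 s\<^sub>n b\<close> the unperturbed functional of index \<open>m\<close> takes the value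
  \<open>1 + s\<^sub>n\<^sup>2 - (s\<^sub>n - s\<^sub>m)\<^sup>2\<close>, which is maximal for \<open>m = n\<close>. The margin is of order
  \<open>max s\<^sub>n s\<^sub>m\<close> squared and absorbs the perturbations; translates are small at \<open>z\<close>, and so is
  a quarter of the round norm.
\<close>
lemma flat_spike:
  assumes n: "n \<noteq> 0"
  shows "flat (spike n)"
proof -
  define s z where "s = node n" and "z = a + (2 * s) *\<^sub>R b"
  have s: "0 < s" "s \<le> 1 / 1000" using node_pos[OF n] node_le by (auto simp: s_def)
  have z: "z \<in> V" by (simp add: z_def)
  have \<phi>\<psi>: "\<phi> z = 1" "\<psi> z = 2 * s"
    using \<phi>_b[of \<one>] \<psi>_a[of \<one>] by (auto simp: z_def functional_onD functionals)
  have Nz: "N z \<le> 2"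
    using N_simps(4)[of a "(2 * s) *\<^sub>R b"] N_simps(3)[of b "2 * s"] ab_norm s
      mult_mono[of "2 * s" 1 "N b" 1] N_simps(1)[of b] by (simp add: z_def)
  have s2: "s\<^sup>2 \<le> 1 / 1000"
    using mult_mono[OF s(2) s(2)] s(1) by (simp add: power2_eq_square)
  have fz: "spike m z = 1 - (node m)\<^sup>2 + 2 * node m * s + (node m)\<^sup>2 / 10 * \<gamma> (m - 1) z" for m
    by (simp add: spike_def \<phi>\<psi>)
  have small: "\<bar>(node m)\<^sup>2 / 10 * \<gamma> (m - 1) z\<bar> \<le> (node m)\<^sup>2 / 5" for m
  proof -
    have "\<bar>\<gamma> (m - 1) z\<bar> \<le> 2" using \<gamma>_bound[OF z, of "m - 1"] Nz by linarith
    then have "(node m)\<^sup>2 / 10 * \<bar>\<gamma> (m - 1) z\<bar> \<le> (node m)\<^sup>2 / 10 * 2"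
      by (rule mult_left_mono) simp
    then show ?thesis by (simp add: abs_mult)
  qed
  have fn: "1 \<le> spike n z"
    using fz[of n] small[of n] by (simp add: s_def power2_eq_square abs_le_iff)
  have gap: "spike m z \<le> spike n z - s\<^sup>2 / 2" if "m \<noteq> n" for m
  proof -
    define w where "w = max (node m) s"
    have w: "0 \<le> w" "s \<le> w" "node m \<le> w" using s by (auto simp: w_def)
    have "999 / 1000 * w \<le> \<bar>node m - s\<bar>"
      using node_separated[OF that] by (simp add: w_def s_def)
    then have "(999 / 1000 * w)\<^sup>2 \<le> \<bar>node m - s\<bar>\<^sup>2"
      using w by (intro power_mono) auto
    then have 1: "9 / 10 * w\<^sup>2 \<le> (node m - s)\<^sup>2"
      by (simp add: power_mult_distrib power2_eq_square)
        (smt (verit) mult_nonneg_nonneg w(1))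
    have 2: "(node m)\<^sup>2 \<le> w\<^sup>2" "s\<^sup>2 \<le> w\<^sup>2"
      using w s node_nonneg[of m] by (auto intro!: power_mono)
    have "spike n z - spike m z = (node m - s)\<^sup>2
        + (s\<^sup>2 / 10 * \<gamma> (n - 1) z - (node m)\<^sup>2 / 10 * \<gamma> (m - 1) z)"
      unfolding fz by (simp add: s_def power2_eq_square algebra_simps)
    then show ?thesis
      using 1 2 small[of n] small[of m] zero_le_power2[of w] unfolding s_def[symmetric] by linarith
  qed
  have pos: "0 \<le> spike m z" for m
  proof -
    have "(node m)\<^sup>2 \<le> 1 / 1000"
      using mult_mono[OF node_le[of m] node_le[of m]] node_nonneg[of m] by (simp add: power2_eq_square)
    moreover have "0 \<le> 2 * node m * s" using node_nonneg[of m] s by simp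
    ultimately show ?thesis using fz[of m] small[of m] zero_le_power2[of "node m"] by linarith
  qed
  have side: "\<bar>spike m (A h z)\<bar> \<le> 1 / 2" if h: "h \<in> carrier H" "h \<noteq> \<one>" "h \<noteq> j" for m h
  proof -
    have "spike m (A h z) = spike m (A h a) + 2 * s * spike m (A h b)"
      using h by (simp add: z_def A_add A_scale functional_onD[OF spike_functional])
    moreover have "\<bar>2 * s * spike m (A h b)\<bar> \<le> 1 * (1 / 100)"
      unfolding abs_mult[of "2 * s"] using spike_other_side[OF h, of b m] s by (intro mult_mono) auto
    moreover have "\<bar>spike m (A h a)\<bar> \<le> 1 / 100" by (rule spike_other_side[OF h]) simp
    ultimately show ?thesis by linarith
  qed
  have qz: "round_norm z / 4 \<le> 3 / 5"
  proof -
    have "\<rho> z \<le> \<rho> a + (2 * s) * \<rho> b" using \<rho>_add[of a "(2 * s) *\<^sub>R b"] s by (simp add: z_def \<rho>_scale)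
    moreover have "2 * s * \<rho> b \<le> (1 / 500) * 1"
      using s \<rho>_b \<rho>_nonneg[of b] by (intro mult_mono) auto
    moreover have "N z \<le> N a + (2 * s) * N b"
      using N_simps(4)[of a "(2 * s) *\<^sub>R b"] N_simps(3)[of b "2 * s"] s by (simp add: z_def)
    moreover have "2 * s * N b \<le> (1 / 500) * 1"
      using s ab_norm N_simps(1)[of b] by (intro mult_mono) auto
    ultimately show ?thesis using \<rho>_a ab_norm by (simp add: round_norm_def)
  qed
  have "spiked_norm x = spike n x" if x: "x \<in> V" and near: "spiked_norm (x - z) < s\<^sup>2 / 4" for x
  proof (rule antisym)
    have close: "\<bar>spike m (A h x) - spike m (A h z)\<bar> < s\<^sup>2 / 4" if "h \<in> carrier H" for m h
    proof -
      have "spike m (A h x) - spike m (A h z) = spike m (A h (x - z))"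
        using that x z by (simp add: A_diff functional_onD[OF spike_functional])
      then show ?thesis using spike_le_spiked_norm[OF that, of "x - z" m] x z near by simp
    qed
    have close1: "\<bar>spike m x - spike m z\<bar> < s\<^sup>2 / 4" for m using close[of \<one> m] x z by simp
    have "round_norm x = round_norm (z + (x - z))" by simp
    also have "\<dots> \<le> round_norm z + round_norm (x - z)"
      using \<rho>_add[of z "x - z"] N_simps(4)[of z "x - z"] x z by (simp add: round_norm_def)
    finally have "round_norm x \<le> round_norm z + round_norm (x - z)" .
    then have "round_norm x / 4 \<le> spike n x"
      using qz close1[of n] fn s2 near round_norm_le_spiked_norm[of "x - z"] by linarith
    moreover have "spike_sup x \<le> spike n x"
    proof -
      obtain h m where h: "h \<in> carrier H" "spike_sup x = \<bar>spike m (A h x)\<bar>"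
        using spike_sup_attained[OF x] by blast
      show ?thesis
      proof (cases "h = \<one> \<or> h = j")
        case True
        then have "spike_sup x = \<bar>spike m x\<bar>" using h x functional_onD(4)[OF spike_functional x] by auto
        moreover have "\<bar>spike m x\<bar> \<le> spike n x"
        proof (cases "m = n")
          case True
          then show ?thesis using close1[of n] fn s2 by (simp only:)
        next
          case False
          then show ?thesis using close1[of m] close1[of n] gap[of m] pos[of m] fn s2 by linarith
        qed
        ultimately show ?thesis by simp
      next
        case False
        then have "\<bar>spike m (A h z)\<bar> \<le> 1 / 2" by (intro side h) auto
        then show ?thesis using h(2) close[OF h(1), of m] close1[of n] fn s2 by linarith
      qed
    qed
    ultimately show "spiked_norm x \<le> spike n x" by (simp add: spiked_norm_def)
    show "spike n x \<le> spiked_norm x" using spike_le_spiked_norm_self[OF x, of n] by simp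
  qed
  then show ?thesis
    unfolding flat_def using z s spike_functional by (intro conjI bexI[of _ z] exI[of _ "s\<^sup>2 / 4"]) auto
qed

text \<open>
  This and the next lemma determine the distance of two spikes up to a constant factor. The lower
  bound is needed at the vector \<open>b\<close> only, where \<open>\<phi>\<close> vanishes and \<open>\<psi>\<close> dominates.
\<close>
lemma spike_diff_upper:
  assumes x: "x \<in> V"
  shows "\<bar>spike m x - spike k x\<bar> \<le> 2 * max (node m) (node k) * round_norm x"
proof -
  define w where "w = max (node m) (node k)"
  have w: "0 \<le> w" "w \<le> 1 / 1000" "node m \<le> w" "node k \<le> w"
    using node_nonneg[of m] node_nonneg[of k] node_le[of m] node_le[of k]
    by (auto simp: w_def max_def)
  have sq: "(node i)\<^sup>2 \<le> w / 1000" if "node i \<le> w" for i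
  proof -
    have "node i * node i \<le> w * (1 / 1000)"
      using that node_nonneg[of i] node_le[of i] w by (intro mult_mono) auto
    then show ?thesis by (simp add: power2_eq_square)
  qed
  have \<gamma>: "\<bar>(node i)\<^sup>2 / 10 * \<gamma> (i - 1) x\<bar> \<le> w / 10 * N x" if "node i \<le> w" for i
    unfolding abs_mult using sq[OF that] \<gamma>_bound[OF x, of "i - 1"] w by (intro mult_mono) auto
  have "\<bar>(node k)\<^sup>2 - (node m)\<^sup>2\<bar> \<le> w / 10"
    using sq[OF w(3)] sq[OF w(4)] w(1) zero_le_power2[of "node k"] zero_le_power2[of "node m"]
    by linarith
  then have "\<bar>((node k)\<^sup>2 - (node m)\<^sup>2) * \<phi> x\<bar> \<le> w / 10 * \<rho> x"
    unfolding abs_mult using \<phi>\<psi>_le_\<rho>[OF x] w(1) by (intro mult_mono) auto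
  moreover have "\<bar>(node m - node k) * \<psi> x\<bar> \<le> w * \<rho> x"
    unfolding abs_mult using \<phi>\<psi>_le_\<rho>[OF x] w node_nonneg[of m] node_nonneg[of k]
    by (intro mult_mono) auto
  moreover have "spike m x - spike k x = ((node k)\<^sup>2 - (node m)\<^sup>2) * \<phi> x + (node m - node k) * \<psi> x
      + ((node m)\<^sup>2 / 10 * \<gamma> (m - 1) x - (node k)\<^sup>2 / 10 * \<gamma> (k - 1) x)"
    by (simp add: spike_def algebra_simps)
  moreover have "0 \<le> w * N x" "0 \<le> w * \<rho> x" using w N_simps(1)[OF x] \<rho>_nonneg[OF x] by auto
  moreover have "2 * w * round_norm x = 2 * (w * N x) + 2 * (w * \<rho> x)" by (simp add: round_norm_def algebra_simps)
  ultimately show ?thesis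
    using \<gamma>[OF w(3)] \<gamma>[OF w(4)] unfolding w_def[symmetric] by linarith
qed

lemma spike_diff_lower:
  assumes "m \<noteq> k"
  shows "max (node m) (node k) / 2 \<le> \<bar>spike m b - spike k b\<bar>"
proof -
  define w where "w = max (node m) (node k)"
  have w: "0 \<le> w" "w \<le> 1 / 1000" "node m \<le> w" "node k \<le> w"
    using node_nonneg[of m] node_nonneg[of k] node_le[of m] node_le[of k]
    by (auto simp: w_def max_def)
  have \<gamma>: "\<bar>(node i)\<^sup>2 / 10 * \<gamma> (i - 1) b\<bar> \<le> w / 10 * 1" if "node i \<le> w" for i
  proof -
    have "node i * node i \<le> w * 1"
      using that node_nonneg[of i] node_le[of i] w by (intro mult_mono) auto
    then show ?thesis unfolding abs_mult using \<gamma>_bound[of b "i - 1"] w ab_norm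
      by (intro mult_mono) (auto simp: power2_eq_square)
  qed
  have "spike m b - spike k b = (node m - node k)
      + ((node m)\<^sup>2 / 10 * \<gamma> (m - 1) b - (node k)\<^sup>2 / 10 * \<gamma> (k - 1) b)"
    using \<phi>_b[of \<one>] by (simp add: spike_def)
  then show ?thesis
    using \<gamma>[OF w(3)] \<gamma>[OF w(4)] node_separated[OF assms] w(1) unfolding w_def[symmetric] by linarith
qed

lemma round_norm_bounded:
  assumes "x \<in> V" "spiked_norm x = spiked_norm y" "y \<in> {a, b}"
  shows "round_norm x \<le> 16"
  using round_norm_le_spiked_norm[of x] spiked_norm_le_round_norm[of y] round_norm_ab assms by auto

text \<open>
  The first value is about \<open>1\<close>, whereas the second one is about \<open>0\<close>, or about \<open>-1\<close> if the two
  group elements differ by \<open>j\<close>.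
\<close>
lemma spike_separates_orbit:
  assumes h: "h \<in> carrier H" and g: "g \<in> carrier H" and "h \<noteq> g"
  shows "1 / 4 \<le> \<bar>spike m (A h (A (inv h) a)) - spike k (A g (A (inv h) a))\<bar>"
proof -
  let ?g = "g \<otimes> inv h"
  have g': "?g \<in> carrier H" "?g \<noteq> \<one>"
    using assms by (auto simp: inv_solve_right')
  have eq: "A g (A (inv h) a) = A ?g a" using h g by (simp add: A_mult)
  show ?thesis
  proof (cases "?g = j")
    case True
    then show ?thesis
      unfolding eq using h spike_a[of m] spike_a[of k] functional_onD(4)[OF spike_functional, of a k] by simp
  next
    case False
    then show ?thesis unfolding eq using h spike_a[of m] spike_other_side[OF g' False, of a k] by auto
  qed
qed

text \<open>
  Along the sequence one recovers \<open>\<phi>\<close> from the terms of order \<open>0\<close>, \<open>\<psi>\<close> from those of order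
  \<open>node n\<close>, and finally \<open>\<gamma>\<close> from those of order \<open>(node n)\<^sup>2\<close>.
\<close>
lemma spike_total:
  assumes w: "w \<in> V" and zero: "\<And>n. n \<noteq> 0 \<Longrightarrow> spike n w = 0"
  shows "w = 0"
proof (rule total[OF w])
  have "(\<lambda>n. spike (Suc n) w) \<longlonglongrightarrow> spike 0 w" by (rule LIMSEQ_Suc[OF spike_tendsto[OF w]])
  then have "spike 0 w = 0" using zero by (simp add: LIMSEQ_const_iff)
  then have \<phi>: "\<phi> w = 0" by (simp add: spike_def)
  have \<psi>n: "\<psi> w = - node (Suc n) / 10 * \<gamma> n w" for n
  proof -
    have "node (Suc n) * (\<psi> w + node (Suc n) / 10 * \<gamma> n w) = 0"
      using zero[of "Suc n"] \<phi> by (simp add: spike_def power2_eq_square algebra_simps)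
    then show ?thesis using node_pos[of "Suc n"] by simp
  qed
  have "(\<lambda>n. - node (Suc n) / 10 * \<gamma> n w) \<longlonglongrightarrow> 0"
  proof (rule Lim_null_comparison)
    show "eventually (\<lambda>n. norm (- node (Suc n) / 10 * \<gamma> n w) \<le> node (Suc n) / 10 * N w) sequentially"
      using \<gamma>_bound[OF w] node_nonneg
      by (auto simp: abs_mult intro!: always_eventually mult_left_mono)
    show "(\<lambda>n. node (Suc n) / 10 * N w) \<longlonglongrightarrow> 0"
      by (rule tendsto_eq_intros LIMSEQ_Suc[OF node_tendsto_0] refl | simp)+
  qed
  then have "\<psi> w = 0" unfolding \<psi>n[symmetric] by (simp add: LIMSEQ_const_iff)
  then show "\<gamma> n w = 0" for n using \<psi>n[of n] node_pos[of "Suc n"] by simp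
qed

text \<open>
  Composing the spike \<open>n\<close> with \<open>T\<close> gives a spike \<open>m n\<close> translated by some \<open>\<eta> n\<close>. As spikes are close
  together while translates are not, \<open>\<eta>\<close> is constant. Comparing the distances of consecutive spikes
  before and after composition shows that \<open>m\<close> is the identity.
\<close>
lemma isometry_is_action:
  assumes bij: "bij_betw T V V" and iso: "linear_isometry_on V spiked_norm T"
  obtains h where "h \<in> carrier H" "\<And>x. x \<in> V \<Longrightarrow> T x = A h x"
proof -
  have T [simp, intro]: "T x \<in> V" if "x \<in> V" for x using bij that by (auto simp: bij_betw_def)
  have T_add: "T (x + y) = T x + T y" and T_scale: "T (c *\<^sub>R x) = c *\<^sub>R T x"
    and iso_T [simp]: "spiked_norm (T x) = spiked_norm x" if "x \<in> V" "y \<in> V" for x y c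
    using iso that by (auto simp: linear_isometry_on_def)
  have T_diff: "T (x - y) = T x - T y" if "x \<in> V" "y \<in> V" for x y
    using T_add[of x "- y"] T_scale[of y y "-1"] that by simp
  have surj: "\<exists>x\<in>V. T x = y" if "y \<in> V" for y
    using bij that unfolding bij_betw_def by (metis imageE)
  have "flat (\<lambda>x. spike n (T x))" if n: "n \<noteq> 0" for n
  proof -
    obtain z r where z: "z \<in> V" "r > 0" "\<And>x. x \<in> V \<Longrightarrow> spiked_norm (x - z) < r \<Longrightarrow> spiked_norm x = spike n x"
      using flat_spike[OF n] unfolding flat_def by blast
    obtain z' where z': "z' \<in> V" "T z' = z" using surj[OF z(1)] by blast
    have "spiked_norm x = spike n (T x)" if x: "x \<in> V" "spiked_norm (x - z') < r" for x
    proof -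
      have "T x - z = T (x - z')" using x z' by (simp add: T_diff)
      then have "spiked_norm (T x - z) < r" using x z' iso_T[of "x - z'" 0] by simp
      then show ?thesis using z(3)[of "T x"] x iso_T[of x 0] by simp
    qed
    moreover have "functional_on V (\<lambda>x. spike n (T x))"
      using spike_functional by (auto simp: functional_on_def T_add T_scale[of _ 0])
    ultimately show ?thesis unfolding flat_def using z z' by blast
  qed
  then have "\<exists>m h. h \<in> carrier H \<and> (\<forall>x\<in>V. spike n (T x) = spike m (A h x))" if "n \<noteq> 0" for n
    using flat_imp_spike[of "\<lambda>x. spike n (T x)"] that by metis
  then obtain m \<eta> where \<eta>: "\<And>n. n \<noteq> 0 \<Longrightarrow> \<eta> n \<in> carrier H"
    and spike_T: "\<And>n x. n \<noteq> 0 \<Longrightarrow> x \<in> V \<Longrightarrow> spike n (T x) = spike (m n) (A (\<eta> n) x)"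
    by metis
  define h where "h = \<eta> 1"
  have h: "h \<in> carrier H" using \<eta> by (simp add: h_def)
  have \<eta>_eq: "\<eta> n = h" if n: "n \<noteq> 0" for n
  proof (rule ccontr)
    assume ne: "\<eta> n \<noteq> h"
    define u where "u = A (inv (\<eta> n)) a"
    have u: "u \<in> V" "spiked_norm u = spiked_norm a" using \<eta>[OF n] by (auto simp: u_def)
    have "1 / 4 \<le> \<bar>spike n (T u) - spike 1 (T u)\<bar>"
      using spike_separates_orbit[OF \<eta>[OF n] h ne, of "m n" "m 1"] u n
      by (simp add: spike_T h_def u_def)
    also have "\<dots> \<le> 2 * max (node n) (node 1) * round_norm (T u)"
      using u by (intro spike_diff_upper) auto
    also have "\<dots> \<le> 2 * (1 / 1000) * 16"
      using round_norm_bounded[of "T u" a] u iso_T[of u 0] node_le[of n] node_le[of 1]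
        round_norm_le_imp[of "T u"] N_simps(1)[of "T u"] node_nonneg[of 1]
      by (intro mult_mono) auto
    finally show False by simp
  qed
  define S where "S x = T (A (inv h) x)" for x
  have S [simp]: "S x \<in> V" "spiked_norm (S x) = spiked_norm x" if "x \<in> V" for x
    using that h iso_T[of "A (inv h) x" 0] by (auto simp: S_def)
  have spike_S: "spike n (S x) = spike (m n) x" if "n \<noteq> 0" "x \<in> V" for n x
    using that h spike_T[of n "A (inv h) x"] by (simp add: S_def \<eta>_eq)
  have S_surj: "\<exists>x\<in>V. S x = y" if y: "y \<in> V" for y
  proof -
    obtain x where "x \<in> V" "T x = y" using surj[OF y] by blast
    then show ?thesis using h by (intro bexI[of _ "A h x"]) (auto simp: S_def)
  qed
  \<comment> \<open>both differences of consecutive spikes are compared with the same vector, \<open>b\<close> or its preimage\<close>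
  have max_eq: "max (node (m n)) (node (m (Suc n))) = node n" if n: "n \<noteq> 0" for n
  proof -
    define c where "c = max (node (m n)) (node (m (Suc n)))"
    have decr: "max (node n) (node (Suc n)) = node n"
      using node_gap[of n "Suc n"] node_nonneg[of n] n by simp
    obtain w where w: "w \<in> V" "S w = b" using S_surj[of b] by auto
    have "node n / 2 \<le> \<bar>spike n (S w) - spike (Suc n) (S w)\<bar>"
      using spike_diff_lower[of n "Suc n"] decr w by simp
    also have "\<dots> = \<bar>spike (m n) w - spike (m (Suc n)) w\<bar>" using n w(1) by (simp add: spike_S)
    finally have low: "node n / 2 \<le> \<bar>spike (m n) w - spike (m (Suc n)) w\<bar>" .
    have qw: "round_norm w \<le> 16" using round_norm_bounded[of w b] S(2)[OF w(1)] w by simp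
    have "\<bar>spike (m n) w - spike (m (Suc n)) w\<bar> \<le> 2 * c * round_norm w"
      unfolding c_def by (rule spike_diff_upper[OF w(1)])
    also have "\<dots> \<le> 2 * c * 16"
      using qw node_nonneg[of "m n"] by (intro mult_left_mono) (auto simp: c_def le_max_iff_disj)
    finally have 1: "node n \<le> 64 * c" using low by simp
    have "m n \<noteq> m (Suc n)" using low node_pos[OF n] by auto
    then have "c / 2 \<le> \<bar>spike (m n) b - spike (m (Suc n)) b\<bar>" unfolding c_def by (rule spike_diff_lower)
    also have "\<dots> = \<bar>spike n (S b) - spike (Suc n) (S b)\<bar>" using n by (simp add: spike_S)
    also have "\<dots> \<le> 2 * node n * round_norm (S b)" using spike_diff_upper[of "S b" n "Suc n"] decr by simp
    also have "\<dots> \<le> 2 * node n * 16"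
      using round_norm_bounded[of "S b" b] node_nonneg[of n] by (intro mult_left_mono) auto
    finally have 2: "c \<le> 64 * node n" by simp
    obtain k where "c = node k" by (metis c_def max_def)
    then show ?thesis using node_comparable_imp_eq[of k n] 1 2 n by (simp add: c_def)
  qed
  \<comment> \<open>the maximum for \<open>n + 1\<close> prevents \<open>m (n + 1)\<close> from attaining the one for \<open>n\<close>\<close>
  have m_eq: "m n = n" if n: "n \<noteq> 0" for n
  proof -
    have "node (m (Suc n)) \<le> node (Suc n)" using max_eq[of "Suc n"] by (metis max.cobounded1 Zero_not_Suc)
    moreover have "node (Suc n) < node n" using node_gap[of n "Suc n"] node_pos[OF n] n by simp
    ultimately have "node (m n) = node n" using max_eq[OF n] by (auto simp: max_def split: if_splits)
    then show ?thesis using node_comparable_imp_eq[of "m n" n] n node_nonneg[of n] by simp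
  qed
  have S_id: "S x = x" if x: "x \<in> V" for x
  proof -
    have "spike n (S x - x) = 0" if "n \<noteq> 0" for n
      using spike_S[OF that x] m_eq[OF that] x by (simp add: functional_onD[OF spike_functional])
    then have "S x - x = 0" using x by (intro spike_total) auto
    then show ?thesis by simp
  qed
  show thesis
  proof (rule that[OF h])
    fix x assume x: "x \<in> V"
    then show "T x = A h x" using S_id[of "A h x"] h by (simp add: S_def)
  qed
qed

theorem isometry_group_spiked_norm: "isometry_group V spiked_norm \<cong> H"
proof -
  define \<Phi> where "\<Phi> h = restrict (A h) V" for h
  have \<Phi>: "\<Phi> h \<in> Bij V" if h: "h \<in> carrier H" for h
  proof -
    have "bij_betw (A h) V V"
      by (rule bij_betwI[where g = "A (inv h)"]) (use h in auto)
    then show ?thesis by (simp add: Bij_def \<Phi>_def bij_betw_def)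
  qed
  have "linear_isometry_on V spiked_norm (\<Phi> h)" if h: "h \<in> carrier H" for h
    using h by (auto simp: linear_isometry_on_def \<Phi>_def A_add A_scale)
  with \<Phi> have car: "\<Phi> h \<in> carrier (isometry_group V spiked_norm)" if "h \<in> carrier H" for h
    using that by (simp add: isometry_group_def)
  have "\<Phi> \<in> hom H (isometry_group V spiked_norm)"
  proof (rule homI)
    fix g h assume gh: "g \<in> carrier H" "h \<in> carrier H"
    have "\<Phi> (g \<otimes> h) = compose V (\<Phi> g) (\<Phi> h)"
      using gh by (auto simp: \<Phi>_def compose_def A_mult fun_eq_iff restrict_def)
    then show "\<Phi> (g \<otimes> h) = \<Phi> g \<otimes>\<^bsub>isometry_group V spiked_norm\<^esub> \<Phi> h"
      using gh \<Phi> by (simp add: isometry_group_def BijGroup_def)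
  qed (rule car)
  moreover have "bij_betw \<Phi> (carrier H) (carrier (isometry_group V spiked_norm))"
    unfolding bij_betw_def
  proof (intro conjI equalityI subsetI)
    show "inj_on \<Phi> (carrier H)"
    proof (rule inj_onI, rule ccontr)
      fix h g assume hg: "h \<in> carrier H" "g \<in> carrier H" "\<Phi> h = \<Phi> g" "h \<noteq> g"
      have "A h (A (inv h) a) = A g (A (inv h) a)"
        using fun_cong[OF hg(3), of "A (inv h) a"] hg by (simp add: \<Phi>_def)
      then show False using spike_separates_orbit[OF hg(1,2,4), of 0 0] by simp
    qed
    fix T assume "T \<in> \<Phi> ` carrier H"
    then show "T \<in> carrier (isometry_group V spiked_norm)" using car by auto
  next
    fix T assume "T \<in> carrier (isometry_group V spiked_norm)"
    then have T: "T \<in> Bij V" "linear_isometry_on V spiked_norm T" by (auto simp: isometry_group_def)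
    obtain h where h: "h \<in> carrier H" "\<And>x. x \<in> V \<Longrightarrow> T x = A h x"
      using isometry_is_action[of T] T by (auto simp: Bij_def)
    have "T = \<Phi> h"
      using T(1) h(2) by (auto simp: \<Phi>_def Bij_def extensional_def fun_eq_iff)
    then show "T \<in> \<Phi> ` carrier H" using h by blast
  qed
  ultimately have "\<Phi> \<in> iso H (isometry_group V spiked_norm)" by (simp add: iso_def)
  then have "H \<cong> isometry_group V spiked_norm" by (auto simp: is_iso_def)
  then show ?thesis by (rule iso_sym)
qed

end

section \<open>Spaces with signed permutations of blocks\<close>

text \<open>
  The functional \<open>\<zeta> i k\<close> is the coordinate \<open>k\<close> of the block \<open>i\<close>. It suffices to demand that signed
  permutations of the blocks do not increase the norm, as the inverse permutation gives the other
  inequality, and that an image vector exists: since the coordinates separate points it is unique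
  and depends linearly on the vector.
\<close>
locale symmetric_blocks =
  fixes V :: "'a::real_vector set" and N :: "'a \<Rightarrow> real"
    and \<zeta> :: "nat \<Rightarrow> nat \<Rightarrow> 'a \<Rightarrow> real" and B :: real
  assumes V: "subspace V" and N: "norm_on V N"
    and functional: "\<And>i k. functional_on V (\<zeta> i k)"
    and bound: "\<And>i k x. x \<in> V \<Longrightarrow> \<bar>\<zeta> i k x\<bar> \<le> B * N x"
    and total: "\<And>x. x \<in> V \<Longrightarrow> (\<And>i k. \<zeta> i k x = 0) \<Longrightarrow> x = 0"
    and decay: "\<And>k x. x \<in> V \<Longrightarrow> (\<lambda>i. \<zeta> i k x) \<longlonglongrightarrow> 0"
    and permute: "\<And>\<pi> \<epsilon> x. bij \<pi> \<Longrightarrow> (\<And>i. \<epsilon> i \<in> {1, -1}) \<Longrightarrow> x \<in> V \<Longrightarrow>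
      \<exists>x'\<in>V. N x' \<le> N x \<and> (\<forall>i k. \<zeta> i k x' = \<epsilon> i * \<zeta> (\<pi> i) k x)"
    and unit: "\<exists>e\<in>V. \<forall>i. \<zeta> i 0 e = (if i = 0 then 1 else 0)"

locale symmetric_blocks_group = symmetric_blocks V N \<zeta> B + group H
  for V :: "'a::real_vector set" and N \<zeta> B and H :: "('g, 'm) monoid_scheme" (structure) +
  fixes j :: 'g
  assumes countable: "countable (carrier H)"
    and j [simp, intro]: "j \<in> carrier H" "j \<noteq> \<one>" and jj [simp]: "j \<otimes> j = \<one>"
    and j_comm: "\<And>x. x \<in> carrier H \<Longrightarrow> j \<otimes> x = x \<otimes> j"
begin

lemma V_closed [simp, intro]:
  "x \<in> V \<Longrightarrow> y \<in> V \<Longrightarrow> x + y \<in> V" "x \<in> V \<Longrightarrow> y \<in> V \<Longrightarrow> x - y \<in> V"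
  "x \<in> V \<Longrightarrow> c *\<^sub>R x \<in> V" "x \<in> V \<Longrightarrow> - x \<in> V" "0 \<in> V"
  using V by (auto intro: subspace_add subspace_diff subspace_scale subspace_neg subspace_0)

lemma \<zeta>_add: "x \<in> V \<Longrightarrow> y \<in> V \<Longrightarrow> \<zeta> i k (x + y) = \<zeta> i k x + \<zeta> i k y"
  and \<zeta>_scale: "x \<in> V \<Longrightarrow> \<zeta> i k (c *\<^sub>R x) = c * \<zeta> i k x"
  using functional unfolding functional_on_def by auto

lemma \<zeta>_diff: "x \<in> V \<Longrightarrow> y \<in> V \<Longrightarrow> \<zeta> i k (x - y) = \<zeta> i k x - \<zeta> i k y"
  using \<zeta>_add[of x "- y"] \<zeta>_scale[of y i k "-1"] by simp

lemma jj' [simp]: "h \<in> carrier H \<Longrightarrow> h \<otimes> j \<otimes> j = h"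
  by (simp add: m_assoc)

lemma mult_j_neq [simp]: "h \<in> carrier H \<Longrightarrow> h \<otimes> j \<noteq> h"
  by simp

text \<open>
  A choice of representatives of the cosets of \<open>{\<one>, j}\<close>: the set handed to the choice operator is
  the same for \<open>h\<close> and \<open>h \<otimes> j\<close>.
\<close>
definition rep :: "'g \<Rightarrow> 'g" where
  "rep h = (SOME x. x \<in> {h, h \<otimes> j})"

definition rep_sign :: "'g \<Rightarrow> real" where
  "rep_sign h = (if rep h = h then 1 else -1)"

lemma rep_cases: "rep h = h \<or> rep h = h \<otimes> j"
  using someI[of "\<lambda>x. x \<in> {h, h \<otimes> j}" h] by (simp add: rep_def)

lemma rep_closed [simp, intro]: "h \<in> carrier H \<Longrightarrow> rep h \<in> carrier H"
  using rep_cases[of h] by auto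

lemma rep_j: "h \<in> carrier H \<Longrightarrow> rep (h \<otimes> j) = rep h"
  by (simp add: rep_def insert_commute)

lemma rep_rep [simp]: "h \<in> carrier H \<Longrightarrow> rep (rep h) = rep h"
  using rep_cases[of h] rep_j[of h] by auto

lemma rep_sign_rep [simp]: "h \<in> carrier H \<Longrightarrow> rep_sign (rep h) = 1"
  by (simp add: rep_sign_def)

lemma rep_sign_j: "h \<in> carrier H \<Longrightarrow> rep_sign (h \<otimes> j) = - rep_sign h"
  using rep_cases[of h] rep_j[of h] by (auto simp: rep_sign_def)

lemma rep_sign_values: "rep_sign h \<in> {1, -1}" "\<bar>rep_sign h\<bar> = 1" "rep_sign h * rep_sign h = 1"
  by (auto simp: rep_sign_def)

lemma rep_eq_imp:
  assumes "h \<in> carrier H" "g \<in> carrier H" "rep h = rep g"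
  shows "h = g \<or> h = g \<otimes> j"
proof -
  have "h = rep h \<or> h = rep h \<otimes> j" "rep g = g \<or> rep g = g \<otimes> j"
    using rep_cases[of h] rep_cases[of g] assms by auto
  then show ?thesis using assms by auto
qed

text \<open>
  Infinitely many blocks belong to each coset, so that finite groups are treated like infinite
  ones and two independent coordinates are available on one coset.
\<close>
definition block_of :: "'g \<times> nat \<Rightarrow> nat" where
  "block_of = to_nat_on (rep ` carrier H \<times> UNIV)"

lemma block_of_bij: "bij_betw block_of (rep ` carrier H \<times> UNIV) UNIV"
  unfolding block_of_def
proof (rule to_nat_on_infinite)
  show "countable (rep ` carrier H \<times> (UNIV :: nat set))"
    using countable by (intro countable_SIGMA countable_image) auto
  have "rep ` carrier H \<noteq> {}" using one_closed by blast
  then show "infinite (rep ` carrier H \<times> (UNIV :: nat set))"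
    by (simp add: finite_cartesian_product_iff)
qed

lemma block_of_eq_iff:
  "h \<in> carrier H \<Longrightarrow> g \<in> carrier H \<Longrightarrow> block_of (rep h, n) = block_of (rep g, m) \<longleftrightarrow> rep h = rep g \<and> n = m"
  using bij_betw_imp_inj_on[OF block_of_bij] by (auto dest: inj_onD)

lemma block_of_surj: obtains r n where "r \<in> carrier H" "rep r = r" "i = block_of (r, n)"
proof -
  have "i \<in> block_of ` (rep ` carrier H \<times> UNIV)" using block_of_bij by (simp add: bij_betw_def)
  then obtain h n where "h \<in> carrier H" "i = block_of (rep h, n)" by auto
  then show thesis using that[of "rep h" n] by simp
qed

text \<open>
  The coordinates of a vector read as those of a function on \<open>H\<close> that is odd with respect to \<open>j\<close>.
\<close>
definition odd_coord :: "'g \<Rightarrow> nat \<Rightarrow> nat \<Rightarrow> 'a \<Rightarrow> real" where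
  "odd_coord h n k x = rep_sign h * \<zeta> (block_of (rep h, n)) k x"

lemma odd_coord_j: "h \<in> carrier H \<Longrightarrow> odd_coord (h \<otimes> j) n k x = - odd_coord h n k x"
  by (simp add: odd_coord_def rep_sign_j rep_j)

lemma odd_coord_functional: "functional_on V (odd_coord h n k)"
  by (auto simp: functional_on_def odd_coord_def \<zeta>_add \<zeta>_scale algebra_simps)

lemma odd_coord_separates:
  assumes "x \<in> V" "y \<in> V" "\<And>h n k. h \<in> carrier H \<Longrightarrow> odd_coord h n k x = odd_coord h n k y"
  shows "x = y"
proof -
  have "\<zeta> i k (x - y) = 0" for i k
  proof -
    obtain r n where "r \<in> carrier H" "rep r = r" "i = block_of (r, n)" by (rule block_of_surj)
    then show ?thesis using assms(3)[of r n k] assms(1,2) by (simp add: odd_coord_def rep_sign_def \<zeta>_diff)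
  qed
  then have "x - y = 0" using assms by (intro total) auto
  then show ?thesis by simp
qed

text \<open>
  Right translation by \<open>g\<close> permutes the cosets of \<open>{\<one>, j}\<close>, and the sign records whether it leads
  from the representative of a coset to a representative.
\<close>
lemma translate_exists:
  assumes g: "g \<in> carrier H" and x: "x \<in> V"
  shows "\<exists>x'\<in>V. N x' \<le> N x \<and> (\<forall>h\<in>carrier H. \<forall>n k. odd_coord h n k x' = odd_coord (h \<otimes> g) n k x)"
proof -
  define block where "block = inv_into (rep ` carrier H \<times> UNIV) block_of"
  have block [simp]: "block (block_of (rep h, n)) = (rep h, n)" if "h \<in> carrier H" for h n
    unfolding block_def using that bij_betw_imp_inj_on[OF block_of_bij] by (intro inv_into_f_f) auto
  define \<pi> where "\<pi> g i = block_of (rep (fst (block i) \<otimes> g), snd (block i))" for g i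
  define \<epsilon> where "\<epsilon> i = rep_sign (fst (block i) \<otimes> g)" for i
  have inverse: "\<pi> (inv g) (\<pi> g i) = i" if g: "g \<in> carrier H" for g i
  proof -
    obtain r n where r: "r \<in> carrier H" "rep r = r" "i = block_of (r, n)" by (rule block_of_surj)
    then have b: "block i = (r, n)" using block[of r n] by simp
    have "rep (rep (r \<otimes> g) \<otimes> inv g) = rep r"
    proof (cases "rep (r \<otimes> g) = r \<otimes> g")
      case True
      then show ?thesis using r g by (simp add: m_assoc)
    next
      case False
      then have "rep (r \<otimes> g) = r \<otimes> g \<otimes> j" using rep_cases by blast
      moreover have "g \<otimes> (j \<otimes> inv g) = j"
        unfolding j_comm[OF inv_closed[OF g]] using g by (simp add: m_assoc[symmetric])
      ultimately have "rep (r \<otimes> g) \<otimes> inv g = r \<otimes> j" using r g by (simp add: m_assoc)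
      then show ?thesis using r rep_j[of r] by simp
    qed
    then show ?thesis using r g b by (simp add: \<pi>_def)
  qed
  have "bij (\<pi> g)"
    using inverse[OF g] inverse[of "inv g"] g by (intro bij_betwI[where g = "\<pi> (inv g)"]) auto
  then obtain x' where x': "x' \<in> V" "N x' \<le> N x" "\<And>i k. \<zeta> i k x' = \<epsilon> i * \<zeta> (\<pi> g i) k x"
    using permute[of "\<pi> g" \<epsilon> x] x rep_sign_values by (auto simp: \<epsilon>_def)
  have rep_eq: "odd_coord (rep h) n k x' = odd_coord (rep h \<otimes> g) n k x" if "h \<in> carrier H" for h n k
    using that x'(3)[of "block_of (rep h, n)" k] by (simp add: odd_coord_def \<epsilon>_def \<pi>_def)
  have "odd_coord h n k x' = odd_coord (h \<otimes> g) n k x" if h: "h \<in> carrier H" for h n k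
  proof (cases "rep h = h")
    case True
    then show ?thesis using rep_eq[OF h] by simp
  next
    case False
    then have r: "rep h = h \<otimes> j" using rep_cases by blast
    have "h \<otimes> j \<otimes> g = h \<otimes> g \<otimes> j" using h g j_comm[OF g] by (simp add: m_assoc)
    then show ?thesis using rep_eq[OF h, of n k] h g unfolding r by (simp add: odd_coord_j)
  qed
  with x' show ?thesis by blast
qed

definition translate :: "'g \<Rightarrow> 'a \<Rightarrow> 'a" where
  "translate g x = (SOME x'. x' \<in> V \<and> N x' \<le> N x \<and> (\<forall>h\<in>carrier H. \<forall>n k. odd_coord h n k x' = odd_coord (h \<otimes> g) n k x))"

lemma translate:
  assumes "g \<in> carrier H" "x \<in> V"
  shows translate_closed: "translate g x \<in> V" and translate_le: "N (translate g x) \<le> N x"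
    and odd_coord_translate: "h \<in> carrier H \<Longrightarrow> odd_coord h n k (translate g x) = odd_coord (h \<otimes> g) n k x"
proof -
  have "\<exists>x'. x' \<in> V \<and> N x' \<le> N x \<and> (\<forall>h\<in>carrier H. \<forall>n k. odd_coord h n k x' = odd_coord (h \<otimes> g) n k x)"
    using translate_exists[OF assms] by blast
  then have *: "translate g x \<in> V \<and> N (translate g x) \<le> N x \<and> (\<forall>h\<in>carrier H. \<forall>n k. odd_coord h n k (translate g x) = odd_coord (h \<otimes> g) n k x)"
    unfolding translate_def by (rule someI_ex)
  then show "translate g x \<in> V" "N (translate g x) \<le> N x" by auto
  show "odd_coord h n k (translate g x) = odd_coord (h \<otimes> g) n k x" if "h \<in> carrier H" using * that by blast
qed

text \<open>
  At most two group elements move a given block to a prescribed one.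
\<close>
lemma odd_coord_decay:
  assumes r: "r \<in> carrier H" and x: "x \<in> V" and e: "e > 0"
  shows "finite {h \<in> carrier H. \<bar>odd_coord r n k (translate h x)\<bar> > e}"
proof -
  define I where "I = {i. \<bar>\<zeta> i k x\<bar> > e}"
  have "eventually (\<lambda>i. \<bar>\<zeta> i k x\<bar> < e) sequentially"
    using tendsto_rabs[OF decay[OF x, of k]] e by (simp add: order_tendstoD)
  then obtain K where "\<And>i. i \<ge> K \<Longrightarrow> \<bar>\<zeta> i k x\<bar> < e" by (auto simp: eventually_sequentially)
  then have "I \<subseteq> {..<K}" by (force simp: I_def not_less[symmetric])
  then have "finite I" by (rule finite_subset) simp
  moreover have "finite {h \<in> carrier H. block_of (rep (r \<otimes> h), n) = i}" (is "finite ?F") for i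
  proof (cases "?F = {}")
    case False
    then obtain h0 where h0: "h0 \<in> carrier H" "block_of (rep (r \<otimes> h0), n) = i" by blast
    have "?F \<subseteq> {h0, h0 \<otimes> j}"
    proof
      fix h assume h: "h \<in> ?F"
      then have "rep (r \<otimes> h) = rep (r \<otimes> h0)" using h0 r block_of_eq_iff[of "r \<otimes> h" "r \<otimes> h0" n n] by simp
      then have "r \<otimes> h = r \<otimes> h0 \<or> r \<otimes> h = r \<otimes> h0 \<otimes> j" using h h0 r by (intro rep_eq_imp) auto
      then show "h \<in> {h0, h0 \<otimes> j}" using h h0 r by (simp add: m_assoc)
    qed
    then show ?thesis by (rule finite_subset) simp
  next
    case True
    then show ?thesis by (simp only: finite.emptyI)
  qed
  ultimately have "finite (\<Union>i\<in>I. {h \<in> carrier H. block_of (rep (r \<otimes> h), n) = i})" by simp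
  moreover have "{h \<in> carrier H. \<bar>odd_coord r n k (translate h x)\<bar> > e} \<subseteq> \<dots>"
    using r x by (auto simp: odd_coord_translate) (auto simp: odd_coord_def abs_mult rep_sign_values I_def)
  ultimately show ?thesis by (rule rev_finite_subset)
qed

lemma unit_block:
  assumes "\<sigma> \<in> {1, -1}"
  shows "\<exists>x\<in>V. \<forall>i. \<zeta> i 0 x = (if i = m then \<sigma> else 0)"
proof -
  obtain e where e: "e \<in> V" "\<And>i. \<zeta> i 0 e = (if i = 0 then 1 else 0)" using unit by blast
  obtain x where "x \<in> V" "\<And>i k. \<zeta> i k x = \<sigma> * \<zeta> (Transposition.transpose 0 m i) k e"
    using permute[of "Transposition.transpose 0 m" "\<lambda>_. \<sigma>" e] assms e(1) by auto
  then show ?thesis by (intro bexI[of _ x]) (auto simp: e(2) Transposition.transpose_def)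
qed

lemma representable: "representable H V N"
proof -
  have N': "0 \<le> N x" "N x = 0 \<longleftrightarrow> x = 0" "N (c *\<^sub>R x) = \<bar>c\<bar> * N x" if "x \<in> V" for x c
    using N that by (auto simp: norm_on_def)
  define m where "m n = block_of (rep \<one>, n)" for n
  obtain a where a: "a \<in> V" "\<And>i. \<zeta> i 0 a = (if i = m 0 then rep_sign \<one> else 0)"
    using unit_block[OF rep_sign_values(1)] by metis
  obtain b where b: "b \<in> V" "\<And>i. \<zeta> i 0 b = (if i = m 1 then rep_sign \<one> else 0)"
    using unit_block[OF rep_sign_values(1)] by metis
  have Za: "odd_coord h n 0 a = (if n = 0 \<and> (h = \<one> \<or> h = j) then rep_sign h * rep_sign \<one> else 0)" if "h \<in> carrier H" for h n
    using that rep_eq_imp[of h \<one>] rep_j[of \<one>] block_of_eq_iff[of h \<one> n 0]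
    by (auto simp: odd_coord_def a(2) m_def)
  have Zb: "odd_coord h n 0 b = (if n = 1 \<and> (h = \<one> \<or> h = j) then rep_sign h * rep_sign \<one> else 0)" if "h \<in> carrier H" for h n
    using that rep_eq_imp[of h \<one>] rep_j[of \<one>] block_of_eq_iff[of h \<one> n 1]
    by (auto simp: odd_coord_def b(2) m_def)
  have "a \<noteq> 0" using Za[of \<one> 0] rep_sign_values(3)[of \<one>] \<zeta>_scale[of 0 _ 0 0] by (auto simp: odd_coord_def)
  then have Na: "N a > 0" using N'[OF a(1)] by (simp add: less_le)
  have Nb: "0 \<le> N b" using N'[OF b(1)] by simp
  \<comment> \<open>scaling the norm normalises \<open>a\<close> and \<open>b\<close>; the functionals \<open>\<gamma>\<close> are scaled along with it\<close>
  define \<kappa> where "\<kappa> = 1 / (N a + N b)"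
  have \<kappa>: "\<kappa> > 0" "\<kappa> * N a \<le> 1" "\<kappa> * N b \<le> 1" using Na Nb by (auto simp: \<kappa>_def)
  define D where "D = \<bar>B\<bar> + 1"
  have D: "D > 0" by (simp add: D_def)
  have bound': "\<bar>\<zeta> i k x\<bar> \<le> D * N x" if x: "x \<in> V" for i k x
  proof -
    have "B * N x \<le> D * N x" using N'(1)[OF x] by (intro mult_right_mono) (auto simp: D_def)
    then show ?thesis using bound[OF x, of i k] by linarith
  qed
  define \<gamma> where "\<gamma> l x = \<kappa> / D * \<zeta> (fst (prod_decode l)) (snd (prod_decode l)) x" for l x
  have \<gamma>_Z: "\<exists>r n k. r \<in> carrier H \<and> (\<forall>x. \<gamma> l x = \<kappa> / D * odd_coord r n k x)" for l
  proof -
    obtain r n where "r \<in> carrier H" "rep r = r" "fst (prod_decode l) = block_of (r, n)" by (rule block_of_surj)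
    then have "\<gamma> l x = \<kappa> / D * odd_coord r n (snd (prod_decode l)) x" for x by (simp add: \<gamma>_def odd_coord_def rep_sign_def)
    then show ?thesis using \<open>r \<in> carrier H\<close> by blast
  qed
  have odd_coord_bound: "\<bar>odd_coord h n k x\<bar> \<le> D / \<kappa> * (\<kappa> * N x)" if "x \<in> V" for h n k x
    using bound'[OF that] \<kappa> by (simp add: odd_coord_def abs_mult rep_sign_values)
  interpret S: spiked_action H V "\<lambda>x. \<kappa> * N x" j translate "odd_coord \<one> 0 0" "odd_coord \<one> 1 0" \<gamma> a b "D / \<kappa>"
  proof
    show "norm_on V (\<lambda>x. \<kappa> * N x)"
      using N \<kappa>(1) unfolding norm_on_def
      by (auto simp: mult.left_commute distrib_left[symmetric])
    show "translate h (x + y) = translate h x + translate h y" if "h \<in> carrier H" "x \<in> V" "y \<in> V" for h x y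
      using that odd_coord_functional unfolding functional_on_def by (intro odd_coord_separates) (auto simp: translate_closed odd_coord_translate)
    show "translate h (c *\<^sub>R x) = c *\<^sub>R translate h x" if "h \<in> carrier H" "x \<in> V" for h x c
      using that odd_coord_functional unfolding functional_on_def by (intro odd_coord_separates) (auto simp: translate_closed odd_coord_translate)
    show "translate (g \<otimes> h) x = translate g (translate h x)" if "g \<in> carrier H" "h \<in> carrier H" "x \<in> V" for g h x
      using that by (intro odd_coord_separates) (auto simp: translate_closed odd_coord_translate m_assoc)
    show one: "translate \<one> x = x" if "x \<in> V" for x
      using that by (intro odd_coord_separates) (auto simp: translate_closed odd_coord_translate)
    show "translate j x = - x" if x: "x \<in> V" for x
    proof (rule odd_coord_separates)
      show "odd_coord h n k (translate j x) = odd_coord h n k (- x)" if h: "h \<in> carrier H" for h n k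
      proof -
        have "odd_coord h n k (-1 *\<^sub>R x) = -1 * odd_coord h n k x"
          using x odd_coord_functional[of h n k] unfolding functional_on_def by blast
        then show ?thesis using h x by (simp add: odd_coord_translate odd_coord_j)
      qed
    qed (use that in \<open>auto simp: translate_closed\<close>)
    show "\<kappa> * N (translate h x) = \<kappa> * N x" if h: "h \<in> carrier H" and x: "x \<in> V" for h x
    proof -
      have "translate (inv h) (translate h x) = x"
        using h x by (intro odd_coord_separates) (auto simp: translate_closed odd_coord_translate m_assoc)
      then show ?thesis using translate_le[OF h x] translate_le[of "inv h" "translate h x"] h x by (simp add: translate_closed)
    qed
    show "functional_on V (\<gamma> l)" for l
      by (auto simp: functional_on_def \<gamma>_def \<zeta>_add \<zeta>_scale algebra_simps)
    show "\<bar>\<gamma> l x\<bar> \<le> \<kappa> * N x" if x: "x \<in> V" for l x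
    proof -
      have "\<bar>\<gamma> l x\<bar> = \<kappa> / D * \<bar>\<zeta> (fst (prod_decode l)) (snd (prod_decode l)) x\<bar>"
        using \<kappa> D by (simp add: \<gamma>_def abs_mult)
      also have "\<dots> \<le> \<kappa> / D * (D * N x)" using \<kappa> D bound'[OF x] by (intro mult_left_mono) auto
      finally show ?thesis using D by simp
    qed
    show "x = 0" if x: "x \<in> V" and "\<And>l. \<gamma> l x = 0" for x
    proof (rule total[OF x])
      show "\<zeta> i k x = 0" for i k
        using that(2)[of "prod_encode (i, k)"] \<kappa> D by (simp add: \<gamma>_def)
    qed
    show "finite {h \<in> carrier H. \<bar>odd_coord \<one> 0 0 (translate h x)\<bar> > e}" "finite {h \<in> carrier H. \<bar>odd_coord \<one> 1 0 (translate h x)\<bar> > e}"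
      if "x \<in> V" "e > 0" for x e
      using that by (auto intro: odd_coord_decay)
    show "finite {h \<in> carrier H. \<bar>\<gamma> l (translate h x)\<bar> > e}" if x: "x \<in> V" and e: "e > 0" for l x e
    proof -
      obtain r n k where r: "r \<in> carrier H" "\<And>x. \<gamma> l x = \<kappa> / D * odd_coord r n k x" using \<gamma>_Z by metis
      have "{h \<in> carrier H. \<bar>\<gamma> l (translate h x)\<bar> > e} = {h \<in> carrier H. \<bar>odd_coord r n k (translate h x)\<bar> > e * D / \<kappa>}"
        using \<kappa> D by (auto simp: r(2) abs_mult field_simps)
      then show ?thesis using odd_coord_decay[OF r(1) x, of "e * D / \<kappa>"] e \<kappa> D by simp
    qed
  qed (use V a b \<kappa> Za Zb odd_coord_functional odd_coord_bound rep_sign_values(3)[of \<one>] in \<open>auto simp: translate_closed odd_coord_translate\<close>)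
  have "equivalent_norms V N (\<lambda>x. \<kappa> * N x)"
    using \<kappa>(1) by (auto simp: equivalent_norms_def)
  then show ?thesis
    unfolding representable_def
    using S.norm_on_spiked_norm S.isometry_group_spiked_norm equivalent_norms_trans[OF _ S.equivalent_norms_spiked_norm] by blast
qed

end

text \<open>
  The block structure may refer to an equivalent norm, as it does for \<open>C([0,1])\<close>.
\<close>
theorem (in symmetric_blocks) representable_iff:
  assumes H: "group H" "countable (carrier H)" and eq: "equivalent_norms V N0 N"
  shows "representable H V N0 \<longleftrightarrow> (\<exists>K. K \<lhd> H \<and> card K = 2)"
proof
  obtain e where e: "e \<in> V" "\<zeta> 0 0 e = 1" using unit by auto
  have "\<zeta> 0 0 (0 *\<^sub>R e) = 0 * \<zeta> 0 0 e"
    using e(1) functional[of 0 0] unfolding functional_on_def by blast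
  then have "e \<noteq> 0" using e(2) by auto
  moreover assume "representable H V N0"
  ultimately show "\<exists>K. K \<lhd> H \<and> card K = 2"
    using representable_imp_central_involution[OF H(1) V e(1)]
    by (simp add: normal_subgroup_card_2_iff_central_involution[OF H(1)])
next
  assume "\<exists>K. K \<lhd> H \<and> card K = 2"
  then obtain j where "central_involution H j"
    by (auto simp: normal_subgroup_card_2_iff_central_involution[OF H(1)])
  then have j: "j \<in> carrier H" "j \<noteq> \<one>\<^bsub>H\<^esub>" "j \<otimes>\<^bsub>H\<^esub> j = \<one>\<^bsub>H\<^esub>"
    "\<forall>x\<in>carrier H. j \<otimes>\<^bsub>H\<^esub> x = x \<otimes>\<^bsub>H\<^esub> j"
    unfolding central_involution_def by blast+
  have "symmetric_blocks_group V N \<zeta> B H j"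
    using H j by (intro symmetric_blocks_group.intro symmetric_blocks_axioms
        symmetric_blocks_group_axioms.intro; blast)
  then have "representable H V N" by (rule symmetric_blocks_group.representable)
  then show "representable H V N0"
    using equivalent_norms_trans[OF eq] unfolding representable_def by blast
qed

section \<open>Null sequences\<close>

lemma tendsto_zero_reindex:
  fixes x :: "nat \<Rightarrow> real"
  assumes "x \<longlonglongrightarrow> 0" "inj \<pi>"
  shows "(\<lambda>i. x (\<pi> i)) \<longlonglongrightarrow> 0"
proof -
  have "filterlim \<pi> cofinite cofinite"
    unfolding filterlim_iff eventually_cofinite using assms(2) finite_vimageI[of _ \<pi>] by (fastforce simp: vimage_def)
  then show ?thesis
    using assms(1) unfolding cofinite_eq_sequentially by (rule filterlim_compose[rotated])
qed

lemma c0_bounded: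
  assumes "x \<in> c0_space"
  shows "bdd_above (range (\<lambda>n. \<bar>x n\<bar>))"
proof -
  have "Bseq x" using assms by (auto simp: c0_space_def intro!: convergent_imp_Bseq convergentI)
  then show ?thesis by (auto simp: Bseq_def bdd_above_def)
qed

lemma c0_norm_upper: "x \<in> c0_space \<Longrightarrow> \<bar>x n\<bar> \<le> c0_norm x"
  unfolding c0_norm_def by (rule cSUP_upper[OF _ c0_bounded]) auto

lemma c0_norm_le: "(\<And>n. \<bar>x n\<bar> \<le> B) \<Longrightarrow> c0_norm x \<le> B"
  unfolding c0_norm_def by (rule cSUP_least) auto

lemma subspace_c0: "subspace c0_space"
  unfolding subspace_def c0_space_def
  by (auto simp: scaleR_fun_def plus_fun_def zero_fun_def intro: tendsto_add_zero tendsto_mult_right_zero)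

lemma norm_on_c0: "norm_on c0_space c0_norm"
  unfolding c0_norm_def
proof (rule norm_on_SUP_functionals[OF subspace_c0 _ c0_bounded])
  show "functional_on c0_space (\<lambda>x. x n)" for n :: nat
    by (simp add: functional_on_def scaleR_fun_def)
qed (auto simp: fun_eq_iff)

lemma symmetric_blocks_c0: "symmetric_blocks c0_space c0_norm (\<lambda>i k x. x i) 1"
proof
  show "functional_on c0_space (\<lambda>x. x i)" for i :: nat
    by (simp add: functional_on_def scaleR_fun_def)
  show "(\<lambda>i. x i) \<longlonglongrightarrow> 0" if "x \<in> c0_space" for x
    using that by (simp add: c0_space_def)
  show "\<exists>x'\<in>c0_space. c0_norm x' \<le> c0_norm x \<and> (\<forall>i k. x' i = \<epsilon> i * x (\<pi> i))"
    if \<pi>: "bij \<pi>" and \<epsilon>: "\<And>i. \<epsilon> i \<in> {1, -1}" and x: "x \<in> c0_space" for \<pi> \<epsilon> and x :: "nat \<Rightarrow> real"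
  proof (intro bexI[of _ "\<lambda>i. \<epsilon> i * x (\<pi> i)"] conjI)
    have abs: "\<bar>\<epsilon> i * x (\<pi> i)\<bar> = \<bar>x (\<pi> i)\<bar>" for i using \<epsilon>[of i] by auto
    then show "c0_norm (\<lambda>i. \<epsilon> i * x (\<pi> i)) \<le> c0_norm x"
      using c0_norm_upper[OF x] by (intro c0_norm_le) auto
    have "(\<lambda>i. x (\<pi> i)) \<longlonglongrightarrow> 0"
      using x by (intro tendsto_zero_reindex[OF _ bij_is_inj[OF \<pi>], of x]) (simp add: c0_space_def)
    then have "(\<lambda>i. \<bar>\<epsilon> i * x (\<pi> i)\<bar>) \<longlonglongrightarrow> 0" unfolding abs by (rule tendsto_rabs_zero)
    then show "(\<lambda>i. \<epsilon> i * x (\<pi> i)) \<in> c0_space"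
      unfolding c0_space_def by (simp add: tendsto_rabs_zero_iff)
  qed simp
  have "(\<lambda>i. if i = 0 then 1 else 0 :: real) \<longlonglongrightarrow> 0"
    by (rule tendsto_eventually) (auto simp: eventually_sequentially intro: exI[of _ 1])
  then show "\<exists>e\<in>c0_space. \<forall>i. e i = (if i = 0 then 1 else 0)"
    by (intro bexI[of _ "\<lambda>i. if i = 0 then 1 else 0"]) (auto simp: c0_space_def)
qed (auto simp: subspace_c0 norm_on_c0 c0_norm_upper fun_eq_iff)

section \<open>Minkowski's inequality and the sequence spaces\<close>

lemma powr_convex_nonneg:
  fixes u v t p :: real
  assumes p: "p \<ge> 1" and t: "0 \<le> t" "t \<le> 1" and uv: "0 \<le> u" "0 \<le> v"
  shows "(t * u + (1 - t) * v) powr p \<le> t * u powr p + (1 - t) * v powr p"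
proof -
  have scaled: "(s * w) powr p \<le> s * w powr p" if "0 \<le> s" "s \<le> 1" "0 \<le> w" for s w :: real
  proof (cases "s = 0")
    case False
    have "s powr p \<le> s powr 1" using that p False by (intro powr_mono') auto
    then show ?thesis using that by (simp add: powr_mult mult_right_mono)
  qed simp
  consider "u = 0" | "v = 0" | "u > 0" "v > 0" using uv by linarith
  then show ?thesis
  proof cases
    case 3
    then show ?thesis
      using convex_onD[OF powr_convex[OF p], of t v u] t by (simp add: add.commute)
  qed (use scaled[of t u] scaled[of "1 - t" v] t uv in auto)
qed

lemma integrable_powr_add:
  fixes f g :: "'b \<Rightarrow> real"
  assumes [measurable]: "f \<in> borel_measurable M" "g \<in> borel_measurable M" and p: "p \<ge> 1"
    and int: "integrable M (\<lambda>x. \<bar>f x\<bar> powr p)" "integrable M (\<lambda>x. \<bar>g x\<bar> powr p)"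
  shows "integrable M (\<lambda>x. \<bar>f x + g x\<bar> powr p)"
proof (rule Bochner_Integration.integrable_bound)
  show "integrable M (\<lambda>x. 2 powr p * (\<bar>f x\<bar> powr p + \<bar>g x\<bar> powr p))"
    using int by (intro integrable_mult_right Bochner_Integration.integrable_add)
  have "\<bar>f x + g x\<bar> powr p \<le> 2 powr p * (\<bar>f x\<bar> powr p + \<bar>g x\<bar> powr p)" for x
  proof -
    define m where "m = max \<bar>f x\<bar> \<bar>g x\<bar>"
    have "\<bar>f x + g x\<bar> powr p \<le> (2 * m) powr p"
      using p by (intro powr_mono2) (auto simp: m_def)
    also have "\<dots> = 2 powr p * m powr p" by (simp add: powr_mult m_def)
    also have "m powr p \<le> \<bar>f x\<bar> powr p + \<bar>g x\<bar> powr p" by (auto simp: m_def max_def)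
    finally show ?thesis by simp
  qed
  then show "AE x in M. norm (\<bar>f x + g x\<bar> powr p) \<le> norm (2 powr p * (\<bar>f x\<bar> powr p + \<bar>g x\<bar> powr p))"
    by (intro AE_I2) simp
qed measurable

text \<open>
  With \<open>\<alpha>\<close> and \<open>\<beta>\<close> slightly larger than the two norms, \<open>\<bar>f + g\<bar> / (\<alpha> + \<beta>)\<close> is bounded by a
  convex combination of \<open>\<bar>f\<bar> / \<alpha>\<close> and \<open>\<bar>g\<bar> / \<beta>\<close>, and \<open>t powr p\<close> is convex. The slack avoids a
  separate treatment of functions of norm zero.
\<close>
lemma Minkowski_integral:
  fixes f g :: "'b \<Rightarrow> real"
  assumes [measurable]: "f \<in> borel_measurable M" "g \<in> borel_measurable M" and p: "p \<ge> 1"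
    and int: "integrable M (\<lambda>x. \<bar>f x\<bar> powr p)" "integrable M (\<lambda>x. \<bar>g x\<bar> powr p)"
  shows "(\<integral>x. \<bar>f x + g x\<bar> powr p \<partial>M) powr (1 / p)
    \<le> (\<integral>x. \<bar>f x\<bar> powr p \<partial>M) powr (1 / p) + (\<integral>x. \<bar>g x\<bar> powr p \<partial>M) powr (1 / p)"
proof (rule field_le_epsilon)
  fix e :: real assume e: "e > 0"
  define I where "I h = (\<integral>x. \<bar>h x\<bar> powr p \<partial>M)" for h :: "'b \<Rightarrow> real"
  have I0: "0 \<le> I h" for h by (simp add: I_def)
  define \<alpha> \<beta> where "\<alpha> = I f powr (1 / p) + e / 2" and "\<beta> = I g powr (1 / p) + e / 2"
  have ab: "\<alpha> > 0" "\<beta> > 0" using e by (auto simp: \<alpha>_def \<beta>_def intro: add_nonneg_pos)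
  have I_le: "I h \<le> (I h powr (1 / p) + e / 2) powr p" for h
  proof -
    have "I h = (I h powr (1 / p)) powr p" using p I0 by (simp add: powr_powr)
    also have "\<dots> \<le> (I h powr (1 / p) + e / 2) powr p" using p e by (intro powr_mono2) auto
    finally show ?thesis .
  qed
  define t where "t = \<alpha> / (\<alpha> + \<beta>)"
  have t: "0 \<le> t" "t \<le> 1" "1 - t = \<beta> / (\<alpha> + \<beta>)" using ab by (auto simp: t_def field_simps)
  let ?r = "\<lambda>x. t * (\<bar>f x\<bar> / \<alpha>) powr p + (1 - t) * (\<bar>g x\<bar> / \<beta>) powr p"
  have r: "?r x = t / \<alpha> powr p * \<bar>f x\<bar> powr p + (1 - t) / \<beta> powr p * \<bar>g x\<bar> powr p" for x
    using ab by (simp add: powr_divide)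
  have pw: "\<bar>f x + g x\<bar> powr p \<le> (\<alpha> + \<beta>) powr p * ?r x" for x
  proof -
    define w where "w = t * (\<bar>f x\<bar> / \<alpha>) + (1 - t) * (\<bar>g x\<bar> / \<beta>)"
    have w: "0 \<le> w" using t ab by (simp add: w_def)
    have "t * (\<bar>f x\<bar> / \<alpha>) = \<bar>f x\<bar> / (\<alpha> + \<beta>)" "(1 - t) * (\<bar>g x\<bar> / \<beta>) = \<bar>g x\<bar> / (\<alpha> + \<beta>)"
      unfolding t(3) using ab by (simp_all add: t_def)
    then have sum: "\<bar>f x\<bar> + \<bar>g x\<bar> = (\<alpha> + \<beta>) * w"
      using ab by (simp add: w_def add_divide_distrib[symmetric])
    have "\<bar>f x + g x\<bar> powr p \<le> ((\<alpha> + \<beta>) * w) powr p"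
      using p sum abs_triangle_ineq[of "f x" "g x"] by (intro powr_mono2) auto
    moreover have "((\<alpha> + \<beta>) * w) powr p = (\<alpha> + \<beta>) powr p * w powr p"
      by (rule powr_mult)
    moreover have "(\<alpha> + \<beta>) powr p * w powr p \<le> (\<alpha> + \<beta>) powr p * ?r x"
      using p t ab powr_convex_nonneg[of p t "\<bar>f x\<bar> / \<alpha>" "\<bar>g x\<bar> / \<beta>"]
      by (intro mult_left_mono) (simp_all add: w_def)
    ultimately show ?thesis by linarith
  qed
  have "I (\<lambda>x. f x + g x) \<le> (\<integral>x. (\<alpha> + \<beta>) powr p * ?r x \<partial>M)"
    unfolding I_def r by (intro integral_mono integrable_powr_add integrable_mult_right
        Bochner_Integration.integrable_add assms) (use pw in \<open>simp add: r\<close>)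
  also have "\<dots> = (\<alpha> + \<beta>) powr p * (t * (I f / \<alpha> powr p) + (1 - t) * (I g / \<beta> powr p))"
    unfolding r I_def using int by (simp add: Bochner_Integration.integral_add)
  also have "\<dots> \<le> (\<alpha> + \<beta>) powr p * (t * 1 + (1 - t) * 1)"
    using t ab I_le[of f] I_le[of g]
    by (intro mult_left_mono add_mono) (auto simp: \<alpha>_def \<beta>_def)
  finally have "I (\<lambda>x. f x + g x) \<le> (\<alpha> + \<beta>) powr p" by simp
  then have "I (\<lambda>x. f x + g x) powr (1 / p) \<le> ((\<alpha> + \<beta>) powr p) powr (1 / p)"
    using p I0 by (intro powr_mono2) auto
  also have "\<dots> = \<alpha> + \<beta>" using p ab by (simp add: powr_powr)
  finally show "(\<integral>x. \<bar>f x + g x\<bar> powr p \<partial>M) powr (1 / p)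
    \<le> (\<integral>x. \<bar>f x\<bar> powr p \<partial>M) powr (1 / p) + (\<integral>x. \<bar>g x\<bar> powr p \<partial>M) powr (1 / p) + e"
    by (simp add: I_def \<alpha>_def \<beta>_def)
qed

lemma lp_space_iff_integrable:
  "x \<in> lp_space p \<longleftrightarrow> integrable (count_space UNIV) (\<lambda>n. \<bar>x n\<bar> powr p)"
  by (simp add: lp_space_def integrable_count_space_nat_iff)

lemma lp_norm_eq_integral:
  "x \<in> lp_space p \<Longrightarrow> lp_norm p x = (\<integral>n. \<bar>x n\<bar> powr p \<partial>count_space UNIV) powr (1 / p)"
  by (simp add: lp_norm_def lp_space_iff_integrable integral_count_space_nat)

lemma subspace_lp:
  assumes "p \<ge> 1"
  shows "subspace (lp_space p)"
  unfolding subspace_def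
proof (intro conjI allI ballI)
  show "x + y \<in> lp_space p" if "x \<in> lp_space p" "y \<in> lp_space p" for x y
    using that assms integrable_powr_add[of x "count_space UNIV" y p]
    by (simp add: lp_space_iff_integrable)
  show "c *\<^sub>R x \<in> lp_space p" if "x \<in> lp_space p" for c x
    using that by (simp add: lp_space_def scaleR_fun_def abs_mult powr_mult)
qed (use assms in \<open>simp add: lp_space_def\<close>)

lemma lp_norm_upper:
  assumes p: "p \<ge> 1" and x: "x \<in> lp_space p"
  shows "\<bar>x n\<bar> \<le> lp_norm p x"
proof -
  have "(\<Sum>i\<in>{n}. \<bar>x i\<bar> powr p) \<le> (\<Sum>i. \<bar>x i\<bar> powr p)"
    using x by (intro sum_le_suminf) (auto simp: lp_space_def)
  then have "(\<bar>x n\<bar> powr p) powr (1 / p) \<le> lp_norm p x"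
    unfolding lp_norm_def using p by (intro powr_mono2) auto
  then show ?thesis using p by (simp add: powr_powr)
qed

lemma norm_on_lp:
  assumes p: "p \<ge> 1"
  shows "norm_on (lp_space p) (lp_norm p)"
  unfolding norm_on_def
proof (intro conjI ballI allI)
  fix x assume x: "x \<in> lp_space p"
  show "0 \<le> lp_norm p x" by (simp add: lp_norm_def)
  show "lp_norm p x = 0 \<longleftrightarrow> x = 0"
  proof
    assume "lp_norm p x = 0"
    then show "x = 0" using lp_norm_upper[OF p x] by (auto simp: fun_eq_iff)
  qed (use p in \<open>simp add: lp_norm_def\<close>)
  show "lp_norm p (c *\<^sub>R x) = \<bar>c\<bar> * lp_norm p x" for c
    using x p by (simp add: lp_norm_def lp_space_def scaleR_fun_def abs_mult powr_mult
        suminf_mult suminf_nonneg powr_powr)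
  fix y assume y: "y \<in> lp_space p"
  have "x + y \<in> lp_space p" using subspace_lp[OF p] x y by (rule subspace_add)
  then show "lp_norm p (x + y) \<le> lp_norm p x + lp_norm p y"
    using Minkowski_integral[of x "count_space UNIV" y p] x y p
    by (simp add: lp_norm_eq_integral) (simp add: lp_space_iff_integrable)
qed

lemma symmetric_blocks_lp:
  assumes p: "p \<ge> 1"
  shows "symmetric_blocks (lp_space p) (lp_norm p) (\<lambda>i k x. x i) 1"
proof
  show "functional_on (lp_space p) (\<lambda>x. x i)" for i :: nat
    by (simp add: functional_on_def scaleR_fun_def)
  show "(\<lambda>i. x i) \<longlonglongrightarrow> 0" if "x \<in> lp_space p" for x
  proof -
    have "(\<lambda>i. \<bar>x i\<bar> powr p) \<longlonglongrightarrow> 0" using that by (intro summable_LIMSEQ_zero) (simp add: lp_space_def)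
    then have "(\<lambda>i. (\<bar>x i\<bar> powr p) powr (1 / p)) \<longlonglongrightarrow> 0"
      by (rule tendsto_zero_powrI[OF _ tendsto_const]) (use p in simp_all)
    moreover have "(\<bar>x i\<bar> powr p) powr (1 / p) = \<bar>x i\<bar>" for i using p by (simp add: powr_powr)
    ultimately have "(\<lambda>i. \<bar>x i\<bar>) \<longlonglongrightarrow> 0" by (simp only:)
    then show ?thesis by (rule tendsto_rabs_zero_cancel)
  qed
  show "\<exists>x'\<in>lp_space p. lp_norm p x' \<le> lp_norm p x \<and> (\<forall>i k. x' i = \<epsilon> i * x (\<pi> i))"
    if \<pi>: "bij \<pi>" and \<epsilon>: "\<And>i. \<epsilon> i \<in> {1, -1}" and x: "x \<in> lp_space p" for \<pi> \<epsilon> and x :: "nat \<Rightarrow> real"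
  proof (intro bexI[of _ "\<lambda>i. \<epsilon> i * x (\<pi> i)"] conjI)
    have abs: "\<bar>\<epsilon> i * x (\<pi> i)\<bar> = \<bar>x (\<pi> i)\<bar>" for i using \<epsilon>[of i] by auto
    show x': "(\<lambda>i. \<epsilon> i * x (\<pi> i)) \<in> lp_space p"
      using x unfolding lp_space_iff_integrable abs
      by (rule integrable_bij_count_space[OF \<pi>, THEN iffD2])
    have "lp_norm p (\<lambda>i. \<epsilon> i * x (\<pi> i)) = lp_norm p x"
      unfolding lp_norm_eq_integral[OF x'] lp_norm_eq_integral[OF x] abs
      by (simp only: integral_bij_count_space[OF \<pi>, of "\<lambda>i. \<bar>x i\<bar> powr p"])
    then show "lp_norm p (\<lambda>i. \<epsilon> i * x (\<pi> i)) \<le> lp_norm p x" by simp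
  qed simp
  have "summable (\<lambda>i. \<bar>if i = 0 then 1 else 0 :: real\<bar> powr p)"
    by (rule summable_finite[of "{0}"]) (use p in auto)
  then show "\<exists>e\<in>lp_space p. \<forall>i. e i = (if i = 0 then 1 else 0)"
    by (intro bexI[of _ "\<lambda>i. if i = 0 then 1 else 0"]) (auto simp: lp_space_def)
qed (use p in \<open>auto simp: subspace_lp norm_on_lp lp_norm_upper fun_eq_iff\<close>)

section \<open>Continuous functions on the unit interval\<close>

text \<open>
  A continuous function \<open>f\<close> on \<open>[0,1]\<close> is determined by its values at \<open>0\<close> and at the points
  \<open>(1 / 2) ^ n\<close> together with the deviations of \<open>f\<close> from linear interpolation on the intervals
  between these points, each of which is rescaled to \<open>[1/2, 1]\<close>. Composing with
  \<open>clip\<close> extends the deviations continuously by zero. Both kinds of data tend to zero,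
  once \<open>f 0\<close> is subtracted from the values, and may be prescribed arbitrarily subject to this.
\<close>
definition clip :: "real \<Rightarrow> real" where
  "clip s = max (1 / 2) (min 1 s)"

definition bend :: "nat \<Rightarrow> (real \<Rightarrow> real) \<Rightarrow> real \<Rightarrow> real" where
  "bend n f s = f ((1 / 2) ^ n * clip s) - (2 * clip s - 1) * f ((1 / 2) ^ n)
     - (2 - 2 * clip s) * f ((1 / 2) ^ Suc n)"

text \<open>
  The value at \<open>0\<close>, which is not small, takes the first place and moves the other values by one.
  In this way it becomes part of a sequence converging to zero that may be permuted.
\<close>
definition knot :: "nat \<Rightarrow> (real \<Rightarrow> real) \<Rightarrow> real" where
  "knot n f = (case n of 0 \<Rightarrow> f 0 | Suc m \<Rightarrow> f ((1 / 2) ^ m) - f 0)"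

definition C01_coord :: "nat \<Rightarrow> nat \<Rightarrow> (real \<Rightarrow> real) \<Rightarrow> real" where
  "C01_coord n k f = (case k of 0 \<Rightarrow> knot n f | Suc l \<Rightarrow> bend n f (of_rat (nat_to_rat_surj l)))"

definition tent :: "real \<Rightarrow> real" where
  "tent x = max 0 (min (2 * x - 1) (2 - x))"

lemma clip_bounds: "1 / 2 \<le> clip s" "clip s \<le> 1"
  by (auto simp: clip_def)

lemma clip_eq: "1 / 2 \<le> s \<Longrightarrow> s \<le> 1 \<Longrightarrow> clip s = s"
  by (auto simp: clip_def)

lemma bend_clip: "bend n f (clip s) = bend n f s"
  by (simp add: bend_def clip_eq[OF clip_bounds])

lemma bend_eq_0:
  assumes "s \<le> 1 / 2 \<or> 1 \<le> s"
  shows "bend n f s = 0"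
proof -
  from assms have "clip s = 1 / 2 \<or> clip s = 1" by (auto simp: clip_def)
  then show ?thesis by (elim disjE) (simp_all only: bend_def, simp_all)
qed

lemma point_in_dyadic_interval:
  fixes x :: real
  assumes "0 < x" "x \<le> 1"
  obtains k s where "1 / 2 \<le> s" "s \<le> 1" "x = (1 / 2) ^ k * s"
proof -
  define n where "n = (LEAST n. (1 / 2 :: real) ^ n < x)"
  have ex: "\<exists>n. (1 / 2 :: real) ^ n < x" using assms by (intro real_arch_pow_inv) auto
  then have n: "(1 / 2 :: real) ^ n < x" unfolding n_def by (rule LeastI_ex)
  have "n \<noteq> 0" using n assms by (cases n) auto
  then obtain k where k: "n = Suc k" by (cases n) auto
  have "\<not> (1 / 2 :: real) ^ k < x" using not_less_Least[of k "\<lambda>n. (1 / 2 :: real) ^ n < x"] k by (simp add: n_def)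
  then show thesis
    using n that[of "2 ^ k * x" k] unfolding k by (simp add: power_divide field_simps)
qed

lemma dyadic_in_01: "1 / 2 \<le> s \<Longrightarrow> s \<le> 1 \<Longrightarrow> (1 / 2 :: real) ^ n * s \<in> {0..1}"
  using mult_mono[of "(1 / 2 :: real) ^ n" 1 s 1] by (simp add: power_le_one)

lemma pow_in_01: "(1 / 2 :: real) ^ n \<in> {0..1}"
  using dyadic_in_01[of 1 n] by simp

lemma C01_bounded:
  assumes "f \<in> C01_space"
  shows "bdd_above ((\<lambda>x. \<bar>f x\<bar>) ` {0..1})"
proof -
  have "compact ((\<lambda>x. \<bar>f x\<bar>) ` {0..1})"
    using assms by (intro compact_continuous_image continuous_intros) (auto simp: C01_space_def)
  then show ?thesis by (intro bounded_imp_bdd_above compact_imp_bounded)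
qed

lemma C01_norm_upper: "f \<in> C01_space \<Longrightarrow> x \<in> {0..1} \<Longrightarrow> \<bar>f x\<bar> \<le> C01_norm f"
  unfolding C01_norm_def by (rule cSUP_upper[OF _ C01_bounded])

lemma subspace_C01: "subspace C01_space"
  unfolding subspace_def C01_space_def
  by (auto simp: plus_fun_def zero_fun_def scaleR_fun_def intro!: continuous_intros)

lemma functional_coord: "functional_on V (C01_coord n k)"
  unfolding functional_on_def
  by (auto simp: C01_coord_def knot_def bend_def scaleR_fun_def algebra_simps split: nat.split)

lemma convex_pair_le:
  fixes c u v :: real
  assumes "\<bar>u\<bar> \<le> c" "\<bar>v\<bar> \<le> c"
  shows "\<bar>(2 * clip s - 1) * u + (2 - 2 * clip s) * v\<bar> \<le> c"
proof -
  have "\<bar>(2 * clip s - 1) * u + (2 - 2 * clip s) * v\<bar>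
      \<le> (2 * clip s - 1) * \<bar>u\<bar> + (2 - 2 * clip s) * \<bar>v\<bar>"
    using clip_bounds[of s] by (intro order_trans[OF abs_triangle_ineq]) (simp add: abs_mult)
  also have "\<dots> \<le> (2 * clip s - 1) * c + (2 - 2 * clip s) * c"
    using clip_bounds[of s] assms by (intro add_mono mult_left_mono) auto
  finally show ?thesis by (simp add: algebra_simps)
qed

lemma bend_le:
  assumes "\<And>x. x \<in> {0..(1 / 2) ^ n} \<Longrightarrow> \<bar>f x - c\<bar> \<le> d"
  shows "\<bar>bend n f s\<bar> \<le> 2 * d"
proof -
  have in_range: "(1 / 2 :: real) ^ n * clip s \<in> {0..(1 / 2) ^ n}" "(1 / 2 :: real) ^ Suc n \<in> {0..(1 / 2) ^ n}"
    "(1 / 2 :: real) ^ n \<in> {0..(1 / 2) ^ n}"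
    using clip_bounds[of s] by (auto simp: mult_left_le)
  have "bend n f s = (f ((1 / 2) ^ n * clip s) - c)
      - ((2 * clip s - 1) * (f ((1 / 2) ^ n) - c) + (2 - 2 * clip s) * (f ((1 / 2) ^ Suc n) - c))"
    by (simp add: bend_def algebra_simps)
  then show ?thesis
    using assms[OF in_range(1)] convex_pair_le[OF assms[OF in_range(3)] assms[OF in_range(2)], of s]
    by linarith
qed

lemma coord_le_norm:
  assumes f: "f \<in> C01_space"
  shows "\<bar>C01_coord n k f\<bar> \<le> 2 * C01_norm f"
proof (cases k)
  case 0
  show ?thesis
  proof (cases n)
    case 0
    then show ?thesis
      using C01_norm_upper[OF f, of 0] \<open>k = 0\<close> by (simp add: C01_coord_def knot_def)
  next
    case (Suc m)
    then show ?thesis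
      using C01_norm_upper[OF f, of 0] C01_norm_upper[OF f pow_in_01[of m]] \<open>k = 0\<close>
      by (simp add: C01_coord_def knot_def)
  qed
next
  case (Suc l)
  have "\<bar>f x - 0\<bar> \<le> C01_norm f" if "x \<in> {0..(1 / 2) ^ n}" for x
    using C01_norm_upper[OF f, of x] pow_in_01[of n] that by auto
  from bend_le[OF this] show ?thesis by (simp add: C01_coord_def Suc)
qed

lemma bend_continuous:
  assumes "f \<in> C01_space"
  shows "continuous_on UNIV (bend n f)"
  unfolding bend_def
proof (intro continuous_intros)
  have "continuous_on UNIV (f \<circ> (\<lambda>s. (1 / 2) ^ n * clip s))"
  proof (rule continuous_on_compose)
    have "(\<lambda>s. (1 / 2) ^ n * clip s) ` UNIV \<subseteq> {0..1}"
      using dyadic_in_01[OF clip_bounds] by auto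
    then show "continuous_on ((\<lambda>s. (1 / 2) ^ n * clip s) ` UNIV) f"
      using assms by (auto simp: C01_space_def intro: continuous_on_subset)
  qed (auto simp: clip_def intro!: continuous_intros)
  then show "continuous_on UNIV (\<lambda>s. f ((1 / 2) ^ n * clip s))" by (simp add: o_def)
qed (auto simp: clip_def intro!: continuous_intros)

lemma bend_le_coord:
  assumes f: "f \<in> C01_space" and le: "\<And>k. \<bar>C01_coord n k f\<bar> \<le> c"
  shows "\<bar>bend n f s\<bar> \<le> c"
proof -
  have "\<bar>bend n f q\<bar> \<le> c" if "q \<in> \<rat>" for q
  proof -
    from that obtain q' :: rat where q': "q = of_rat q'" by (auto elim: Rats_cases)
    obtain l where "q' = nat_to_rat_surj l" using surj_nat_to_rat_surj by (metis surjD)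
    then show ?thesis using le[of "Suc l"] q' by (simp add: C01_coord_def)
  qed
  moreover have "continuous_on (closure \<rat>) (\<lambda>s. \<bar>bend n f s\<bar>)"
    using bend_continuous[OF f] by (auto intro!: continuous_intros intro: continuous_on_subset)
  ultimately show ?thesis
    using continuous_le_on_closure[of "\<rat>" "\<lambda>s. \<bar>bend n f s\<bar>" s c] by (simp add: Rats_closure_real)
qed

lemma value_le_coord:
  assumes f: "f \<in> C01_space" and le: "\<And>n k. \<bar>C01_coord n k f\<bar> \<le> c" and x: "x \<in> {0..1}"
  shows "\<bar>f x\<bar> \<le> 3 * c"
proof -
  have f0: "\<bar>f 0\<bar> \<le> c" using le[of 0 0] by (simp add: C01_coord_def knot_def)
  have pow: "\<bar>f ((1 / 2) ^ n)\<bar> \<le> 2 * c" for n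
    using le[of "Suc n" 0] f0 by (simp add: C01_coord_def knot_def)
  show ?thesis
  proof (cases "x = 0")
    case False
    then have "0 < x" "x \<le> 1" using x by auto
    then obtain k s where s: "1 / 2 \<le> s" "s \<le> 1" "x = (1 / 2) ^ k * s"
      by (rule point_in_dyadic_interval)
    have "f x = bend k f s + ((2 * clip s - 1) * f ((1 / 2) ^ k) + (2 - 2 * clip s) * f ((1 / 2) ^ Suc k))"
      using s by (simp add: bend_def clip_eq)
    then show ?thesis
      using bend_le_coord[OF f le, of k s] convex_pair_le[OF pow[of k] pow[of "Suc k"], of s] by linarith
  next
    case True
    moreover have "0 \<le> c" using f0 by linarith
    ultimately show ?thesis using f0 by simp
  qed
qed

definition C01_block_norm :: "(real \<Rightarrow> real) \<Rightarrow> real" where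
  "C01_block_norm f = (SUP i. \<bar>C01_coord (fst i) (snd i) f\<bar>)"

lemma coord_bdd: "f \<in> C01_space \<Longrightarrow> bdd_above (range (\<lambda>i. \<bar>C01_coord (fst i) (snd i) f\<bar>))"
  using coord_le_norm[of f] by (auto simp: bdd_above_def)

lemma coord_le_block_norm: "f \<in> C01_space \<Longrightarrow> \<bar>C01_coord n k f\<bar> \<le> C01_block_norm f"
  unfolding C01_block_norm_def using cSUP_upper[OF _ coord_bdd, of "(n, k)" f] by simp

lemma coord_total:
  assumes f: "f \<in> C01_space" and "\<And>n k. C01_coord n k f = 0"
  shows "f = 0"
proof (rule ext)
  fix x show "f x = 0 x"
    using value_le_coord[OF f, of 0 x] assms by (cases "x \<in> {0..1}") (auto simp: C01_space_def)
qed

lemma equivalent_norms_C01: "equivalent_norms C01_space C01_norm C01_block_norm"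
proof -
  have "1 / 3 * C01_norm f \<le> C01_block_norm f \<and> C01_block_norm f \<le> 2 * C01_norm f" if f: "f \<in> C01_space" for f
  proof
    have "C01_norm f \<le> 3 * C01_block_norm f"
      unfolding C01_norm_def using value_le_coord[OF f coord_le_block_norm[OF f]]
      by (intro cSUP_least) auto
    then show "1 / 3 * C01_norm f \<le> C01_block_norm f" by simp
    show "C01_block_norm f \<le> 2 * C01_norm f"
      unfolding C01_block_norm_def using coord_le_norm[OF f] by (intro cSUP_least) auto
  qed
  then show ?thesis
    unfolding equivalent_norms_def by (intro exI[of _ "1 / 3 :: real"] exI[of _ "2 :: real"] conjI) auto
qed

definition C01_block_size :: "(real \<Rightarrow> real) \<Rightarrow> nat \<Rightarrow> real" where
  "C01_block_size f n = (SUP k. \<bar>C01_coord n k f\<bar>)"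

lemma coord_le_block_size: "f \<in> C01_space \<Longrightarrow> \<bar>C01_coord n k f\<bar> \<le> C01_block_size f n"
  unfolding C01_block_size_def using coord_le_norm[of f n]
  by (intro cSUP_upper) (auto simp: bdd_above_def)

lemma C01_block_size_tendsto_0:
  assumes f: "f \<in> C01_space"
  shows "C01_block_size f \<longlonglongrightarrow> 0"
proof (rule LIMSEQ_I)
  fix e :: real assume e: "e > 0"
  have "continuous_on {0..1} f" using f by (simp add: C01_space_def)
  then obtain d where d: "d > 0" "\<And>x. x \<in> {0..1} \<Longrightarrow> \<bar>x - 0\<bar> < d \<Longrightarrow> \<bar>f x - f 0\<bar> < e / 4"
    using e unfolding continuous_on_iff dist_real_def
    by (metis atLeastAtMost_iff order_refl zero_le_one divide_pos_pos zero_less_numeral)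
  obtain K where K: "(1 / 2 :: real) ^ K < d"
    using real_arch_pow_inv[OF d(1), of "1 / 2"] by auto
  have "norm (C01_block_size f n - 0) < e" if n: "n \<ge> Suc K" for n
  proof -
    have small: "\<bar>f x - f 0\<bar> \<le> e / 4" if "x \<in> {0..(1 / 2) ^ K}" for x
      using d(2)[of x] that K pow_in_01[of K] by auto
    have pow: "(1 / 2 :: real) ^ m \<in> {0..(1 / 2) ^ K}" if "m \<ge> K" for m
      using that by (auto intro: power_decreasing)
    have "\<bar>C01_coord n k f\<bar> \<le> e / 2" for k
    proof (cases k)
      case 0
      obtain m where "n = Suc m" "m \<ge> K" using n by (cases n) auto
      then show ?thesis using small[OF pow[of m]] e 0 by (simp add: C01_coord_def knot_def)
    next
      case (Suc l)
      have "\<bar>f x - f 0\<bar> \<le> e / 4" if "x \<in> {0..(1 / 2) ^ n}" for x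
      proof (rule small)
        have "(1 / 2 :: real) ^ n \<le> (1 / 2) ^ K" using n by (intro power_decreasing) auto
        then have "x \<le> (1 / 2) ^ K" using that by (meson atLeastAtMost_iff order_trans)
        then show "x \<in> {0..(1 / 2) ^ K}" using that by simp
      qed
      from bend_le[OF this] show ?thesis using Suc by (simp add: C01_coord_def)
    qed
    then have "C01_block_size f n \<le> e / 2" unfolding C01_block_size_def by (intro cSUP_least) auto
    moreover have "0 \<le> C01_block_size f n" using coord_le_block_size[OF f, of n 0] by linarith
    ultimately show ?thesis using e by simp
  qed
  then show "\<exists>K. \<forall>n\<ge>K. norm (C01_block_size f n - 0) < e" by blast
qed

text \<open>
  A continuous function with prescribed values and deviations is the sum of tent functions peaked
  at \<open>(1 / 2) ^ n\<close> and of rescaled deviations. At every point at most two consecutive summands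
  are nonzero, so that the series converges uniformly.
\<close>
lemma C01_glue:
  fixes c :: "nat \<Rightarrow> real" and g :: "nat \<Rightarrow> real \<Rightarrow> real" and E :: "nat \<Rightarrow> real"
  assumes g_cont: "\<And>n. continuous_on UNIV (g n)"
    and g_0: "\<And>n s. s \<le> 1 / 2 \<or> 1 \<le> s \<Longrightarrow> g n s = 0"
    and g_clip: "\<And>n s. g n (clip s) = g n s"
    and E: "E \<longlonglongrightarrow> 0" "\<And>n. \<bar>c (Suc n)\<bar> \<le> E n" "\<And>n s. \<bar>g n s\<bar> \<le> E n"
  obtains f where "f \<in> C01_space" "\<And>n. knot n f = c n" "\<And>n s. bend n f s = g n s"
proof -
  define T where "T n x = c (Suc n) * tent (2 ^ n * x) + g n (2 ^ n * x)" for n x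
  define f where "f x = (if x \<in> {0..1} then c 0 + (\<Sum>n. T n x) else 0)" for x
  have tent_0: "tent x = 0" if "x \<le> 1 / 2 \<or> 2 \<le> x" for x using that by (auto simp: tent_def)
  have tent_le: "\<bar>tent x\<bar> \<le> 1" for x by (auto simp: tent_def max_def min_def)
  have T_le: "\<bar>T n x\<bar> \<le> 2 * E n" for n x
  proof -
    have "\<bar>c (Suc n) * tent (2 ^ n * x)\<bar> \<le> E n * 1"
      unfolding abs_mult using E(2)[of n] tent_le by (intro mult_mono) auto
    then show ?thesis using E(3)[of n "2 ^ n * x"] unfolding T_def by linarith
  qed
  have T_0: "T n 0 = 0" for n by (simp add: T_def tent_def g_0)
  have T_dyadic: "T n ((1 / 2) ^ k * s) = 0" if s: "1 / 2 \<le> s" "s \<le> 1" and n: "n \<notin> {k, Suc k}" for n k s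
  proof -
    have eq: "2 ^ n * ((1 / 2) ^ k * s) = 2 ^ n / 2 ^ k * s" by (simp add: power_divide)
    define y where "y = 2 ^ n / 2 ^ k * s"
    consider "n < k" | "n \<ge> Suc (Suc k)" using n by fastforce
    then have "y \<le> 1 / 2 \<or> 2 \<le> y"
    proof cases
      case 1
      then have "(2 :: real) ^ Suc n \<le> 2 ^ k" by (intro power_increasing) auto
      then have "2 ^ n / 2 ^ k \<le> (1 / 2 :: real)" by (simp add: field_simps)
      then have "y \<le> 1 / 2 * 1" unfolding y_def using s by (intro mult_mono) auto
      then show ?thesis by simp
    next
      case 2
      then have "(2 :: real) ^ Suc (Suc k) \<le> 2 ^ n" by (intro power_increasing) auto
      then have "(4 :: real) \<le> 2 ^ n / 2 ^ k" by (simp add: field_simps)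
      then have "4 * (1 / 2) \<le> y" unfolding y_def using s by (intro mult_mono) auto
      then show ?thesis by simp
    qed
    then have "tent y = 0" "g n y = 0" by (auto intro: tent_0 g_0)
    then show ?thesis unfolding T_def eq y_def[symmetric] by simp
  qed
  have two_terms: "\<exists>I. finite I \<and> card I \<le> 2 \<and> (\<forall>n. n \<notin> I \<longrightarrow> T n x = 0)" if x: "x \<in> {0..1}" for x
  proof (cases "x = 0")
    case False
    then have "0 < x" "x \<le> 1" using x by auto
    then obtain k s where "1 / 2 \<le> s" "s \<le> 1" "x = (1 / 2) ^ k * s"
      by (rule point_in_dyadic_interval)
    then show ?thesis using T_dyadic by (intro exI[of _ "{k, Suc k}"]) auto
  qed (use T_0 in \<open>auto intro: exI[of _ "{}"]\<close>)
  have limit: "uniform_limit {0..1} (\<lambda>m x. c 0 + (\<Sum>n<m. T n x)) f sequentially"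
  proof (rule uniform_limitI)
    fix e :: real assume e: "e > 0"
    have "eventually (\<lambda>n. E n < e / 6) sequentially" using E(1) e by (intro order_tendstoD) auto
    then obtain K where K: "\<And>n. n \<ge> K \<Longrightarrow> E n < e / 6" by (auto simp: eventually_sequentially)
    have "dist (c 0 + (\<Sum>n<m. T n x)) (f x) < e" if m: "m \<ge> K" and x: "x \<in> {0..1}" for m x
    proof -
      obtain I where I: "finite I" "card I \<le> 2" "\<And>n. n \<notin> I \<Longrightarrow> T n x = 0" using two_terms[OF x] by blast
      have "(\<Sum>n. T n x) = (\<Sum>n\<in>I. T n x)" using I by (intro suminf_finite) auto
      moreover have "(\<Sum>n<m. T n x) = (\<Sum>n\<in>I \<inter> {..<m}. T n x)"
        using I by (intro sum.mono_neutral_right) auto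
      moreover have "(\<Sum>n\<in>I. T n x) = (\<Sum>n\<in>I \<inter> {..<m}. T n x) + (\<Sum>n\<in>I - {..<m}. T n x)"
        using I by (subst sum.Int_Diff[of I _ "{..<m}"]) auto
      ultimately have "dist (c 0 + (\<Sum>n<m. T n x)) (f x) = \<bar>\<Sum>n\<in>I - {..<m}. T n x\<bar>"
        using x by (simp add: f_def dist_real_def)
      also have "\<dots> \<le> (\<Sum>n\<in>I - {..<m}. \<bar>T n x\<bar>)" by (rule sum_abs)
      also have "\<dots> \<le> (\<Sum>n\<in>I - {..<m}. e / 3)"
      proof (rule sum_mono)
        fix n assume "n \<in> I - {..<m}"
        then show "\<bar>T n x\<bar> \<le> e / 3" using K[of n] T_le[of n x] m by auto
      qed
      also have "\<dots> = real (card (I - {..<m})) * (e / 3)" by simp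
      also have "\<dots> \<le> 2 * (e / 3)"
        using I card_mono[of I "I - {..<m}"] e by (intro mult_right_mono) auto
      finally show ?thesis using e by simp
    qed
    then show "\<forall>\<^sub>F m in sequentially. \<forall>x\<in>{0..1}. dist (c 0 + (\<Sum>n<m. T n x)) (f x) < e"
      unfolding eventually_sequentially by blast
  qed
  have "continuous_on {0..1} (\<lambda>x. c 0 + (\<Sum>n<m. T n x))" for m
  proof -
    have "continuous_on UNIV (\<lambda>x. g n (2 ^ n * x))" for n
      using continuous_on_compose2[OF g_cont[of n], of UNIV "\<lambda>x. 2 ^ n * x"] by (auto intro!: continuous_intros)
    then have "continuous_on UNIV (\<lambda>x. c 0 + (\<Sum>n<m. T n x))"
      unfolding T_def tent_def by (intro continuous_intros) auto
    then show ?thesis by (rule continuous_on_subset) auto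
  qed
  then have "\<forall>\<^sub>F m in sequentially. continuous_on {0..1} (\<lambda>x. c 0 + (\<Sum>n<m. T n x))"
    by (intro always_eventually allI)
  then have "continuous_on {0..1} f" by (rule uniform_limit_theorem[OF _ limit]) simp
  then have f: "f \<in> C01_space" by (simp add: C01_space_def f_def)
  have f_dyadic: "f ((1 / 2) ^ k * s) = c 0 + c (Suc k) * (2 * s - 1) + c (Suc (Suc k)) * (2 - 2 * s) + g k s"
    if s: "1 / 2 \<le> s" "s \<le> 1" for k s
  proof -
    have arg: "2 ^ k * ((1 / 2) ^ k * s) = s" "2 ^ Suc k * ((1 / 2) ^ k * s) = 2 * s"
      by (simp_all add: power_divide)
    have tents: "tent s = 2 * s - 1" "tent (2 * s) = 2 - 2 * s" "g (Suc k) (2 * s) = 0"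
      using s by (auto simp: tent_def max_def min_def g_0)
    have "T k ((1 / 2) ^ k * s) = c (Suc k) * (2 * s - 1) + g k s"
      unfolding T_def arg tents ..
    moreover have "T (Suc k) ((1 / 2) ^ k * s) = c (Suc (Suc k)) * (2 - 2 * s) + 0"
      unfolding T_def arg tents ..
    moreover have "(\<Sum>n. T n ((1 / 2) ^ k * s)) = (\<Sum>n\<in>{k, Suc k}. T n ((1 / 2) ^ k * s))"
      using T_dyadic[OF s] by (intro suminf_finite) auto
    ultimately have "(\<Sum>n. T n ((1 / 2) ^ k * s))
        = c (Suc k) * (2 * s - 1) + g k s + c (Suc (Suc k)) * (2 - 2 * s)" by simp
    then show ?thesis using dyadic_in_01[OF s, of k] by (simp add: f_def)
  qed
  have f_0: "f 0 = c 0" by (simp add: f_def T_0)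
  have f_pow: "f ((1 / 2) ^ k) = c 0 + c (Suc k)" for k
    using f_dyadic[of 1 k] g_0[of 1 k] by simp
  show thesis
  proof (rule that[OF f])
    show "knot n f = c n" for n by (auto simp: knot_def f_0 f_pow split: nat.split)
    show "bend n f s = g n s" for n s
      unfolding bend_def f_pow f_dyadic[OF clip_bounds] g_clip by (simp add: algebra_simps)
  qed
qed

lemma symmetric_blocks_C01: "symmetric_blocks C01_space C01_block_norm C01_coord 1"
proof
  show "norm_on C01_space C01_block_norm"
    unfolding C01_block_norm_def
    by (rule norm_on_SUP_functionals[OF subspace_C01 functional_coord coord_bdd]) (auto intro: coord_total)
  show "(\<lambda>i. C01_coord i k f) \<longlonglongrightarrow> 0" if "f \<in> C01_space" for k f
    using coord_le_block_size[OF that]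
    by (intro Lim_null_comparison[OF _ C01_block_size_tendsto_0[OF that]]) (auto intro: always_eventually)
  show "\<exists>f'\<in>C01_space. C01_block_norm f' \<le> C01_block_norm f \<and> (\<forall>i k. C01_coord i k f' = \<epsilon> i * C01_coord (\<pi> i) k f)"
    if \<pi>: "bij \<pi>" and \<epsilon>: "\<And>i. \<epsilon> i \<in> {1, -1}" and f: "f \<in> C01_space" for \<pi> \<epsilon> f
  proof -
    have abs: "\<bar>\<epsilon> i * y\<bar> = \<bar>y\<bar>" for i y using \<epsilon>[of i] by auto
    have size: "\<bar>knot n f\<bar> \<le> C01_block_size f n" "\<bar>bend n f s\<bar> \<le> C01_block_size f n" for n s
      using coord_le_block_size[OF f, of n 0] bend_le_coord[OF f coord_le_block_size[OF f], of n s]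
      by (simp_all add: C01_coord_def)
    have size0: "0 \<le> C01_block_size f n" for n using size(1)[of n] by linarith
    have lim: "(\<lambda>n. C01_block_size f (\<pi> n)) \<longlonglongrightarrow> 0"
      by (rule tendsto_zero_reindex[OF C01_block_size_tendsto_0[OF f] bij_is_inj[OF \<pi>]])
    obtain f' where f': "f' \<in> C01_space" "\<And>n. knot n f' = \<epsilon> n * knot (\<pi> n) f"
      "\<And>n s. bend n f' s = \<epsilon> n * bend (\<pi> n) f s"
    proof (rule C01_glue[of "\<lambda>n s. \<epsilon> n * bend (\<pi> n) f s"
          "\<lambda>n. C01_block_size f (\<pi> n) + C01_block_size f (\<pi> (Suc n))" "\<lambda>n. \<epsilon> n * knot (\<pi> n) f"])
      show "continuous_on UNIV (\<lambda>s. \<epsilon> n * bend (\<pi> n) f s)" for n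
        using bend_continuous[OF f] by (intro continuous_intros)
      show "(\<lambda>n. C01_block_size f (\<pi> n) + C01_block_size f (\<pi> (Suc n))) \<longlonglongrightarrow> 0"
        using tendsto_add[OF lim LIMSEQ_Suc[OF lim]] by simp
      show "\<bar>\<epsilon> (Suc n) * knot (\<pi> (Suc n)) f\<bar> \<le> C01_block_size f (\<pi> n) + C01_block_size f (\<pi> (Suc n))" for n
        unfolding abs using size(1)[of "\<pi> (Suc n)"] size0[of "\<pi> n"] by linarith
      show "\<bar>\<epsilon> n * bend (\<pi> n) f s\<bar> \<le> C01_block_size f (\<pi> n) + C01_block_size f (\<pi> (Suc n))" for n s
        unfolding abs using size(2)[of "\<pi> n" s] size0[of "\<pi> (Suc n)"] by linarith
    qed (auto simp: bend_eq_0 bend_clip)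
    have coord: "C01_coord i k f' = \<epsilon> i * C01_coord (\<pi> i) k f" for i k
      by (simp add: C01_coord_def f' split: nat.split)
    have "C01_block_norm f' \<le> C01_block_norm f"
      unfolding C01_block_norm_def[of f'] coord abs
      by (intro cSUP_least) (auto intro: coord_le_block_norm[OF f])
    then show ?thesis using f' coord by blast
  qed
  show "\<exists>e\<in>C01_space. \<forall>i. C01_coord i 0 e = (if i = 0 then 1 else 0)"
  proof (intro bexI[of _ "\<lambda>x. if x \<in> {0..1} then 1 else 0"] allI)
    show "(\<lambda>x. if x \<in> {0..1} then 1 else 0) \<in> C01_space"
      using continuous_on_cong[of "{0..1::real}" "{0..1}" "\<lambda>x. if x \<in> {0..1} then 1 else 0" "\<lambda>_. 1 :: real"]
      by (simp add: C01_space_def)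
    show "C01_coord i 0 (\<lambda>x. if x \<in> {0..1} then 1 else 0) = (if i = 0 then 1 else 0)" for i
      using pow_in_01 by (auto simp: C01_coord_def knot_def split: nat.split)
  qed
qed (auto simp: subspace_C01 functional_coord coord_le_block_norm coord_total)

section \<open>Integrable functions on the unit interval\<close>

text \<open>
  Dominated convergence extends the hypothesis to all rays. Then the positive and the negative
  part have equal integrals over all rays, hence define the same measure, and by uniqueness of
  densities they agree almost everywhere.
\<close>
lemma AE_zero_if_integrals_over_rational_rays_zero:
  fixes f :: "real \<Rightarrow> real"
  assumes f: "integrable lebesgue f"
    and zero: "\<And>q. q \<in> \<rat> \<Longrightarrow> (\<integral>x. indicator {q<..} x * f x \<partial>lebesgue) = 0"
  shows "AE x in lebesgue. f x = 0"
proof -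
  have "f \<in> borel_measurable lebesgue" using f by simp
  then obtain g where g [measurable]: "g \<in> borel_measurable lborel" and fg: "AE x in lborel. f x = g x"
    using completion_ex_borel_measurable_real by blast
  have fg': "AE x in lebesgue. f x = g x" using fg by (rule AE_completion)
  have g_leb [measurable]: "g \<in> borel_measurable lebesgue" using g by (rule measurable_completion)
  have [measurable]: "{q<..} \<in> sets lebesgue" for q :: real by simp
  have f_meas [measurable]: "f \<in> borel_measurable lebesgue" using f by simp
  have g_int: "integrable lborel g"
    using integrable_cong_AE[OF _ g_leb fg'] f g by (simp add: integrable_completion)
  have rational_ray: "(\<integral>x. indicator {q<..} x * g x \<partial>lborel) = 0" if "q \<in> \<rat>" for q
  proof -
    have "(\<integral>x. indicator {q<..} x * g x \<partial>lborel) = (\<integral>x. indicator {q<..} x * g x \<partial>lebesgue)"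
      by (subst integral_completion) auto
    also have "\<dots> = (\<integral>x. indicator {q<..} x * f x \<partial>lebesgue)"
      using fg' by (intro integral_cong_AE) (measurable, auto)
    finally show ?thesis using zero[OF that] by simp
  qed
  have ray: "(\<integral>x. indicator {a<..} x * g x \<partial>lborel) = 0" for a :: real
  proof -
    have "\<exists>q. q \<in> \<rat> \<and> a < q \<and> q < a + 1 / real (Suc i)" for i
      using Rats_dense_in_real[of a "a + 1 / real (Suc i)"] by auto
    then obtain q where q: "\<And>i. q i \<in> \<rat>" "\<And>i. a < q i" "\<And>i. q i < a + 1 / real (Suc i)" by metis
    have "q \<longlonglongrightarrow> a"
    proof (rule tendsto_sandwich[OF _ _ tendsto_const])
      show "(\<lambda>i. a + 1 / real (Suc i)) \<longlonglongrightarrow> a"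
        using tendsto_add[OF tendsto_const LIMSEQ_inverse_real_of_nat, of a] by (simp add: inverse_eq_divide)
    qed (use q in \<open>auto intro!: always_eventually less_imp_le\<close>)
    have "(\<lambda>i. \<integral>x. indicator {q i<..} x * g x \<partial>lborel) \<longlonglongrightarrow> (\<integral>x. indicator {a<..} x * g x \<partial>lborel)"
    proof (rule integral_dominated_convergence[where w = "\<lambda>x. \<bar>g x\<bar>"])
      show "AE x in lborel. (\<lambda>i. indicator {q i<..} x * g x) \<longlonglongrightarrow> indicator {a<..} x * g x"
      proof (intro AE_I2)
        fix x
        have "eventually (\<lambda>i. indicator {q i<..} x * g x = indicator {a<..} x * g x) sequentially"
        proof (cases "a < x")
          case True
          then have "eventually (\<lambda>i. q i < x) sequentially"
            using \<open>q \<longlonglongrightarrow> a\<close> by (simp add: order_tendstoD)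
          then show ?thesis by eventually_elim (use True in simp)
        next
          case False
          then have "\<not> q i < x" for i using q(2)[of i] by linarith
          then show ?thesis using False by simp
        qed
        then show "(\<lambda>i. indicator {q i<..} x * g x) \<longlonglongrightarrow> indicator {a<..} x * g x"
          by (rule tendsto_eventually)
      qed
    qed (use g_int in \<open>auto simp: indicator_def\<close>)
    then show ?thesis using rational_ray[OF q(1)] by (simp add: LIMSEQ_const_iff)
  qed
  have pos: "integrable lborel (\<lambda>x. max 0 (g x))" and neg: "integrable lborel (\<lambda>x. max 0 (- g x))"
    using g_int by (auto intro: Bochner_Integration.integrable_max)
  have pos_ray: "integrable lborel (\<lambda>x. indicator {a<..} x * max 0 (g x))"
    and neg_ray: "integrable lborel (\<lambda>x. indicator {a<..} x * max 0 (- g x))" for a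
    using pos neg by (auto intro!: integrable_mult_indicator[where 'b = real, simplified])
  have measure_ray: "emeasure (density lborel (\<lambda>x. ennreal (max 0 (u x)))) {a<..}
      = ennreal (\<integral>x. indicator {a<..} x * max 0 (u x) \<partial>lborel)"
    if u: "u \<in> borel_measurable lborel" "integrable lborel (\<lambda>x. indicator {a<..} x * max 0 (u x))" for u :: "real \<Rightarrow> real" and a :: real
  proof -
    have "emeasure (density lborel (\<lambda>x. ennreal (max 0 (u x)))) {a<..}
        = (\<integral>\<^sup>+x. ennreal (indicator {a<..} x * max 0 (u x)) \<partial>lborel)"
      using u(1) by (subst emeasure_density) (auto intro!: nn_integral_cong simp: indicator_def)
    also have "\<dots> = ennreal (\<integral>x. indicator {a<..} x * max 0 (u x) \<partial>lborel)"
      using u(2) by (intro nn_integral_eq_integral) auto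
    finally show ?thesis .
  qed
  have "density lborel (\<lambda>x. ennreal (max 0 (g x))) = density lborel (\<lambda>x. ennreal (max 0 (- g x)))"
  proof (rule measure_eqI_lessThan)
    fix a :: real
    have "(\<integral>x. indicator {a<..} x * max 0 (g x) \<partial>lborel) - (\<integral>x. indicator {a<..} x * max 0 (- g x) \<partial>lborel)
        = (\<integral>x. indicator {a<..} x * max 0 (g x) - indicator {a<..} x * max 0 (- g x) \<partial>lborel)"
      using pos_ray neg_ray by (simp add: Bochner_Integration.integral_diff)
    also have "\<dots> = (\<integral>x. indicator {a<..} x * g x \<partial>lborel)"
      by (intro Bochner_Integration.integral_cong) (auto simp: max_def indicator_def)
    finally show "emeasure (density lborel (\<lambda>x. ennreal (max 0 (g x)))) {a<..}
        = emeasure (density lborel (\<lambda>x. ennreal (max 0 (- g x)))) {a<..}"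
      using ray[of a] pos_ray neg_ray by (simp add: measure_ray)
    show "emeasure (density lborel (\<lambda>x. ennreal (max 0 (g x)))) {a<..} < \<infinity>"
      using pos_ray by (simp add: measure_ray)
  qed auto
  then have "AE x in lborel. ennreal (max 0 (g x)) = ennreal (max 0 (- g x))"
    by (subst (asm) sigma_finite_measure.density_unique_iff) (auto simp: lborel.sigma_finite_measure_axioms)
  then have "AE x in lborel. g x = 0"
    by eventually_elim (auto simp: max_def split: if_splits)
  then show ?thesis using AE_completion fg' by fastforce
qed

text \<open>
  Representatives on the whole line that vanish outside \<open>(0, 1]\<close>, for which Lebesgue integrals may
  be transformed affinely. The point \<open>0\<close> is excluded because it lies in no dyadic interval.
\<close>
definition Lp_reps :: "real \<Rightarrow> (real \<Rightarrow> real) set" where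
  "Lp_reps p = {f \<in> borel_measurable lebesgue. (\<forall>x. x \<notin> {0<..1} \<longrightarrow> f x = 0) \<and>
     integrable lebesgue (\<lambda>x. \<bar>f x\<bar> powr p)}"

lemma leb01_integral:
  fixes f :: "real \<Rightarrow> real"
  assumes "\<And>x. x \<notin> {0<..1} \<Longrightarrow> f x = 0"
  shows "integrable leb01 f \<longleftrightarrow> integrable lebesgue f" "(\<integral>x. f x \<partial>leb01) = (\<integral>x. f x \<partial>lebesgue)"
proof -
  have "indicator {0..1} x *\<^sub>R f x = f x" for x
    using assms[of x] by (cases "x \<in> {0<..1}") (auto simp: indicator_def)
  then have eq: "(\<lambda>x. indicator {0..1} x *\<^sub>R f x) = f" by (rule ext)
  show "integrable leb01 f \<longleftrightarrow> integrable lebesgue f" "(\<integral>x. f x \<partial>leb01) = (\<integral>x. f x \<partial>lebesgue)"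
    using integrable_restrict_space[of "{0..1}" lebesgue f] integral_restrict_space[of "{0..1}" lebesgue f]
    unfolding eq by simp_all
qed

lemma Lp_reps_ae_equal: "f \<in> Lp_reps p \<Longrightarrow> ae_equal f f"
  by (simp add: Lp_reps_def ae_equal_def measurable_restrict_space1)

lemma Lp_reps_powr_zero: "f \<in> Lp_reps p \<Longrightarrow> x \<notin> {0<..1} \<Longrightarrow> \<bar>f x\<bar> powr p = 0"
  by (simp add: Lp_reps_def)

lemma abs_in_Lp_space: "f \<in> Lp_reps p \<Longrightarrow> abs_ae_fun f \<in> Lp_space p"
  using leb01_integral(1)[OF Lp_reps_powr_zero[of f p]] Lp_reps_ae_equal[of f p]
  by (simp add: Lp_space_def Lp_integrable.abs_eq Lp_reps_def)

lemma Lp_norm_abs: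
  "f \<in> Lp_reps p \<Longrightarrow> Lp_norm p (abs_ae_fun f) = (\<integral>x. \<bar>f x\<bar> powr p \<partial>lebesgue) powr (1 / p)"
  using leb01_integral(2)[OF Lp_reps_powr_zero[of f p]] Lp_reps_ae_equal[of f p]
  by (simp add: Lp_norm.abs_eq)

lemma Lp_space_rep:
  assumes "F \<in> Lp_space p"
  obtains f where "f \<in> Lp_reps p" "F = abs_ae_fun f"
proof -
  obtain f0 where f0: "ae_equal f0 f0" "F = abs_ae_fun f0"
    by (rule ae_fun.abs_induct[of "\<lambda>F'. F = F' \<longrightarrow> thesis", THEN mp, OF _ refl]) (use that in blast)
  define f where "f x = (if x \<in> {0<..1} then f0 x else 0)" for x
  have f0_meas: "f0 \<in> borel_measurable leb01" using f0 by (simp add: ae_equal_def)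
  then have "f0 \<in> borel_measurable (lebesgue_on {0<..1})"
    by (rule measurable_restrict_mono) auto
  then have f_meas: "f \<in> borel_measurable lebesgue"
    unfolding f_def by (subst borel_measurable_if) auto
  have "AE x in lebesgue. x \<noteq> (0 :: real)" by (rule AE_completion[OF AE_lborel_singleton])
  then have "AE x in leb01. x \<noteq> 0"
    by (subst AE_restrict_space_iff) (auto elim: eventually_mono)
  moreover have "AE x in leb01. x \<in> {0..1}" using AE_space[of leb01] by simp
  ultimately have ae: "AE x in leb01. f0 x = f x" by eventually_elim (auto simp: f_def)
  have f_meas': "f \<in> borel_measurable leb01" using f_meas by (rule measurable_restrict_space1)
  have eq: "ae_equal f0 f" using f0_meas f_meas' ae by (simp add: ae_equal_def)
  have F: "F = abs_ae_fun f"
    using eq f0 Quotient3_rel[OF Quotient3_ae_fun, of f0 f] by simp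
  have "ae_equal f f" using f_meas' by (simp add: ae_equal_def)
  then have "integrable leb01 (\<lambda>x. \<bar>f x\<bar> powr p)"
    using assms unfolding F Lp_space_def by (simp add: Lp_integrable.abs_eq)
  moreover have "\<bar>f x\<bar> powr p = 0" if "x \<notin> {0<..1}" for x using that by (auto simp: f_def)
  ultimately have "integrable lebesgue (\<lambda>x. \<bar>f x\<bar> powr p)"
    using leb01_integral(1)[of "\<lambda>x. \<bar>f x\<bar> powr p"] by blast
  moreover have "f x = 0" if "x \<notin> {0<..1}" for x using that by (auto simp: f_def)
  ultimately have "f \<in> Lp_reps p" using f_meas by (simp add: Lp_reps_def)
  then show thesis using F by (rule that)
qed

lemma Lp_reps_add:
  assumes p: "p \<ge> 1" and f: "f \<in> Lp_reps p" and g: "g \<in> Lp_reps p"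
  shows "(\<lambda>x. f x + g x) \<in> Lp_reps p" "abs_ae_fun f + abs_ae_fun g = abs_ae_fun (\<lambda>x. f x + g x)"
  using f g integrable_powr_add[of f lebesgue g p, OF _ _ p] Lp_reps_ae_equal[OF f] Lp_reps_ae_equal[OF g]
  by (auto simp: Lp_reps_def plus_ae_fun.abs_eq)

lemma Lp_reps_scale:
  assumes f: "f \<in> Lp_reps p"
  shows "(\<lambda>x. c * f x) \<in> Lp_reps p" "c *\<^sub>R abs_ae_fun f = abs_ae_fun (\<lambda>x. c * f x)"
  using f Lp_reps_ae_equal[OF f] by (auto simp: Lp_reps_def scaleR_ae_fun.abs_eq abs_mult powr_mult)

lemma abs_ae_fun_eq_0_iff:
  assumes f: "f \<in> Lp_reps p"
  shows "abs_ae_fun f = 0 \<longleftrightarrow> (AE x in lebesgue. f x = 0)"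
proof -
  have "abs_ae_fun f = 0 \<longleftrightarrow> ae_equal f (\<lambda>_. 0)"
    using Lp_reps_ae_equal[OF f] Quotient3_rel[OF Quotient3_ae_fun, of f "\<lambda>_. 0"]
    by (simp add: zero_ae_fun.abs_eq ae_equal_def)
  also have "\<dots> \<longleftrightarrow> (AE x in leb01. f x = 0)"
    using Lp_reps_ae_equal[OF f] by (simp add: ae_equal_def)
  also have "\<dots> \<longleftrightarrow> (AE x in lebesgue. x \<in> {0..1} \<longrightarrow> f x = 0)"
    by (rule AE_restrict_space_iff) simp
  also have "\<dots> \<longleftrightarrow> (AE x in lebesgue. f x = 0)"
  proof (rule AE_cong)
    fix x show "(x \<in> {0..1} \<longrightarrow> f x = 0) \<longleftrightarrow> f x = 0"
      using f by (cases "x \<in> {0<..1}") (auto simp: Lp_reps_def)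
  qed
  finally show ?thesis .
qed

lemma Lp_reps_zero: "p \<ge> 1 \<Longrightarrow> (\<lambda>_. 0) \<in> Lp_reps p"
  by (simp add: Lp_reps_def)

lemma subspace_Lp:
  assumes p: "p \<ge> 1"
  shows "subspace (Lp_space p)"
  unfolding subspace_def
proof (intro conjI allI ballI)
  show "0 \<in> Lp_space p"
    using abs_in_Lp_space[OF Lp_reps_zero[OF p]] by (simp add: zero_ae_fun.abs_eq)
  fix F assume F: "F \<in> Lp_space p"
  obtain f where f: "f \<in> Lp_reps p" "F = abs_ae_fun f" using Lp_space_rep[OF F] .
  show "c *\<^sub>R F \<in> Lp_space p" for c
    using f abs_in_Lp_space[OF Lp_reps_scale(1)[OF f(1)]] by (simp add: Lp_reps_scale)
  fix G assume G: "G \<in> Lp_space p"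
  obtain g where g: "g \<in> Lp_reps p" "G = abs_ae_fun g" using Lp_space_rep[OF G] .
  show "F + G \<in> Lp_space p"
    using f g abs_in_Lp_space[OF Lp_reps_add(1)[OF p f(1) g(1)]] by (simp add: Lp_reps_add[OF p])
qed

lemma norm_on_Lp:
  assumes p: "p \<ge> 1"
  shows "norm_on (Lp_space p) (Lp_norm p)"
  unfolding norm_on_def
proof (intro conjI ballI allI)
  fix F assume F: "F \<in> Lp_space p"
  obtain f where f: "f \<in> Lp_reps p" "F = abs_ae_fun f" using Lp_space_rep[OF F] .
  have int: "integrable lebesgue (\<lambda>x. \<bar>f x\<bar> powr p)" using f by (simp add: Lp_reps_def)
  show "0 \<le> Lp_norm p F" using f by (simp add: Lp_norm_abs)
  have "Lp_norm p F = 0 \<longleftrightarrow> (\<integral>x. \<bar>f x\<bar> powr p \<partial>lebesgue) = 0"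
    using f p by (simp add: Lp_norm_abs)
  also have "\<dots> \<longleftrightarrow> (AE x in lebesgue. \<bar>f x\<bar> powr p = 0)"
    by (rule integral_nonneg_eq_0_iff_AE[OF int]) simp
  also have "\<dots> \<longleftrightarrow> F = 0" using f by (simp add: abs_ae_fun_eq_0_iff)
  finally show "Lp_norm p F = 0 \<longleftrightarrow> F = 0" .
  show "Lp_norm p (c *\<^sub>R F) = \<bar>c\<bar> * Lp_norm p F" for c
    using f p Lp_norm_abs[OF Lp_reps_scale(1)[OF f(1)], of c]
    by (simp add: Lp_norm_abs Lp_reps_scale abs_mult powr_mult powr_powr)
  fix G assume G: "G \<in> Lp_space p"
  obtain g where g: "g \<in> Lp_reps p" "G = abs_ae_fun g" using Lp_space_rep[OF G] .
  show "Lp_norm p (F + G) \<le> Lp_norm p F + Lp_norm p G"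
    using f g Lp_norm_abs[OF Lp_reps_add(1)[OF p f(1) g(1)]] Minkowski_integral[of f lebesgue g p, OF _ _ p]
    by (simp add: Lp_norm_abs Lp_reps_add[OF p]) (simp add: Lp_reps_def)
qed

definition piece :: "nat \<Rightarrow> real set" where
  "piece n = {x. 1 / 2 < 2 ^ n * x \<and> 2 ^ n * x \<le> 1}"

text \<open>
  At index \<open>0\<close> the threshold is below every rescaled interval, whose coordinate is then the
  integral over all of it; the other thresholds run through the rational numbers.
\<close>
definition threshold :: "nat \<Rightarrow> real" where
  "threshold k = (case k of 0 \<Rightarrow> 0 | Suc l \<Rightarrow> of_rat (nat_to_rat_surj l))"

definition part :: "nat \<Rightarrow> nat \<Rightarrow> real set" where
  "part n k = {x \<in> piece n. threshold k < 2 ^ n * x}"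

text \<open>
  The weight makes the coordinates of \<open>f\<close> in the piece \<open>n\<close> equal to those of the rescaled function
  \<open>2 powr (- n / p) * f (x / 2 ^ n)\<close> on the first piece, whose norm is that of \<open>f\<close> on the piece \<open>n\<close>.
\<close>
lift_definition Lp_coord :: "real \<Rightarrow> nat \<Rightarrow> nat \<Rightarrow> ae_fun \<Rightarrow> real" is
  "\<lambda>p n k f. (2 ^ n) powr (1 - 1 / p) * (\<integral>x. indicator (part n k) x * f x \<partial>leb01)"
proof -
  fix p :: real and n k :: nat and f g :: "real \<Rightarrow> real"
  assume fg: "ae_equal f g"
  have "part n k \<in> sets lebesgue" by (simp add: part_def piece_def)
  then have "indicator (part n k) \<in> borel_measurable leb01"
    by (intro measurable_restrict_space1) (rule borel_measurable_indicator)
  then have "(\<integral>x. indicator (part n k) x * f x \<partial>leb01) = (\<integral>x. indicator (part n k) x * g x \<partial>leb01)"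
    using fg unfolding ae_equal_def
    by (intro integral_cong_AE borel_measurable_times) (auto elim!: eventually_mono)
  then show "(2 ^ n) powr (1 - 1 / p) * (\<integral>x. indicator (part n k) x * f x \<partial>leb01)
      = (2 ^ n) powr (1 - 1 / p) * (\<integral>x. indicator (part n k) x * g x \<partial>leb01)" by simp
qed

lemma piece_interval: "piece n = {1 / 2 / 2 ^ n <.. 1 / 2 ^ n}"
  by (auto simp: piece_def field_simps)

lemma piece_measurable [measurable]: "piece n \<in> sets borel"
  by (simp add: piece_interval)

lemma part_measurable [measurable]: "part n k \<in> sets borel"
  unfolding part_def piece_def by measurable

lemma piece_subset: "piece n \<subseteq> {0<..1}"
proof
  fix x assume x: "x \<in> piece n"
  then have "0 < 2 ^ n * x" by (auto simp: piece_def)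
  then have "0 < x" by (simp add: zero_less_mult_iff)
  moreover have "1 * x \<le> 2 ^ n * x" using \<open>0 < x\<close> by (intro mult_right_mono) auto
  moreover have "2 ^ n * x \<le> 1" using x by (simp add: piece_def)
  ultimately have "x \<le> 1" by linarith
  then show "x \<in> {0<..1}" using \<open>0 < x\<close> by simp
qed

lemma part_subset: "part n k \<subseteq> piece n"
  by (auto simp: part_def)

lemma piece_unique:
  assumes "x \<in> piece n" "x \<in> piece m"
  shows "n = m"
proof -
  have *: False if "n < m" "x \<in> piece n" "x \<in> piece m" for n m
  proof -
    have "(2 :: real) ^ Suc n \<le> 2 ^ m" using that by (intro power_increasing) auto
    moreover have "0 \<le> x" using piece_subset that by force
    ultimately have "2 ^ Suc n * x \<le> 2 ^ m * x" by (rule mult_right_mono)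
    then show False using that by (auto simp: piece_def)
  qed
  show ?thesis using *[of n m] *[of m n] assms by (meson linorder_neqE_nat)
qed

lemma piece_exists:
  assumes "x \<in> {0<..1}"
  obtains n where "x \<in> piece n"
proof -
  obtain k s where s: "1 / 2 \<le> s" "s \<le> 1" "x = (1 / 2) ^ k * s"
    using assms by (auto intro: point_in_dyadic_interval[of x])
  have "2 ^ k * x = s" by (simp add: s power_divide)
  then have "x \<in> piece (if s = 1 / 2 then Suc k else k)" using s(1,2) by (auto simp: piece_def mult.assoc)
  then show thesis by (rule that)
qed

lemma Lp_coord_abs:
  assumes "f \<in> Lp_reps p"
  shows "Lp_coord p n k (abs_ae_fun f)
    = (2 ^ n) powr (1 - 1 / p) * (\<integral>x. indicator (part n k) x * f x \<partial>lebesgue)"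
proof -
  have "indicator (part n k) x * f x = 0" if "x \<notin> {0<..1}" for x
    using assms that by (simp add: Lp_reps_def)
  from leb01_integral(2)[OF this] show ?thesis
    using Lp_reps_ae_equal[OF assms] by (simp add: Lp_coord.abs_eq)
qed

lemma indicator_powr_integrable:
  assumes "f \<in> Lp_reps p"
  shows "integrable lebesgue (\<lambda>x. indicator (piece n) x * \<bar>f x\<bar> powr p)"
  using assms integrable_mult_indicator[of "piece n" lebesgue "\<lambda>x. \<bar>f x\<bar> powr p"]
  by (simp add: Lp_reps_def)

lemma measure_piece: "integrable lebesgue (indicator (piece n) :: real \<Rightarrow> real)"
  "(\<integral>x. indicator (piece n) x \<partial>lebesgue) = (1 / 2 / 2 ^ n :: real)"
proof -
  have le: "1 / 2 / 2 ^ n \<le> (1 / 2 ^ n :: real)" by (simp add: field_simps)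
  have "emeasure lborel (piece n) = ennreal (1 / 2 / 2 ^ n)"
    using le by (simp add: piece_interval field_simps)
  then have *: "emeasure lebesgue (piece n) = ennreal (1 / 2 / 2 ^ n)"
    by simp
  then show "integrable lebesgue (indicator (piece n) :: real \<Rightarrow> real)"
    by (intro integrable_real_indicator) auto
  show "(\<integral>x. indicator (piece n) x \<partial>lebesgue) = (1 / 2 / 2 ^ n :: real)"
    using * by (simp add: measure_def)
qed

text \<open>
  A substitute for Hoelder's inequality: pointwise \<open>\<bar>f\<bar> \<le> d + d powr (1 - p) * \<bar>f\<bar> powr p\<close>, since
  the second summand dominates where \<open>\<bar>f\<bar>\<close> exceeds \<open>d\<close>. Optimising \<open>d\<close> costs a factor \<open>2\<close> only.
\<close>
lemma integrable_on_piece: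
  assumes p: "p \<ge> 1" and f: "f \<in> Lp_reps p"
  shows "integrable lebesgue (\<lambda>x. indicator (part n k) x * f x)"
    and "d > 0 \<Longrightarrow> \<bar>\<integral>x. indicator (part n k) x * f x \<partial>lebesgue\<bar>
      \<le> d / 2 ^ n + d powr (1 - p) * (\<integral>x. indicator (piece n) x * \<bar>f x\<bar> powr p \<partial>lebesgue)"
proof -
  have [measurable]: "f \<in> borel_measurable lebesgue" using f by (simp add: Lp_reps_def)
  have [measurable]: "part n k \<in> sets lebesgue" by simp
  have pointwise: "\<bar>indicator (part n k) x * f x\<bar>
      \<le> d * indicator (piece n) x + d powr (1 - p) * (indicator (piece n) x * \<bar>f x\<bar> powr p)"
    if d: "d > 0" for d x
  proof (cases "x \<in> part n k")
    case True
    then have "x \<in> piece n" using part_subset by blast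
    moreover have "\<bar>f x\<bar> \<le> d + d powr (1 - p) * \<bar>f x\<bar> powr p"
    proof (cases "\<bar>f x\<bar> \<le> d")
      case False
      have "\<bar>f x\<bar> = \<bar>f x\<bar> powr (1 - p) * \<bar>f x\<bar> powr p"
        using False d by (simp add: powr_add[symmetric])
      also have "\<dots> \<le> d powr (1 - p) * \<bar>f x\<bar> powr p"
        using False d p by (intro mult_right_mono powr_mono2') auto
      finally show ?thesis using d by linarith
    qed (use d in \<open>simp add: add_increasing2\<close>)
    ultimately show ?thesis using True by simp
  qed (use d in simp)
  have dom: "integrable lebesgue (\<lambda>x. d * indicator (piece n) x
      + d powr (1 - p) * (indicator (piece n) x * \<bar>f x\<bar> powr p))" for d
    using measure_piece(1) indicator_powr_integrable[OF f]
    by (intro Bochner_Integration.integrable_add integrable_mult_right)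
  show int: "integrable lebesgue (\<lambda>x. indicator (part n k) x * f x)"
  proof (rule Bochner_Integration.integrable_bound[OF dom[of 1]])
    show "AE x in lebesgue. norm (indicator (part n k) x * f x) \<le> norm (1 * indicator (piece n) x
      + 1 powr (1 - p) * (indicator (piece n) x * \<bar>f x\<bar> powr p))"
      using pointwise[of 1] by (intro AE_I2) (auto intro: order_trans[OF _ abs_ge_self])
  qed measurable
  assume d: "d > 0"
  have "\<bar>\<integral>x. indicator (part n k) x * f x \<partial>lebesgue\<bar> \<le> (\<integral>x. \<bar>indicator (part n k) x * f x\<bar> \<partial>lebesgue)"
    by (rule integral_abs_bound)
  also have "\<dots> \<le> (\<integral>x. d * indicator (piece n) x
      + d powr (1 - p) * (indicator (piece n) x * \<bar>f x\<bar> powr p) \<partial>lebesgue)"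
    using int dom pointwise[OF d] by (intro integral_mono integrable_abs)
  also have "\<dots> = d * (1 / 2 / 2 ^ n)
      + d powr (1 - p) * (\<integral>x. indicator (piece n) x * \<bar>f x\<bar> powr p \<partial>lebesgue)"
    using measure_piece[of n] indicator_powr_integrable[OF f, of n]
    by (simp add: Bochner_Integration.integral_add)
  also have "d * (1 / 2 / 2 ^ n) \<le> d / 2 ^ n" using d by (simp add: field_simps)
  finally show "\<bar>\<integral>x. indicator (part n k) x * f x \<partial>lebesgue\<bar>
      \<le> d / 2 ^ n + d powr (1 - p) * (\<integral>x. indicator (piece n) x * \<bar>f x\<bar> powr p \<partial>lebesgue)"
    by simp
qed

lemma Lp_coord_bound:
  assumes p: "p \<ge> 1" and f: "f \<in> Lp_reps p" and D: "D > 0"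
    and le: "(\<integral>x. indicator (piece n) x * \<bar>f x\<bar> powr p \<partial>lebesgue) \<le> D"
  shows "\<bar>Lp_coord p n k (abs_ae_fun f)\<bar> \<le> 2 * D powr (1 / p)"
proof -
  \<comment> \<open>with this choice the two bounds of \<open>integrable_on_piece\<close> agree\<close>
  define d where "d = (D * 2 ^ n) powr (1 / p)"
  have d: "d > 0" using D by (simp add: d_def)
  have dp: "d powr p = D * 2 ^ n" using D p by (simp add: d_def powr_powr)
  have "d powr (1 - p) * D = d / 2 ^ n" using d D by (simp add: powr_diff dp)
  moreover have "d powr (1 - p) * (\<integral>x. indicator (piece n) x * \<bar>f x\<bar> powr p \<partial>lebesgue) \<le> d powr (1 - p) * D"
    using le by (rule mult_left_mono) simp
  ultimately have "\<bar>\<integral>x. indicator (part n k) x * f x \<partial>lebesgue\<bar> \<le> 2 * (d / 2 ^ n)"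
    using integrable_on_piece(2)[OF p f d, of n k] by linarith
  then have "\<bar>Lp_coord p n k (abs_ae_fun f)\<bar> \<le> (2 ^ n) powr (1 - 1 / p) * (2 * (d / 2 ^ n))"
    unfolding Lp_coord_abs[OF f] abs_mult[of "_ powr _"] by (intro mult_mono) auto
  also have "\<dots> = 2 * D powr (1 / p)"
    using D by (simp add: d_def powr_mult powr_diff)
  finally show ?thesis .
qed

lemma Lp_coord_le_norm:
  assumes p: "p \<ge> 1" and F: "F \<in> Lp_space p"
  shows "\<bar>Lp_coord p n k F\<bar> \<le> 2 * Lp_norm p F"
proof (rule field_le_epsilon)
  fix e :: real assume e: "e > 0"
  obtain f where f: "f \<in> Lp_reps p" "F = abs_ae_fun f" using Lp_space_rep[OF F] .
  define D where "D = (Lp_norm p F + e / 2) powr p"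
  have norm0: "0 \<le> Lp_norm p F" using norm_on_Lp[OF p] F by (simp add: norm_on_def)
  then have D: "D > 0" using e by (simp add: D_def)
  have "(\<integral>x. indicator (piece n) x * \<bar>f x\<bar> powr p \<partial>lebesgue) \<le> (\<integral>x. \<bar>f x\<bar> powr p \<partial>lebesgue)"
    using f indicator_powr_integrable[OF f(1)]
    by (intro integral_mono) (auto simp: Lp_reps_def indicator_def)
  also have "\<dots> = Lp_norm p F powr p" using f p by (simp add: Lp_norm_abs powr_powr)
  also have "\<dots> \<le> D" unfolding D_def using e p norm0 by (intro powr_mono2) auto
  finally have "\<bar>Lp_coord p n k F\<bar> \<le> 2 * D powr (1 / p)"
    unfolding f(2) by (rule Lp_coord_bound[OF p f(1) D])
  also have "\<dots> = 2 * Lp_norm p F + e" using p e norm0 by (simp add: D_def powr_powr)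
  finally show "\<bar>Lp_coord p n k F\<bar> \<le> 2 * Lp_norm p F + e" .
qed

lemma Lp_coord_decay:
  assumes p: "p \<ge> 1" and F: "F \<in> Lp_space p"
  shows "(\<lambda>n. Lp_coord p n k F) \<longlonglongrightarrow> 0"
proof (rule LIMSEQ_I)
  fix e :: real assume e: "e > 0"
  obtain f where f: "f \<in> Lp_reps p" "F = abs_ae_fun f" using Lp_space_rep[OF F] .
  have [measurable]: "f \<in> borel_measurable lebesgue" using f by (simp add: Lp_reps_def)
  have [measurable]: "piece n \<in> sets lebesgue" for n by simp
  have "(\<lambda>n. \<integral>x. indicator (piece n) x * \<bar>f x\<bar> powr p \<partial>lebesgue) \<longlonglongrightarrow> (\<integral>x. 0 \<partial>(lebesgue :: real measure))"
  proof (rule integral_dominated_convergence[where w = "\<lambda>x. \<bar>f x\<bar> powr p"])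
    show "AE x in lebesgue. (\<lambda>n. indicator (piece n) x * \<bar>f x\<bar> powr p) \<longlonglongrightarrow> 0"
    proof (intro AE_I2)
      fix x :: real
      have "eventually (\<lambda>n. x \<notin> piece n) sequentially"
      proof (cases "\<exists>m. x \<in> piece m")
        case True
        then obtain m where "x \<in> piece m" by blast
        then show ?thesis
          using piece_unique by (intro eventually_sequentiallyI[of "Suc m"]) fastforce
      qed auto
      then have "eventually (\<lambda>n. indicator (piece n) x * \<bar>f x\<bar> powr p = 0) sequentially"
        by eventually_elim simp
      then show "(\<lambda>n. indicator (piece n) x * \<bar>f x\<bar> powr p) \<longlonglongrightarrow> 0" by (rule tendsto_eventually)
    qed
  qed (use f in \<open>auto simp: Lp_reps_def indicator_def\<close>)
  then have lim: "(\<lambda>n. \<integral>x. indicator (piece n) x * \<bar>f x\<bar> powr p \<partial>lebesgue) \<longlonglongrightarrow> 0" by simp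
  define D where "D = (e / 4) powr p"
  have D: "D > 0" using e by (simp add: D_def)
  have "eventually (\<lambda>n. (\<integral>x. indicator (piece n) x * \<bar>f x\<bar> powr p \<partial>lebesgue) < D) sequentially"
    using lim D by (rule order_tendstoD)
  then obtain K where K: "\<And>n. n \<ge> K \<Longrightarrow> (\<integral>x. indicator (piece n) x * \<bar>f x\<bar> powr p \<partial>lebesgue) < D"
    by (auto simp: eventually_sequentially)
  have "norm (Lp_coord p n k F - 0) < e" if "n \<ge> K" for n
  proof -
    have "\<bar>Lp_coord p n k F\<bar> \<le> 2 * D powr (1 / p)"
      unfolding f(2) using K[OF that] by (intro Lp_coord_bound[OF p f(1) D]) simp
    also have "\<dots> < e" using p e by (simp add: D_def powr_powr)
    finally show ?thesis by simp
  qed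
  then show "\<exists>K. \<forall>n\<ge>K. norm (Lp_coord p n k F - 0) < e" by blast
qed

lemma functional_Lp_coord:
  assumes p: "p \<ge> 1"
  shows "functional_on (Lp_space p) (Lp_coord p n k)"
  unfolding functional_on_def
proof (intro conjI ballI allI)
  fix F assume F: "F \<in> Lp_space p"
  obtain f where f: "f \<in> Lp_reps p" "F = abs_ae_fun f" using Lp_space_rep[OF F] .
  show "Lp_coord p n k (c *\<^sub>R F) = c * Lp_coord p n k F" for c
    using f Lp_coord_abs[OF Lp_reps_scale(1)[OF f(1)], of n k c]
    by (simp add: Lp_coord_abs Lp_reps_scale mult.left_commute)
  fix G assume G: "G \<in> Lp_space p"
  obtain g where g: "g \<in> Lp_reps p" "G = abs_ae_fun g" using Lp_space_rep[OF G] .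
  show "Lp_coord p n k (F + G) = Lp_coord p n k F + Lp_coord p n k G"
    using f g Lp_coord_abs[OF Lp_reps_add(1)[OF p f(1) g(1)], of n k]
      integrable_on_piece(1)[OF p f(1), of n k] integrable_on_piece(1)[OF p g(1), of n k]
    by (simp add: Lp_coord_abs Lp_reps_add[OF p] distrib_left)
qed

lemma Lp_coord_total:
  assumes p: "p \<ge> 1" and F: "F \<in> Lp_space p" and zero: "\<And>n k. Lp_coord p n k F = 0"
  shows "F = 0"
proof -
  obtain f where f: "f \<in> Lp_reps p" "F = abs_ae_fun f" using Lp_space_rep[OF F] .
  have int0: "(\<integral>x. indicator (part n k) x * f x \<partial>lebesgue) = 0" for n k
    using zero[of n k] f by (simp add: Lp_coord_abs)
  have "AE x in lebesgue. indicator (part n 0) x * f x = 0" for n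
  proof (rule AE_zero_if_integrals_over_rational_rays_zero)
    show "integrable lebesgue (\<lambda>x. indicator (part n 0) x * f x)"
      by (rule integrable_on_piece(1)[OF p f(1)])
    fix q :: real assume "q \<in> \<rat>"
    then have "2 ^ n * q \<in> \<rat>" by simp
    then obtain r where r: "2 ^ n * q = of_rat r" by (auto elim: Rats_cases)
    obtain l where "r = nat_to_rat_surj l" using surj_nat_to_rat_surj by (metis surjD)
    then have th: "threshold (Suc l) = 2 ^ n * q" using r by (simp add: threshold_def)
    have "indicator {q<..} x * (indicator (part n 0) x * f x) = indicator (part n (Suc l)) x * f x" for x
      unfolding part_def th by (auto simp: indicator_def threshold_def piece_def)
    then have eq: "(\<lambda>x. indicator {q<..} x * (indicator (part n 0) x * f x))
        = (\<lambda>x. indicator (part n (Suc l)) x * f x)" by (rule ext)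
    show "(\<integral>x. indicator {q<..} x * (indicator (part n 0) x * f x) \<partial>lebesgue) = 0"
      unfolding eq by (rule int0)
  qed
  then have "AE x in lebesgue. \<forall>n. indicator (part n 0) x * f x = 0"
    unfolding AE_all_countable by blast
  then have "AE x in lebesgue. f x = 0"
  proof eventually_elim
    fix x assume x: "\<forall>n. indicator (part n 0) x * f x = 0"
    show "f x = 0"
    proof (cases "x \<in> {0<..1}")
      case True
      then obtain n where "x \<in> piece n" by (rule piece_exists)
      then have "x \<in> part n 0" by (auto simp: part_def threshold_def piece_def)
      then show ?thesis using x by (metis indicator_simps(1) mult_1)
    qed (use f in \<open>simp add: Lp_reps_def\<close>)
  qed
  then show ?thesis using f by (simp add: abs_ae_fun_eq_0_iff)
qed

text \<open>
  On the piece \<open>n\<close> one uses \<open>f\<close> on the piece \<open>\<pi> n\<close>, rescaled by \<open>r n = 2 ^ n / 2 ^ \<pi> n\<close>; the factor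
  \<open>r n powr (1 / p)\<close> compensates for the change of length.
\<close>
lemma Lp_glue:
  assumes p: "p \<ge> 1" and \<pi>: "bij \<pi>" and \<epsilon>: "\<And>i. \<epsilon> i \<in> {1, -1 :: real}" and f: "f \<in> Lp_reps p"
  shows "\<exists>f'\<in>Lp_reps p. (\<integral>x. \<bar>f' x\<bar> powr p \<partial>lebesgue) = (\<integral>x. \<bar>f x\<bar> powr p \<partial>lebesgue) \<and>
    (\<forall>n k. Lp_coord p n k (abs_ae_fun f') = \<epsilon> n * Lp_coord p (\<pi> n) k (abs_ae_fun f))"
proof -
  have [measurable]: "f \<in> borel_measurable lebesgue" using f by (simp add: Lp_reps_def)
  have [measurable]: "piece n \<in> sets lebesgue" for n by simp
  define r where "r n = (2 ^ n / 2 ^ \<pi> n :: real)" for n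
  have r: "r n > 0" for n by (simp add: r_def)
  have r_piece: "r n * x \<in> piece (\<pi> n) \<longleftrightarrow> x \<in> piece n" for n x by (simp add: piece_def r_def)
  have r_part: "r n * x \<in> part (\<pi> n) k \<longleftrightarrow> x \<in> part n k" for n k x
    unfolding part_def mem_Collect_eq r_piece by (simp add: r_def)
  define u where "u n x = \<epsilon> n * r n powr (1 / p) * f (r n * x)" for n x
  define f' where "f' x = (\<Sum>n. indicator (piece n) x * u n x)" for x
  have f'_piece: "f' x = u n x" if "x \<in> piece n" for n x
  proof -
    have "(\<Sum>m. indicator (piece m) x * u m x) = (\<Sum>m\<in>{n}. indicator (piece m) x * u m x)"
      using piece_unique[OF that] by (intro suminf_finite) (auto simp: indicator_def)
    then show ?thesis using that by (simp add: f'_def)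
  qed
  have f'_outside: "f' x = 0" if "x \<notin> {0<..1}" for x
  proof -
    have "x \<notin> piece n" for n using piece_subset that by blast
    then show ?thesis by (simp add: f'_def)
  qed
  have [measurable]: "(\<lambda>x. f (r n * x)) \<in> borel_measurable lebesgue" for n
    using borel_measurable_affine[of f "r n" 0] r[of n] by simp
  have u_meas [measurable]: "u n \<in> borel_measurable lebesgue" for n
    unfolding u_def by measurable
  have f'_meas [measurable]: "f' \<in> borel_measurable lebesgue"
    unfolding f'_def by (intro borel_measurable_suminf borel_measurable_times u_meas) measurable
  define w where "w n x = ennreal (indicator (piece n) x * \<bar>f x\<bar> powr p)" for n x
  have w_meas [measurable]: "w n \<in> borel_measurable lebesgue" for n unfolding w_def by measurable
  define w' where "w' n x = ennreal (indicator (piece n) x * \<bar>f' x\<bar> powr p)" for n x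
  have w'_meas [measurable]: "w' n \<in> borel_measurable lebesgue" for n unfolding w'_def by measurable
  have decompose: "ennreal (\<bar>h x\<bar> powr p) = (\<Sum>n. ennreal (indicator (piece n) x * \<bar>h x\<bar> powr p))"
    if h: "\<And>x. x \<notin> {0<..1} \<Longrightarrow> h x = 0" for h :: "real \<Rightarrow> real" and x
  proof (cases "x \<in> {0<..1}")
    case True
    then obtain m where m: "x \<in> piece m" by (rule piece_exists)
    have "(\<Sum>n. ennreal (indicator (piece n) x * \<bar>h x\<bar> powr p))
        = (\<Sum>n\<in>{m}. ennreal (indicator (piece n) x * \<bar>h x\<bar> powr p))"
      using piece_unique[OF m] by (intro suminf_finite) (auto simp: indicator_def)
    then show ?thesis using m by simp
  qed (simp add: h)
  have transport: "(\<integral>\<^sup>+x. w' n x \<partial>lebesgue) = (\<integral>\<^sup>+x. w (\<pi> n) x \<partial>lebesgue)" for n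
  proof -
    have "w' n x = ennreal (r n) * w (\<pi> n) (0 + r n * x)" for x
    proof (cases "x \<in> piece n")
      case True
      have "\<bar>u n x\<bar> powr p = r n * \<bar>f (r n * x)\<bar> powr p"
        using \<epsilon>[of n] r[of n] p by (auto simp: u_def abs_mult powr_mult powr_powr)
      then show ?thesis
        using True r[of n] by (simp add: w'_def w_def f'_piece r_piece ennreal_mult)
    qed (simp add: w'_def w_def r_piece)
    then have "(\<integral>\<^sup>+x. w' n x \<partial>lebesgue) = (\<integral>\<^sup>+x. ennreal (r n) * w (\<pi> n) (0 + r n * x) \<partial>lebesgue)"
      by simp
    also have "\<dots> = ennreal (r n) * (\<integral>\<^sup>+x. w (\<pi> n) (0 + r n * x) \<partial>lebesgue)"
    proof (rule nn_integral_cmult)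
      have "(\<lambda>x. indicator (piece n) x * \<bar>f (r n * x)\<bar> powr p) \<in> borel_measurable lebesgue"
        by measurable
      moreover have "w (\<pi> n) (0 + r n * x) = ennreal (indicator (piece n) x * \<bar>f (r n * x)\<bar> powr p)" for x
        using r_piece[of n x] by (simp add: w_def indicator_def)
      ultimately show "(\<lambda>x. w (\<pi> n) (0 + r n * x)) \<in> borel_measurable lebesgue" by simp
    qed
    also have "\<dots> = (\<integral>\<^sup>+x. w (\<pi> n) x \<partial>lebesgue)"
      using nn_integral_real_affine_lebesgue[OF w_meas, of "r n" "\<pi> n" 0] r[of n] by simp
    finally show ?thesis .
  qed
  have "(\<integral>\<^sup>+x. ennreal (\<bar>f' x\<bar> powr p) \<partial>lebesgue) = (\<integral>\<^sup>+x. (\<Sum>n. w' n x) \<partial>lebesgue)"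
    unfolding w'_def by (intro nn_integral_cong decompose f'_outside)
  also have "\<dots> = (\<Sum>n. \<integral>\<^sup>+x. w' n x \<partial>lebesgue)" by (rule nn_integral_suminf) simp
  also have "\<dots> = (\<Sum>n. \<integral>\<^sup>+x. w (\<pi> n) x \<partial>lebesgue)" by (simp add: transport)
  also have "\<dots> = (\<Sum>n. \<integral>\<^sup>+x. w n x \<partial>lebesgue)"
    using nn_integral_bij_count_space[OF \<pi>, of "\<lambda>n. \<integral>\<^sup>+x. w n x \<partial>lebesgue"]
    by (simp add: nn_integral_count_space_nat)
  also have "\<dots> = (\<integral>\<^sup>+x. (\<Sum>n. w n x) \<partial>lebesgue)" by (rule nn_integral_suminf[symmetric]) simp
  also have "\<dots> = (\<integral>\<^sup>+x. ennreal (\<bar>f x\<bar> powr p) \<partial>lebesgue)"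
    unfolding w_def
  proof (intro nn_integral_cong decompose[symmetric])
    show "f x = 0" if "x \<notin> {0<..1}" for x using f that by (simp add: Lp_reps_def)
  qed
  finally have nn: "(\<integral>\<^sup>+x. ennreal (\<bar>f' x\<bar> powr p) \<partial>lebesgue) = (\<integral>\<^sup>+x. ennreal (\<bar>f x\<bar> powr p) \<partial>lebesgue)" .
  have int: "integrable lebesgue (\<lambda>x. \<bar>f' x\<bar> powr p)"
    using f nn unfolding Lp_reps_def integrable_iff_bounded by auto
  have f'_rep: "f' \<in> Lp_reps p" using int f'_outside by (simp add: Lp_reps_def)
  show ?thesis
  proof (intro bexI[OF _ f'_rep] conjI allI)
    show "(\<integral>x. \<bar>f' x\<bar> powr p \<partial>lebesgue) = (\<integral>x. \<bar>f x\<bar> powr p \<partial>lebesgue)"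
      using nn by (simp add: integral_eq_nn_integral)
    show "Lp_coord p n k (abs_ae_fun f') = \<epsilon> n * Lp_coord p (\<pi> n) k (abs_ae_fun f)" for n k
    proof -
      let ?G = "\<lambda>y. indicator (part (\<pi> n) k) y * f y"
      have "indicator (part n k) x * f' x = \<epsilon> n * r n powr (1 / p) * ?G (0 + r n * x)" for x
        using part_subset[of n k] r_part[of n x k] by (auto simp: indicator_def f'_piece u_def)
      then have "(\<integral>x. indicator (part n k) x * f' x \<partial>lebesgue)
          = \<epsilon> n * r n powr (1 / p) * (\<integral>x. ?G (0 + r n * x) \<partial>lebesgue)"
        by simp
      moreover have "(\<integral>y. ?G y \<partial>lebesgue) = r n * (\<integral>x. ?G (0 + r n * x) \<partial>lebesgue)"
        using lebesgue_integral_real_affine[of "r n" ?G 0] r[of n] by simp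
      ultimately have coord: "(\<integral>x. indicator (part n k) x * f' x \<partial>lebesgue)
          = \<epsilon> n * (r n powr (1 / p) / r n) * (\<integral>y. ?G y \<partial>lebesgue)"
        using r[of n] by (simp add: field_simps)
      have weight: "(2 ^ n) powr (1 - 1 / p) * (r n powr (1 / p) / r n) = (2 ^ \<pi> n) powr (1 - 1 / p)"
        by (simp add: r_def powr_divide powr_diff)
      show ?thesis
        unfolding Lp_coord_abs[OF f'_rep] Lp_coord_abs[OF f] coord weight[symmetric]
        by (simp only: mult.assoc mult.left_commute)
    qed
  qed
qed

lemma symmetric_blocks_Lp:
  assumes p: "p \<ge> 1"
  shows "symmetric_blocks (Lp_space p) (Lp_norm p) (Lp_coord p) 2"
proof
  show "\<exists>F'\<in>Lp_space p. Lp_norm p F' \<le> Lp_norm p F \<and> (\<forall>i k. Lp_coord p i k F' = \<epsilon> i * Lp_coord p (\<pi> i) k F)"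
    if \<pi>: "bij \<pi>" and \<epsilon>: "\<And>i. \<epsilon> i \<in> {1, -1}" and F: "F \<in> Lp_space p" for \<pi> \<epsilon> F
  proof -
    obtain f where f: "f \<in> Lp_reps p" "F = abs_ae_fun f" using Lp_space_rep[OF F] .
    obtain f' where f': "f' \<in> Lp_reps p"
      "(\<integral>x. \<bar>f' x\<bar> powr p \<partial>lebesgue) = (\<integral>x. \<bar>f x\<bar> powr p \<partial>lebesgue)"
      "\<And>n k. Lp_coord p n k (abs_ae_fun f') = \<epsilon> n * Lp_coord p (\<pi> n) k (abs_ae_fun f)"
      using Lp_glue[where \<epsilon> = \<epsilon> and \<pi> = \<pi>, OF p \<pi> \<epsilon> f(1)] by blast
    then show ?thesis
      using f abs_in_Lp_space[OF f'(1)] by (intro bexI[of _ "abs_ae_fun f'"]) (auto simp: Lp_norm_abs)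
  qed
  show "\<exists>e\<in>Lp_space p. \<forall>i. Lp_coord p i 0 e = (if i = 0 then 1 else 0)"
  proof -
    define e :: "real \<Rightarrow> real" where "e x = 2 * indicator (piece 0) x" for x
    have "\<bar>e x\<bar> powr p = 2 powr p * indicator (piece 0) x" for x
      using p by (auto simp: e_def indicator_def)
    then have "integrable lebesgue (\<lambda>x. \<bar>e x\<bar> powr p)"
      using measure_piece(1)[of 0] by simp
    moreover have "e \<in> borel_measurable lebesgue"
      unfolding e_def using borel_measurable_integrable[OF measure_piece(1)[of 0]] by simp
    moreover have "e x = 0" if "x \<notin> {0<..1}" for x
      using that piece_subset[of 0] by (auto simp: e_def indicator_def)
    ultimately have e: "e \<in> Lp_reps p" by (simp add: Lp_reps_def)
    have "indicator (part i 0) x * e x = (if i = 0 then 2 * indicator (piece 0) x else 0)" for i x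
      using piece_unique[of x i 0] by (auto simp: e_def part_def threshold_def piece_def indicator_def)
    then have "Lp_coord p i 0 (abs_ae_fun e) = (if i = 0 then 1 else 0)" for i
      using measure_piece(2)[of 0] by (simp add: Lp_coord_abs[OF e])
    then show ?thesis using abs_in_Lp_space[OF e] by blast
  qed
qed (use p in \<open>auto simp: subspace_Lp norm_on_Lp functional_Lp_coord Lp_coord_le_norm
    intro: Lp_coord_total Lp_coord_decay\<close>)

section \<open>Countable groups of isometries\<close>

theorem corollary15:
  fixes H :: "('g, 'm) monoid_scheme"
  assumes "group H" and "countable (carrier H)"
  shows "(representable H c0_space c0_norm \<longleftrightarrow> (\<exists>N. N \<lhd> H \<and> card N = 2)) \<and>
         (representable H C01_space C01_norm \<longleftrightarrow> (\<exists>N. N \<lhd> H \<and> card N = 2)) \<and>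
         (\<forall>p\<ge>1. representable H (lp_space p) (lp_norm p) \<longleftrightarrow> (\<exists>N. N \<lhd> H \<and> card N = 2)) \<and>
         (\<forall>p\<ge>1. representable H (Lp_space p) (Lp_norm p) \<longleftrightarrow> (\<exists>N. N \<lhd> H \<and> card N = 2))"
proof (intro conjI allI impI)
  show "representable H c0_space c0_norm \<longleftrightarrow> (\<exists>N. N \<lhd> H \<and> card N = 2)"
    by (rule symmetric_blocks.representable_iff[OF symmetric_blocks_c0 assms equivalent_norms_refl])
  show "representable H C01_space C01_norm \<longleftrightarrow> (\<exists>N. N \<lhd> H \<and> card N = 2)"
    by (rule symmetric_blocks.representable_iff[OF symmetric_blocks_C01 assms equivalent_norms_C01])
  fix p :: real assume p: "1 \<le> p"
  show "representable H (lp_space p) (lp_norm p) \<longleftrightarrow> (\<exists>N. N \<lhd> H \<and> card N = 2)"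
    by (rule symmetric_blocks.representable_iff[OF symmetric_blocks_lp[OF p] assms equivalent_norms_refl])
  show "representable H (Lp_space p) (Lp_norm p) \<longleftrightarrow> (\<exists>N. N \<lhd> H \<and> card N = 2)"
    by (rule symmetric_blocks.representable_iff[OF symmetric_blocks_Lp[OF p] assms equivalent_norms_refl])
qed

end
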